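(* Fix an integer $k\ge3$ and put $\chi_k=\frac{k-1}{k!}$. Along every sequence $r\to\infty$ with prime powers $q=q_r$ and integers $m=m_r\ge1$ (both allowed to vary) such that $c=\frac mr\binom rk\in\mathbb Z$, with $N=r+c$, $$d_{\mathrm{TV}}\bigl(\mathcal L(X_{N,r}),\mathrm{Poisson}(\mu_{N,r})\bigr)\ge q^{-(\chi_k+o_k(1))mr^{k-1}} .$$ The same lower bound holds for $d_{\mathrm{TV}}(\mathcal L(\mathcal Z_{N,r}),\mathcal L(\mathcal B_r))$ and for $d_{\mathrm{TV}}(\mathcal L(\Xi_r),\mathcal L(\Pi_r))$. Here $o_k(1)$ tends to $0$ as $r\to\infty$, uniformly in $q$ and $m$. Equivalently, $$\limsup_{r\to\infty}\frac{-\log_qd_{\mathrm{TV}}\bigl(\mathcal L(X_{N,r}),\mathrm{Poisson}(\mu_{N,r})\bigr)}{mr^{k-1}}\le\frac{k-1}{k!},$$ and likewise for the random-set and point-process distances.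
   Context: Let $V_N=\mathbb F_q^N$ and let $\Theta_N$ be uniformly random in $\mathrm{Hom}(\Lambda^kV_N,\mathbb F_q^m)$. An $r$-dimensional subspace $H\le V_N$ is null if $\Theta_N(\Lambda^kH)=0$. $\mathcal G_r=\mathrm{Gr}(r,V_N)$ is the set of $r$-dimensional subspaces; $\mathcal Z_{N,r}\subseteq\mathcal G_r$ is the random set of null $r$-spaces; $X_{N,r}=|\mathcal Z_{N,r}|$; $\mu_{N,r}=\mathbb EX_{N,r}$; $\Xi_r=\sum_{H\in\mathcal Z_{N,r}}\delta_H$. Put $p_r=q^{-m\binom rk}=q^{-rc}$. $\mathcal B_r\subseteq\mathcal G_r$ retains each element independently with probability $p_r$; $\Pi_r$ is the Poisson point process on $\mathcal G_r$ with intensity $p_r\sum_{H\in\mathcal G_r}\delta_H$. $\mathcal L$ denotes the law and $d_{\mathrm{TV}}$ total-variation distance (the supremum over events of the difference of probabilities). *)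

theory Defs
  imports
    "HOL-Probability.Probability"
    "HOL-Algebra.AbelCoset"
    "Jordan_Normal_Form.Missing_VectorSpace"
begin

section \<open>Exterior powers of vector spaces over a finite field\<close>

text \<open>
  Finite fields are HOL-Algebra structures with finite carrier and not types, so that one
  statement can range over all prime powers \<open>q\<close>. Every finite field is isomorphic to
  one whose carrier is a set of natural numbers, so already the instance \<open>nat\<close> of the type
  of field elements covers all of them.
\<close>

definition coord_space :: "('a, 'b) ring_scheme \<Rightarrow> nat \<Rightarrow> ('a, nat \<Rightarrow> 'a) module" where
  "coord_space F n = ring.func_space F {..<n}"

text \<open>The quotient \<open>M/W\<close> by a submodule: the additive cosets of \<open>W\<close>, where
  \<open>a \<cdot> C\<close> is \<open>aC + W\<close> (adding \<open>W\<close> only matters if \<open>a = 0\<close>).\<close>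

definition quotient_module ::
  "('a, 'v, 'e) module_scheme \<Rightarrow> 'v set \<Rightarrow> ('a, 'v set) module" where
  "quotient_module M W =
    \<lparr>carrier = a_rcosets\<^bsub>M\<^esub> W, mult = undefined, one = undefined,
     zero = W, add = set_add M,
     smult = (\<lambda>a C. ((\<lambda>x. a \<odot>\<^bsub>M\<^esub> x) ` C) <+>\<^bsub>M\<^esub> W)\<rparr>"

lemma module_quotient:
  assumes "module F M" "Module.submodule W F M"
  shows "module F (quotient_module M W)"
proof -
  interpret M: module F M by fact
  interpret W: Module.submodule W F M by fact
  have sg: "abelian_subgroup W M"
    by (rule abelian_subgroupI3) (auto intro!: additive_subgroupI W.subgroup_axioms M.abelian_group_axioms)
  interpret A: abelian_subgroup W M by (rule sg)
  have smul: "smult (quotient_module M W) a (W +>\<^bsub>M\<^esub> x) = W +>\<^bsub>M\<^esub> (a \<odot>\<^bsub>M\<^esub> x)"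
    if "a \<in> carrier F" "x \<in> carrier M" for a x
  proof -
    have "(\<lambda>x. a \<odot>\<^bsub>M\<^esub> x) ` (W +>\<^bsub>M\<^esub> x) <+>\<^bsub>M\<^esub> W
        = (\<Union>w\<in>W. \<Union>w'\<in>W. {a \<odot>\<^bsub>M\<^esub> (w \<oplus>\<^bsub>M\<^esub> x) \<oplus>\<^bsub>M\<^esub> w'})"
      by (auto simp: a_r_coset_def' set_add_def')
    also have "\<dots> = (\<Union>w\<in>W. {w \<oplus>\<^bsub>M\<^esub> a \<odot>\<^bsub>M\<^esub> x})"
    proof (intro equalityI subsetI)
      fix z assume "z \<in> (\<Union>w\<in>W. \<Union>w'\<in>W. {a \<odot>\<^bsub>M\<^esub> (w \<oplus>\<^bsub>M\<^esub> x) \<oplus>\<^bsub>M\<^esub> w'})"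
      then obtain w w' where w: "w \<in> W" "w' \<in> W" "z = a \<odot>\<^bsub>M\<^esub> (w \<oplus>\<^bsub>M\<^esub> x) \<oplus>\<^bsub>M\<^esub> w'" by auto
      then have "z = (a \<odot>\<^bsub>M\<^esub> w \<oplus>\<^bsub>M\<^esub> w') \<oplus>\<^bsub>M\<^esub> a \<odot>\<^bsub>M\<^esub> x"
        using that A.a_subset by (simp add: M.smult_r_distr M.a_ac subsetD)
      then show "z \<in> (\<Union>w\<in>W. {w \<oplus>\<^bsub>M\<^esub> a \<odot>\<^bsub>M\<^esub> x})" using w that by (auto intro!: A.a_closed)
    next
      fix z assume "z \<in> (\<Union>w\<in>W. {w \<oplus>\<^bsub>M\<^esub> a \<odot>\<^bsub>M\<^esub> x})"
      then obtain w where w: "w \<in> W" "z = w \<oplus>\<^bsub>M\<^esub> a \<odot>\<^bsub>M\<^esub> x" by auto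
      then have "z = a \<odot>\<^bsub>M\<^esub> (\<zero>\<^bsub>M\<^esub> \<oplus>\<^bsub>M\<^esub> x) \<oplus>\<^bsub>M\<^esub> w"
        using that A.a_subset by (simp add: M.a_ac subsetD)
      then show "z \<in> (\<Union>w\<in>W. \<Union>w'\<in>W. {a \<odot>\<^bsub>M\<^esub> (w \<oplus>\<^bsub>M\<^esub> x) \<oplus>\<^bsub>M\<^esub> w'})" using w A.zero_closed by blast
    qed
    finally show ?thesis by (simp add: quotient_module_def a_r_coset_def')
  qed
  have add: "(W +>\<^bsub>M\<^esub> x) \<oplus>\<^bsub>quotient_module M W\<^esub> (W +>\<^bsub>M\<^esub> y) = W +>\<^bsub>M\<^esub> (x \<oplus>\<^bsub>M\<^esub> y)"
    if "x \<in> carrier M" "y \<in> carrier M" for x y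
    using that by (simp add: quotient_module_def A.a_rcos_sum)
  have car: "\<exists>x\<in>carrier M. C = W +>\<^bsub>M\<^esub> x" if "C \<in> carrier (quotient_module M W)" for C
    using that by (auto simp: quotient_module_def A_RCOSETS_def RCOSETS_def a_r_coset_def)
  have carI: "W +>\<^bsub>M\<^esub> x \<in> carrier (quotient_module M W)" if "x \<in> carrier M" for x
    using that by (auto simp: quotient_module_def A_RCOSETS_def RCOSETS_def a_r_coset_def)
  show ?thesis
  proof (rule moduleI)
    show "cring F" ..
    interpret Q: comm_group "M A_Mod W" by (rule A.a_factorgroup_is_comm_group)
    have Q: "carrier (M A_Mod W) = carrier (add_monoid (quotient_module M W))"
      "mult (M A_Mod W) = mult (add_monoid (quotient_module M W))"
      "one (M A_Mod W) = one (add_monoid (quotient_module M W))"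
      by (simp_all add: quotient_module_def A_FactGroup_def FactGroup_def A_RCOSETS_def set_add_def)
    have "comm_group (add_monoid (quotient_module M W))"
    proof (rule comm_groupI, unfold Q[symmetric])
      show "\<exists>y\<in>carrier (M A_Mod W). y \<otimes>\<^bsub>M A_Mod W\<^esub> x = \<one>\<^bsub>M A_Mod W\<^esub>"
        if "x \<in> carrier (M A_Mod W)" for x
        using that Q.l_inv Q.inv_closed by blast
    qed (rule Q.m_closed Q.one_closed Q.m_assoc Q.m_comm Q.l_one; assumption)+
    then show "abelian_group (quotient_module M W)"
      by (simp add: abelian_group_def abelian_group_axioms_def abelian_monoid_def comm_group_def)
  qed (auto dest!: car simp: smul add carI M.smult_l_distr M.smult_r_distr M.smult_assoc1)
qed

definition tuples :: "nat \<Rightarrow> 'v set \<Rightarrow> (nat \<Rightarrow> 'v) set" where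
  "tuples k H = ({..<k} \<rightarrow>\<^sub>E H)"

text \<open>The free module on the \<open>k\<close>-tuples of elements of \<open>V\<close>. There is no finite-support
  condition: all \<open>V\<close> considered here are finite sets.\<close>

definition free_tuples ::
  "('a, 'b) ring_scheme \<Rightarrow> nat \<Rightarrow> ('a, 'v, 'e) module_scheme \<Rightarrow> ('a, (nat \<Rightarrow> 'v) \<Rightarrow> 'a) module" where
  "free_tuples F k V = ring.func_space F (tuples k (carrier V))"

definition tuple_gen ::
  "('a, 'b) ring_scheme \<Rightarrow> nat \<Rightarrow> ('a, 'v, 'e) module_scheme \<Rightarrow> (nat \<Rightarrow> 'v) \<Rightarrow> (nat \<Rightarrow> 'v) \<Rightarrow> 'a" where
  "tuple_gen F k V t = (\<lambda>s\<in>tuples k (carrier V). if s = t then \<one>\<^bsub>F\<^esub> else \<zero>\<^bsub>F\<^esub>)"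

text \<open>Additivity and homogeneity in each argument, and vanishing on tuples with a repeated entry.\<close>

definition wedge_relations ::
  "('a, 'b) ring_scheme \<Rightarrow> nat \<Rightarrow> ('a, 'v, 'e) module_scheme \<Rightarrow> ((nat \<Rightarrow> 'v) \<Rightarrow> 'a) set" where
  "wedge_relations F k V =
    {tuple_gen F k V (t(i := u \<oplus>\<^bsub>V\<^esub> v))
        \<ominus>\<^bsub>free_tuples F k V\<^esub>
      (tuple_gen F k V (t(i := u)) \<oplus>\<^bsub>free_tuples F k V\<^esub> tuple_gen F k V (t(i := v)))
      | t i u v. t \<in> tuples k (carrier V) \<and> i < k \<and> u \<in> carrier V \<and> v \<in> carrier V}
    \<union> {tuple_gen F k V (t(i := a \<odot>\<^bsub>V\<^esub> u))
        \<ominus>\<^bsub>free_tuples F k V\<^esub>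
       (a \<odot>\<^bsub>free_tuples F k V\<^esub> tuple_gen F k V (t(i := u)))
      | t i a u. t \<in> tuples k (carrier V) \<and> i < k \<and> a \<in> carrier F \<and> u \<in> carrier V}
    \<union> {tuple_gen F k V t
      | t i j. t \<in> tuples k (carrier V) \<and> i < j \<and> j < k \<and> t i = t j}"

definition wedge_kernel ::
  "('a, 'b) ring_scheme \<Rightarrow> nat \<Rightarrow> ('a, 'v, 'e) module_scheme \<Rightarrow> ((nat \<Rightarrow> 'v) \<Rightarrow> 'a) set" where
  "wedge_kernel F k V =
    LinearCombinations.module.span F (free_tuples F k V) (wedge_relations F k V)"

definition exterior_power ::
  "('a, 'b) ring_scheme \<Rightarrow> nat \<Rightarrow> ('a, 'v, 'e) module_scheme \<Rightarrow>
     ('a, ((nat \<Rightarrow> 'v) \<Rightarrow> 'a) set) module" where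
  "exterior_power F k V = quotient_module (free_tuples F k V) (wedge_kernel F k V)"

definition wedge ::
  "('a, 'b) ring_scheme \<Rightarrow> nat \<Rightarrow> ('a, 'v, 'e) module_scheme \<Rightarrow>
     (nat \<Rightarrow> 'v) \<Rightarrow> ((nat \<Rightarrow> 'v) \<Rightarrow> 'a) set" where
  "wedge F k V t = wedge_kernel F k V +>\<^bsub>free_tuples F k V\<^esub> tuple_gen F k V t"

text \<open>\<open>\<Lambda>\<^sup>kH\<close> as a subspace of \<open>\<Lambda>\<^sup>kV\<close>, for a subspace \<open>H\<close> of \<open>V\<close>.\<close>

definition exterior_subspace ::
  "('a, 'b) ring_scheme \<Rightarrow> nat \<Rightarrow> ('a, 'v, 'e) module_scheme \<Rightarrow> 'v set \<Rightarrow>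
     ((nat \<Rightarrow> 'v) \<Rightarrow> 'a) set set" where
  "exterior_subspace F k V H =
    LinearCombinations.module.span F (exterior_power F k V) (wedge F k V ` tuples k H)"

text \<open>Linear maps are made extensional so that each of them is counted once by the
  uniform distribution.\<close>

definition lin_maps ::
  "('a, 'b) ring_scheme \<Rightarrow> ('a, 'v, 'e) module_scheme \<Rightarrow> ('a, 'w, 'f) module_scheme \<Rightarrow>
     ('v \<Rightarrow> 'w) set" where
  "lin_maps F V W = module_hom F V W \<inter> extensional (carrier V)"

definition grassmannian ::
  "('a, 'b) ring_scheme \<Rightarrow> nat \<Rightarrow> ('a, 'v, 'e) module_scheme \<Rightarrow> 'v set set" where
  "grassmannian F r V =
    {H. VectorSpace.subspace F H V \<and> vectorspace.dim F (V\<lparr>carrier := H\<rparr>) = r}"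


section \<open>Random null subspaces\<close>

type_synonym 'a form = "((nat \<Rightarrow> nat \<Rightarrow> 'a) \<Rightarrow> 'a) set \<Rightarrow> nat \<Rightarrow> 'a"

definition random_form :: "'a ring \<Rightarrow> nat \<Rightarrow> nat \<Rightarrow> nat \<Rightarrow> 'a form pmf" where
  "random_form F k m N =
    pmf_of_set (lin_maps F (exterior_power F k (coord_space F N)) (coord_space F m))"

definition null_spaces ::
  "'a ring \<Rightarrow> nat \<Rightarrow> nat \<Rightarrow> nat \<Rightarrow> nat \<Rightarrow> 'a form \<Rightarrow> (nat \<Rightarrow> 'a) set set" where
  "null_spaces F k m N r \<theta> =
    {H \<in> grassmannian F r (coord_space F N).
       \<forall>\<omega> \<in> exterior_subspace F k (coord_space F N) H. \<theta> \<omega> = \<zero>\<^bsub>coord_space F m\<^esub>}"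

definition null_set_law ::
  "'a ring \<Rightarrow> nat \<Rightarrow> nat \<Rightarrow> nat \<Rightarrow> nat \<Rightarrow> (nat \<Rightarrow> 'a) set set pmf" where
  "null_set_law F k m N r = map_pmf (null_spaces F k m N r) (random_form F k m N)"

definition null_count_law :: "'a ring \<Rightarrow> nat \<Rightarrow> nat \<Rightarrow> nat \<Rightarrow> nat \<Rightarrow> nat pmf" where
  "null_count_law F k m N r = map_pmf card (null_set_law F k m N r)"

definition null_mean :: "'a ring \<Rightarrow> nat \<Rightarrow> nat \<Rightarrow> nat \<Rightarrow> nat \<Rightarrow> real" where
  "null_mean F k m N r = measure_pmf.expectation (null_count_law F k m N r) real"

definition null_prob :: "'a ring \<Rightarrow> nat \<Rightarrow> nat \<Rightarrow> nat \<Rightarrow> real" where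
  "null_prob F k m r = 1 / real (card (carrier F)) ^ (m * (r choose k))"


section \<open>Point processes on a finite set\<close>

text \<open>The measure \<open>\<Sum>x\<in>S. n x \<cdot> \<delta>\<^sub>x\<close> on the subsets of \<open>S\<close>.\<close>

definition atomic_measure :: "'x set \<Rightarrow> ('x \<Rightarrow> nat) \<Rightarrow> 'x measure" where
  "atomic_measure S n = point_measure S (\<lambda>x. of_nat (n x))"

lemma emeasure_atomic_measure:
  assumes "finite S" "A \<subseteq> S"
  shows "emeasure (atomic_measure S n) A = of_nat (\<Sum>x\<in>A. n x)"
  unfolding atomic_measure_def using assms
  by (subst emeasure_point_measure_finite) auto

definition null_process_law ::
  "'a ring \<Rightarrow> nat \<Rightarrow> nat \<Rightarrow> nat \<Rightarrow> nat \<Rightarrow> (nat \<Rightarrow> 'a) set measure pmf" where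
  "null_process_law F k m N r =
    map_pmf (\<lambda>Z. atomic_measure (grassmannian F r (coord_space F N)) (indicator Z))
      (null_set_law F k m N r)"

definition bernoulli_set_law :: "'x set \<Rightarrow> real \<Rightarrow> 'x set pmf" where
  "bernoulli_set_law S p =
    map_pmf (\<lambda>b. {x \<in> S. b x}) (Pi_pmf S False (\<lambda>_. bernoulli_pmf p))"

text \<open>The Poisson process with intensity measure \<open>\<Sum>x\<in>S. \<rho> x \<cdot> \<delta>\<^sub>x\<close> on a finite set \<open>S\<close>,
  built from independent Poisson multiplicities.\<close>

definition poisson_process :: "'x set \<Rightarrow> ('x \<Rightarrow> real) \<Rightarrow> 'x measure pmf" where
  "poisson_process S \<rho> =
    map_pmf (atomic_measure S) (Pi_pmf S 0 (\<lambda>x. poisson_pmf (\<rho> x)))"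


text \<open>The two defining properties of the process: Poisson counts on every set, independent on
  disjoint sets. (For \<open>A = {}\<close> the count is \<open>0\<close>; the library's \<open>poisson_pmf\<close> needs a positive rate.)\<close>

lemma poisson_pmf_add:
  assumes "a > 0" "b > 0"
  shows "map_pmf (\<lambda>(x, y). x + y) (pair_pmf (poisson_pmf a) (poisson_pmf b)) = poisson_pmf (a + b)"
proof (rule pmf_eqI)
  fix n :: nat
  have eq: "(\<lambda>(x, y). x + y) -` {n} = (\<lambda>i. (i, n - i)) ` {..n}"
    by (auto simp: image_iff)
  have inj: "inj_on (\<lambda>i. (i, n - i)) {..n}"
    by (auto simp: inj_on_def)
  have "pmf (map_pmf (\<lambda>(x, y). x + y) (pair_pmf (poisson_pmf a) (poisson_pmf b))) n
      = measure_pmf.prob (pair_pmf (poisson_pmf a) (poisson_pmf b)) ((\<lambda>i. (i, n - i)) ` {..n})"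
    by (simp only: pmf_map eq)
  also have "\<dots> = (\<Sum>i\<le>n. pmf (poisson_pmf a) i * pmf (poisson_pmf b) (n - i))"
    by (simp add: measure_measure_pmf_finite sum.reindex[OF inj] pmf_pair)
  also have "\<dots> = (\<Sum>i\<le>n. real (n choose i) * a ^ i * b ^ (n - i)) / fact n * exp (- (a + b))"
    unfolding sum_divide_distrib sum_distrib_right
  proof (rule sum.cong[OF refl])
    fix i assume i: "i \<in> {..n}"
    have "exp (- a) * exp (- b) = exp (- (a + b))"
      by (simp add: mult_exp_exp)
    with i show "pmf (poisson_pmf a) i * pmf (poisson_pmf b) (n - i)
      = real (n choose i) * a ^ i * b ^ (n - i) / fact n * exp (- (a + b))"
      using assms by (simp add: binomial_fact divide_inverse ac_simps)
  qed
  also have "\<dots> = pmf (poisson_pmf (a + b)) n"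
    using assms by (simp add: binomial_ring)
  finally show "pmf (map_pmf (\<lambda>(x, y). x + y) (pair_pmf (poisson_pmf a) (poisson_pmf b))) n
      = pmf (poisson_pmf (a + b)) n" .
qed

lemma sum_Pi_poisson:
  assumes "finite A" "A \<noteq> {}" "\<And>x. x \<in> A \<Longrightarrow> \<rho> x > 0"
  shows "map_pmf (\<lambda>n. \<Sum>x\<in>A. n x) (Pi_pmf A 0 (\<lambda>x. poisson_pmf (\<rho> x))) = poisson_pmf (\<Sum>x\<in>A. \<rho> x)"
  using assms
proof (induction rule: finite_ne_induct)
  case (singleton x)
  then show ?case by (simp add: Pi_pmf_singleton map_pmf_comp)
next
  case (insert x A)
  let ?q = "\<lambda>x. poisson_pmf (\<rho> x)"
  have pos: "(\<Sum>x\<in>A. \<rho> x) > 0" using insert by (intro sum_pos) auto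
  have "map_pmf (\<lambda>n. \<Sum>y\<in>insert x A. n y) (Pi_pmf (insert x A) 0 ?q)
     = map_pmf (\<lambda>(y, f). \<Sum>z\<in>insert x A. (f(x := y)) z) (pair_pmf (?q x) (Pi_pmf A 0 ?q))"
    using insert by (simp add: Pi_pmf_insert map_pmf_comp case_prod_unfold)
  also have "\<dots> = map_pmf (\<lambda>(y, f). y + (\<Sum>z\<in>A. f z)) (pair_pmf (?q x) (Pi_pmf A 0 ?q))"
    using insert.hyps by (intro map_pmf_cong refl) (auto intro!: sum.cong)
  also have "\<dots> = map_pmf (\<lambda>(y, z). y + z)
      (pair_pmf (?q x) (map_pmf (\<lambda>n. \<Sum>x\<in>A. n x) (Pi_pmf A 0 ?q)))"
    by (simp add: pair_map_pmf2 map_pmf_comp case_prod_unfold)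
  also have "\<dots> = poisson_pmf (\<rho> x + (\<Sum>x\<in>A. \<rho> x))"
    using insert pos by (simp add: poisson_pmf_add)
  finally show ?case using insert.hyps by simp
qed

lemma poisson_process_count:
  assumes "finite S" "A \<subseteq> S" "A \<noteq> {}" "\<And>x. x \<in> S \<Longrightarrow> \<rho> x > 0"
  shows "map_pmf (\<lambda>\<xi>. emeasure \<xi> A) (poisson_process S \<rho>) = map_pmf of_nat (poisson_pmf (\<Sum>x\<in>A. \<rho> x))"
proof -
  let ?q = "\<lambda>x. poisson_pmf (\<rho> x)"
  have finA: "finite A" using assms finite_subset by blast
  have "map_pmf (\<lambda>\<xi>. emeasure \<xi> A) (poisson_process S \<rho>)
      = map_pmf of_nat (map_pmf (\<lambda>n. \<Sum>x\<in>A. n x) (Pi_pmf S 0 ?q))"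
    using assms by (simp add: poisson_process_def map_pmf_comp emeasure_atomic_measure)
  also have "map_pmf (\<lambda>n. \<Sum>x\<in>A. n x) (Pi_pmf S 0 ?q) = map_pmf (\<lambda>n. \<Sum>x\<in>A. n x) (Pi_pmf A 0 ?q)"
    by (simp add: Pi_pmf_subset[OF assms(1,2)] map_pmf_comp)
  also have "\<dots> = poisson_pmf (\<Sum>x\<in>A. \<rho> x)"
    using assms finA by (intro sum_Pi_poisson) auto
  finally show ?thesis .
qed

lemma poisson_process_indep:
  assumes fin: "finite S" and sub: "\<And>j. j \<in> J \<Longrightarrow> A j \<subseteq> S" and disj: "disjoint_family_on A J"
  shows "prob_space.indep_vars (measure_pmf (poisson_process S \<rho>)) (\<lambda>_. count_space UNIV)
     (\<lambda>j \<xi>. emeasure \<xi> (A j)) J"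
proof (cases "J = {}")
  case True
  then show ?thesis
    by (subst prob_space.indep_vars_def [OF measure_pmf.prob_space_axioms],
        subst prob_space.indep_sets_def [OF measure_pmf.prob_space_axioms]) simp_all
next
  case False
  let ?P = "Pi_pmf S 0 (\<lambda>x. poisson_pmf (\<rho> x))"
  have "prob_space.indep_vars (measure_pmf ?P) (\<lambda>j. PiM (A j) (\<lambda>_. count_space UNIV)) (\<lambda>j n. restrict (\<lambda>x. n x) (A j)) J"
    by (rule prob_space.indep_vars_restrict[OF measure_pmf.prob_space_axioms indep_vars_Pi_pmf[OF fin] sub disj])
  then have "prob_space.indep_vars (measure_pmf ?P) (\<lambda>_. count_space UNIV)
      (\<lambda>j n. of_nat (\<Sum>x\<in>A j. restrict (\<lambda>x. n x) (A j) x) :: ennreal) J"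
  proof (rule prob_space.indep_vars_compose2[OF measure_pmf.prob_space_axioms, where Y = "\<lambda>j n. of_nat (\<Sum>x\<in>A j. n x)"])
    fix j assume "j \<in> J"
    then have "finite (A j)" using sub fin finite_subset by blast
    then show "(\<lambda>n. of_nat (\<Sum>x\<in>A j. n x) :: ennreal)
      \<in> PiM (A j) (\<lambda>_. count_space UNIV) \<rightarrow>\<^sub>M count_space UNIV"
      by measurable
  qed
  then have *: "prob_space.indep_vars (measure_pmf ?P) (\<lambda>_. count_space UNIV) (\<lambda>j n. emeasure (atomic_measure S n) (A j)) J"
    by (rule prob_space.indep_vars_cong[OF measure_pmf.prob_space_axioms, THEN iffD1, rotated -1])
       (auto simp: emeasure_atomic_measure[OF fin sub])
  have D: "measure_pmf (poisson_process S \<rho>)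
      = distr (measure_pmf ?P) (count_space UNIV) (atomic_measure S)"
    by (simp add: poisson_process_def map_pmf_rep_eq)
  have meas: "(\<lambda>\<xi>. \<lambda>j\<in>J. emeasure \<xi> (A j)) \<in> count_space UNIV \<rightarrow>\<^sub>M PiM J (\<lambda>_. count_space UNIV)"
    by (auto simp: space_PiM)
  have "distr (measure_pmf ?P) (PiM J (\<lambda>_. count_space UNIV))
          (\<lambda>n. \<lambda>j\<in>J. emeasure (atomic_measure S n) (A j))
      = PiM J (\<lambda>j. distr (measure_pmf ?P) (count_space UNIV) (\<lambda>n. emeasure (atomic_measure S n) (A j)))"
    using * by (subst (asm) prob_space.indep_vars_iff_distr_eq_PiM'
          [OF measure_pmf.prob_space_axioms False]) auto
  then show ?thesis
    by (subst prob_space.indep_vars_iff_distr_eq_PiM'[OF measure_pmf.prob_space_axioms False])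
       (simp_all add: D distr_distr[OF meas] distr_distr o_def)
qed


section \<open>Distances\<close>

definition tv_dist :: "'x pmf \<Rightarrow> 'x pmf \<Rightarrow> real" where
  "tv_dist P Q = (SUP A. \<bar>measure_pmf.prob P A - measure_pmf.prob Q A\<bar>)"

text \<open>\<open>-log\<^sub>b x\<close> with value \<open>\<infinity>\<close> at \<open>x = 0\<close>, where the library's \<open>log\<close> returns \<open>0\<close>.\<close>

definition neg_log :: "real \<Rightarrow> real \<Rightarrow> ereal" where
  "neg_log b x = (if x > 0 then ereal (- log b x) else \<infinity>)"

end

theory Submission
  imports Defs "HOL-Real_Asymp.Real_Asymp"
begin

text \<open>
  All three distances dominate the distance of the law of \<open>X\<close>, the number of null \<open>r\<close>-spaces, from
  a law on the natural numbers (Poisson, or binomial for the Bernoulli set) whose mean \<open>\<mu>\<close> lies in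
  \<open>[1, 4]\<close>, whose second factorial moment is at most \<open>\<mu>\<^sup>2\<close> and whose tails are exponentially small.
  As \<open>(k - 1) c \<le> (k - 1) m r\<^sup>k\<^sup>-\<^sup>1 / k!\<close>, the bound \<open>q\<close> to the power \<open>-(k - 1) c - O(m r\<^sup>k\<^sup>-\<^sup>2)\<close> suffices.

  If \<open>c\<close> is at most exponential in \<open>r\<close>, test on the event \<open>X \<ge> q\<^sup>r\<close>. It contains the event
  that there is a null space of dimension \<open>r + 1\<close>, whose probability is large enough by the second
  moment method, while it has negligible probability under the comparison law.

  If \<open>c\<close> is larger, test with \<open>n (n - 1)\<close>, truncated at \<open>q\<close> to the power \<open>o(c)\<close>. Two \<open>r\<close>-spaces that meet
  in dimension \<open>r - 1\<close> are positively correlated, so that the second factorial moment of \<open>X\<close>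
  exceeds \<open>\<mu>\<^sup>2\<close> by about \<open>q\<close> to the power \<open>-(k - 1) c\<close>. The crude bound \<open>q\<close> to the power
  \<open>s\<^sup>2 r\<^sup>2\<close> for the \<open>s\<close>-th moment of \<open>X\<close> controls the truncation error, because now \<open>r\<^sup>4 \<le> c\<close>.

  The probabilistic input is that, for every basis of \<open>V\<close>, the coefficients of a uniform form on
  the \<open>k\<close>-subsets of the basis are independent and uniform. For subspaces \<open>H\<close> and \<open>U\<close> one takes a basis
  adapted to both: the coefficients that decide whether \<open>H\<close> is null, given the form on \<open>U\<close>,
  belong to the \<open>k\<close>-subsets of the basis of \<open>H\<close> that are not contained in \<open>H \<inter> U\<close>.
\<close>

section \<open>Subspaces of a finite vector space\<close>

text \<open>Both tests detect the same exponent. The binomial coefficient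
  \<open>Suc r choose k\<close> times \<open>m\<close> is about
  \<open>(r + 1) * c + (k - 1) * c\<close>, while there are about
  \<open>q ^ ((r + 1) * (c - 1))\<close> spaces of dimension \<open>r + 1\<close>; hence
  \<open>q\<close> to the power \<open>-(k - 1) * c\<close> for the expected number of null ones, up
  to lower order. Likewise each of the roughly \<open>q ^ (r * c)\<close> spaces of dimension
  \<open>r\<close> has about \<open>q ^ c\<close> partners through a fixed hyperplane, and such a
  pair is null with probability \<open>q\<close> to the power \<open>-(r + k) * c\<close>. The
  obstacle is that \<open>m\<close> is free. The tail bound for the comparison law at
  \<open>q ^ r\<close>, about 2 to the power \<open>-(q ^ r)\<close>, is certainly below the signal
  while \<open>2 * k * c \<le> q ^ (r - 1)\<close>. The moment test has no such limit, but
  truncation at \<open>q ^ a\<close> costs a factor \<open>q ^ (2 * a)\<close>, and the moment of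
  order \<open>r + 2\<close> asks for \<open>a\<close> of about \<open>r ^ 3 + k * c / r\<close>.
  The cubic term is harmless once \<open>r ^ 4 \<le> c\<close>, but may exceed the allowed order
  \<open>m * r ^ (k - 2)\<close> if \<open>k\<close> is 3 or 4 and \<open>m\<close> is small. The
  two ranges overlap because \<open>r ^ 4\<close> is far below \<open>2 ^ (r - 1)\<close> for large
  \<open>r\<close>.\<close>

locale finite_vectorspace = vectorspace K V for K and V +
  assumes finite_K: "finite (carrier K)" and finite_V: "finite (carrier V)"
begin

abbreviation q :: nat where "q \<equiv> card (carrier K)"
abbreviation sdim :: "'c set \<Rightarrow> nat" where "sdim W \<equiv> vectorspace.dim K (vs W)"

lemma q_ge_2: "q \<ge> 2"
proof -
  have "{\<zero>\<^bsub>K\<^esub>, \<one>\<^bsub>K\<^esub>} \<subseteq> carrier K" "\<zero>\<^bsub>K\<^esub> \<noteq> \<one>\<^bsub>K\<^esub>" by auto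
  then show ?thesis using card_mono[OF finite_K, of "{\<zero>\<^bsub>K\<^esub>, \<one>\<^bsub>K\<^esub>}"] by simp
qed

lemma subspace_subset: "subspace K W V \<Longrightarrow> W \<subseteq> carrier V"
  by (meson is_module submodule.subset)

lemma subspace_finite: "subspace K W V \<Longrightarrow> finite W"
  using subspace_subset finite_V finite_subset by blast

lemma subspaceD:
  assumes "subspace K W V"
  shows "\<zero>\<^bsub>V\<^esub> \<in> W" "\<And>u v. u \<in> W \<Longrightarrow> v \<in> W \<Longrightarrow> u \<oplus>\<^bsub>V\<^esub> v \<in> W"
    "\<And>a v. a \<in> carrier K \<Longrightarrow> v \<in> W \<Longrightarrow> a \<odot>\<^bsub>V\<^esub> v \<in> W"
  using submodule.m_closed[OF is_module[OF assms]] submodule.zero_closed[OF is_module[OF assms]]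
    submodule.smult_closed[OF is_module[OF assms]] by auto

lemma subspaceI:
  assumes "W \<subseteq> carrier V" "\<zero>\<^bsub>V\<^esub> \<in> W" "\<And>u v. u \<in> W \<Longrightarrow> v \<in> W \<Longrightarrow> u \<oplus>\<^bsub>V\<^esub> v \<in> W"
    "\<And>a v. a \<in> carrier K \<Longrightarrow> v \<in> W \<Longrightarrow> a \<odot>\<^bsub>V\<^esub> v \<in> W"
  shows "subspace K W V"
  unfolding subspace_def submodule_def using assms vectorspace_axioms module_axioms by auto

lemma subspace_carrier: "subspace K (carrier V) V"
  by (rule subspaceI) auto

lemma subspace_Int: "subspace K U V \<Longrightarrow> subspace K W V \<Longrightarrow> subspace K (U \<inter> W) V"
  by (rule subspaceI) (auto dest: subspace_subset subspaceD)

lemma span_subset: "subspace K W V \<Longrightarrow> A \<subseteq> W \<Longrightarrow> span A \<subseteq> W"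
  by (rule span_is_subset) auto

lemma card_span:
  assumes "lin_indpt A" "A \<subseteq> carrier V"
  shows "card (span A) = q ^ card A"
proof -
  have fin: "finite A" using assms(2) finite_V finite_subset by blast
  have "span A = (\<lambda>a. lincomb a A) ` (A \<rightarrow>\<^sub>E carrier K)"
  proof
    show "span A \<subseteq> (\<lambda>a. lincomb a A) ` (A \<rightarrow>\<^sub>E carrier K)"
    proof
      fix v assume "v \<in> span A"
      then obtain a where a: "a \<in> A \<rightarrow> carrier K" "v = lincomb a A"
        using finite_span[OF fin assms(2)] by auto
      then have "v = lincomb (restrict a A) A"
        using assms(2) by (intro trans[OF a(2)] lincomb_cong) auto
      moreover have "restrict a A \<in> A \<rightarrow>\<^sub>E carrier K" using a by auto
      ultimately show "v \<in> (\<lambda>a. lincomb a A) ` (A \<rightarrow>\<^sub>E carrier K)" by blast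
    qed
  qed (use finite_span[OF fin assms(2)] in auto)
  moreover have "inj_on (\<lambda>a. lincomb a A) (A \<rightarrow>\<^sub>E carrier K)"
  proof (rule inj_onI)
    fix a b assume ab: "a \<in> A \<rightarrow>\<^sub>E carrier K" "b \<in> A \<rightarrow>\<^sub>E carrier K" "lincomb a A = lincomb b A"
    then have ab': "a \<in> A \<rightarrow> carrier K" "b \<in> A \<rightarrow> carrier K" by auto
    have "lincomb (\<lambda>v. a v \<ominus>\<^bsub>K\<^esub> b v) A = \<zero>\<^bsub>V\<^esub>"
      using lincomb_diff[OF fin assms(2) ab'] ab(3) ab' assms(2) by simp
    then have "(\<lambda>v. a v \<ominus>\<^bsub>K\<^esub> b v) \<in> A \<rightarrow> {\<zero>\<^bsub>K\<^esub>}"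
      using ab' by (intro not_lindepD[OF assms(1) fin]) auto
    then have "a v = b v" if "v \<in> A" for v using that ab' by (auto simp: Pi_iff)
    then show "a = b" using ab(1,2) by (meson PiE_ext)
  qed
  ultimately have "card (span A) = card (A \<rightarrow>\<^sub>E carrier K)" by (simp add: card_image)
  then show ?thesis by (simp add: card_PiE fin)
qed

lemma sdim_span:
  assumes "lin_indpt A" "A \<subseteq> carrier V"
  shows "sdim (span A) = card A"
proof -
  have s: "subspace K (span A) V" using assms by (simp add: span_is_subspace)
  interpret S: vectorspace K "vs (span A)" using s by (rule subspace_is_vs)
  have fin: "finite A" using assms(2) finite_V finite_subset by blast
  have "A \<subseteq> span A" using assms by (simp add: in_own_span)
  then have "S.basis A"
    unfolding S.basis_def using span_li_not_depend[OF _ is_module[OF s]] assms by simp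
  then show ?thesis using S.dim_basis[OF fin] by simp
qed

text \<open>By finiteness there is a maximal independent set between \<open>A\<close> and
  \<open>W\<close>; a vector of \<open>W\<close> outside its span could still be adjoined.\<close>

lemma extend_basis:
  assumes "lin_indpt A" "A \<subseteq> W" "subspace K W V"
  obtains B where "A \<subseteq> B" "B \<subseteq> W" "lin_indpt B" "span B = W"
proof -
  let ?S = "{B. A \<subseteq> B \<and> B \<subseteq> W \<and> lin_indpt B}"
  have fS: "finite ?S" using subspace_finite[OF assms(3)] by (auto intro: finite_subset[of _ "Pow W"])
  have "A \<in> ?S" using assms by auto
  from finite_has_maximal2[OF fS this]
  obtain B where "B \<in> ?S" "\<forall>C\<in>?S. B \<subseteq> C \<longrightarrow> B = C" by blast
  then have B: "B \<in> ?S" "\<And>C. C \<in> ?S \<Longrightarrow> B \<subseteq> C \<Longrightarrow> B = C" by blast+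
  have BV: "B \<subseteq> carrier V" using B subspace_subset[OF assms(3)] by auto
  have "v \<in> span B" if "v \<in> W" for v
  proof (rule ccontr)
    assume n: "v \<notin> span B"
    then have vB: "v \<notin> B" using in_own_span[OF BV] by auto
    have "v \<in> carrier V" using that subspace_subset[OF assms(3)] by auto
    then have "lin_indpt (B \<union> {v})" using lin_dep_iff_in_span[OF BV _ _ vB] B n by auto
    then have "B \<union> {v} \<in> ?S" using B that by auto
    from B(2)[OF this] vB show False by auto
  qed
  then have "span B = W" using span_subset[OF assms(3)] B by blast
  then show thesis using that B by auto
qed

lemma lin_indpt_empty: "lin_indpt {}"
  unfolding lin_dep_def by auto

lemma subspace_basis:
  assumes "subspace K W V"
  obtains B where "B \<subseteq> W" "lin_indpt B" "span B = W" "card B = sdim W"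
  using extend_basis[OF lin_indpt_empty _ assms] sdim_span subspace_subset[OF assms]
  by (metis empty_subsetI order_trans)

lemma card_subspace: "subspace K W V \<Longrightarrow> card W = q ^ sdim W"
  by (metis subspace_basis card_span subspace_subset order_trans)

lemma sdim_mono: "subspace K U V \<Longrightarrow> subspace K W V \<Longrightarrow> U \<subseteq> W \<Longrightarrow> sdim U \<le> sdim W"
  using card_subspace[of U] card_subspace[of W] card_mono[of W U] subspace_finite[of W] q_ge_2
  by (metis Suc_1 Suc_le_lessD power_le_imp_le_exp)

lemma sdim_eq_imp_eq:
  assumes "subspace K U V" "subspace K W V" "U \<subseteq> W" "sdim U = sdim W"
  shows "U = W"
  using assms card_subspace[of U] card_subspace[of W] subspace_finite[of W] by (simp add: card_subset_eq)

lemma sdim_unique: "subspace K W V \<Longrightarrow> card W = q ^ d \<Longrightarrow> sdim W = d"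
  using card_subspace[of W] q_ge_2 by simp

lemma sdim_span_insert:
  assumes "subspace K J V" "v \<in> carrier V" "v \<notin> J"
  shows "sdim (span (insert v J)) = Suc (sdim J)"
proof -
  obtain B where B: "B \<subseteq> J" "lin_indpt B" "span B = J" "card B = sdim J"
    using subspace_basis[OF assms(1)] by blast
  have BV: "B \<subseteq> carrier V" using B subspace_subset[OF assms(1)] by auto
  have fB: "finite B" using BV finite_V finite_subset by blast
  have vB: "v \<notin> B" using B assms by auto
  have ind: "lin_indpt (insert v B)" using lin_dep_iff_in_span[OF BV B(2) assms(2) vB] B assms by auto
  have "span (insert v B) = span (insert v J)"
  proof
    show "span (insert v B) \<subseteq> span (insert v J)" using B by (intro span_is_monotone) auto
    have s: "subspace K (span (insert v B)) V" using BV assms by (intro span_is_subspace) auto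
    have "J \<subseteq> span (insert v B)" using B(3) span_is_monotone[of B "insert v B"] by auto
    moreover have "v \<in> span (insert v B)" using BV assms by (intro span_mem) auto
    ultimately show "span (insert v J) \<subseteq> span (insert v B)" by (intro span_subset[OF s]) auto
  qed
  then show ?thesis using sdim_span[OF ind] BV assms B(4) vB fB by simp
qed

lemma span_Un_sum:
  assumes "A \<subseteq> carrier V" "B \<subseteq> carrier V" "A \<inter> B = {}" "v \<in> span (A \<union> B)"
  obtains a b where "a \<in> span A" "b \<in> span B" "v = a \<oplus>\<^bsub>V\<^esub> b"
proof -
  have fin: "finite (A \<union> B)" "finite A" "finite B"
    using assms(1,2) finite_V finite_subset by (auto intro: finite_subset)
  obtain x where x: "x \<in> A \<union> B \<rightarrow> carrier K" "lincomb x (A \<union> B) = v"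
    using finite_in_span[OF fin(1) _ assms(4)] assms by auto
  have "v = lincomb x A \<oplus>\<^bsub>V\<^esub> lincomb x B"
    using module.lincomb_union[OF fin(1) _ assms(3) x(1)] assms x(2) by auto
  moreover have "lincomb x A \<in> span A" "lincomb x B \<in> span B"
    using finite_span[OF fin(2) assms(1)] finite_span[OF fin(3) assms(2)] x(1) by auto
  ultimately show thesis using that by blast
qed

text \<open>A vector \<open>v\<close> of \<open>A - C\<close> in the span of \<open>B\<close> and of
  earlier vectors \<open>E\<close> of \<open>A - C\<close> is \<open>u + e\<close> with
  \<open>u\<close> in \<open>U\<close> and \<open>e\<close> in the span of \<open>E\<close>. Then
  \<open>u = v - e\<close> lies in \<open>H \<inter> U\<close>, the span of \<open>C\<close>, so
  \<open>v\<close> would be spanned by \<open>C \<union> E\<close>, against the independence of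
  \<open>A\<close>. This is the basis adapted to both subspaces.\<close>

lemma glue_bases:
  assumes H: "subspace K H V" and U: "subspace K U V"
    and A: "lin_indpt A" "span A = H" "A \<subseteq> H" and B: "lin_indpt B" "span B = U" "B \<subseteq> U"
    and C: "C \<subseteq> A" "C \<subseteq> B" "span C = H \<inter> U"
  shows "lin_indpt (B \<union> A)" "A \<inter> B = C"
proof -
  have AV: "A \<subseteq> carrier V" and BV: "B \<subseteq> carrier V" and CV: "C \<subseteq> carrier V"
    using A B C subspace_subset[OF H] subspace_subset[OF U] by auto
  have notspan: "v \<notin> span (C \<union> E)" if "v \<in> A - C - E" "E \<subseteq> A" for v E
  proof
    assume s: "v \<in> span (C \<union> E)"
    have CE: "C \<union> E \<subseteq> A" using that C by auto
    have "lin_indpt (C \<union> E)" "lin_indpt (C \<union> E \<union> {v})"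
      using subset_li_is_li[OF A(1)] CE that by auto
    then show False using lin_dep_iff_in_span[of "C \<union> E" v] s that CE AV by blast
  qed
  show AB: "A \<inter> B = C"
  proof
    show "A \<inter> B \<subseteq> C"
    proof
      fix x assume x: "x \<in> A \<inter> B"
      then have "x \<in> span C" using A B C by auto
      then show "x \<in> C" using notspan[of x "{}"] x by auto
    qed
  qed (use C in auto)
  have fA: "finite (A - C)" using AV finite_V finite_subset by blast
  have "lin_indpt (B \<union> E)" if "E \<subseteq> A - C" for E
    using finite_subset[OF that fA] that
  proof (induction E rule: finite_induct)
    case empty then show ?case using B by simp
  next
    case (insert v E)
    have ih: "lin_indpt (B \<union> E)" using insert by auto
    have vA: "v \<in> A" "v \<notin> C" "v \<notin> E" and EA: "E \<subseteq> A - C" using insert by auto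
    have vB: "v \<notin> B \<union> E" using vA AB by auto
    have BEV: "B \<union> E \<subseteq> carrier V" and EV: "E \<subseteq> carrier V" using BV AV EA by auto
    have "v \<notin> span (B \<union> E)"
    proof
      assume "v \<in> span (B \<union> E)"
      moreover have "B \<inter> E = {}" using AB EA by auto
      ultimately obtain u e where ue: "u \<in> span B" "e \<in> span E" "v = u \<oplus>\<^bsub>V\<^esub> e"
        using span_Un_sum[OF BV EV] by metis
      have eH: "e \<in> H" using ue(2) span_is_monotone[of E A] EA A by auto
      have uV: "u \<in> carrier V" "e \<in> carrier V" using ue BV EV by auto
      have "u = v \<oplus>\<^bsub>V\<^esub> (\<ominus>\<^bsub>V\<^esub> e)" using ue uV by (simp add: M.a_assoc M.r_neg)
      moreover have "\<ominus>\<^bsub>V\<^esub> e \<in> H" using span_neg[OF AV] eH A by auto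
      ultimately have "u \<in> H" using subspaceD(2)[OF H] vA A by auto
      then have "u \<in> span C" using ue B C by auto
      then have "u \<in> span (C \<union> E)" "e \<in> span (C \<union> E)"
        using ue(2) span_is_monotone[of C "C \<union> E"] span_is_monotone[of E "C \<union> E"] by auto
      then have "v \<in> span (C \<union> E)" using ue(3) span_add1[of "C \<union> E"] CV EV by auto
      then show False using notspan[of v E] vA EA by auto
    qed
    then have "lin_indpt (B \<union> E \<union> {v})"
      using lin_dep_iff_in_span[OF BEV ih _ vB] vA AV by auto
    then show ?case by simp
  qed
  from this[of "A - C"] have "lin_indpt (B \<union> (A - C))" by simp
  moreover have "B \<union> (A - C) = B \<union> A" using C by auto
  ultimately show "lin_indpt (B \<union> A)" by simp
qed

subsection \<open>Counting subspaces\<close>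

definition between :: "'c set \<Rightarrow> 'c set \<Rightarrow> nat \<Rightarrow> 'c set set" where
  "between J W d = {H. subspace K H V \<and> J \<subseteq> H \<and> H \<subseteq> W \<and> sdim H = d}"

lemma finite_between: "finite (between J W d)"
  by (rule finite_subset[of _ "Pow (carrier V)"]) (auto simp: between_def finite_V dest: subspace_subset)

text \<open>Induction on \<open>d - sdim J\<close>, by double counting the pairs of a vector
  \<open>v\<close> in \<open>W - J\<close> and a space \<open>H\<close> through \<open>v\<close>:
  each \<open>H\<close> has \<open>q ^ d - q ^ sdim J\<close> such vectors, and the spaces through
  \<open>v\<close> are those above the span of \<open>J\<close> and \<open>v\<close>.\<close>

lemma card_between:
  assumes "subspace K J V" "subspace K W V" "J \<subseteq> W" "sdim J \<le> d" "d \<le> sdim W"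
  shows "real (card (between J W d)) = (\<Prod>i = sdim J..<d. (real q ^ sdim W - real q ^ i) / (real q ^ d - real q ^ i))"
proof -
  define n where "n = d - sdim J"
  from n_def assms show ?thesis
proof (induction n arbitrary: J)
  case 0
  then have d: "d = sdim J" by simp
  have "H = J" if "subspace K H V" "J \<subseteq> H" "sdim H = d" for H
    using sdim_eq_imp_eq[of J H] 0 that d by metis
  then have "between J W d = {J}"
    unfolding between_def using 0 d by auto
  with 0 show ?case by simp
next
  case (Suc n)
  let ?j = "sdim J"
  have jd: "?j < d" using Suc by auto
  let ?F = "\<lambda>j. \<Prod>i = j..<d. (real q ^ sdim W - real q ^ i) / (real q ^ d - real q ^ i)"
  have step: "real (card {H \<in> between J W d. v \<in> H}) = ?F (Suc ?j)" if v: "v \<in> W - J" for v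
  proof -
    have vV: "v \<in> carrier V" using v subspace_subset[OF Suc.prems(3)] by auto
    let ?J = "span (insert v J)"
    have JV: "insert v J \<subseteq> carrier V" using vV subspace_subset[OF Suc.prems(2)] by auto
    have sJ: "subspace K ?J V" using JV by (rule span_is_subspace)
    have dJ: "sdim ?J = Suc ?j" using sdim_span_insert[OF Suc.prems(2) vV] v by auto
    have JW: "?J \<subseteq> W" using v Suc.prems by (intro span_subset) auto
    have "{H \<in> between J W d. v \<in> H} = between ?J W d"
      unfolding between_def using span_subset[of _ "insert v J"] in_own_span[OF JV] by blast
    moreover have "real (card (between ?J W d)) = ?F (Suc ?j)"
      using Suc.IH[of ?J] sJ dJ JW Suc.prems jd by auto
    ultimately show ?thesis by simp
  qed
  have fW: "finite W" using subspace_finite Suc.prems by auto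
  have cHJ: "real (card (H - J)) = real q ^ d - real q ^ ?j" if "H \<in> between J W d" for H
  proof -
    have "card (H - J) = card H - card J" "card J \<le> card H"
      using that subspace_finite[of H] subspace_finite[OF Suc.prems(2)]
      by (auto simp: between_def card_Diff_subset card_mono)
    then show ?thesis using card_subspace[OF Suc.prems(2)] card_subspace[of H] that
      by (simp add: between_def of_nat_diff)
  qed
  have cWJ: "real (card (W - J)) = real q ^ sdim W - real q ^ ?j"
  proof -
    have "card (W - J) = card W - card J" "card J \<le> card W"
      using fW Suc.prems(4) finite_subset[of J W] by (auto simp: card_Diff_subset card_mono)
    then show ?thesis using card_subspace[OF Suc.prems(2)] card_subspace[OF Suc.prems(3)]
      by (simp add: of_nat_diff)
  qed
  have "(\<Sum>H\<in>between J W d. card (H - J)) = (\<Sum>H\<in>between J W d. \<Sum>v\<in>W - J. if v \<in> H then 1 else 0)"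
  proof (rule sum.cong[OF refl])
    fix H assume "H \<in> between J W d"
    then have "H - J = (W - J) \<inter> H" by (auto simp: between_def)
    then show "card (H - J) = (\<Sum>v\<in>W - J. if v \<in> H then 1 else 0)"
      using fW by (simp add: sum.If_cases)
  qed
  also have "\<dots> = (\<Sum>v\<in>W - J. \<Sum>H\<in>between J W d. if v \<in> H then 1 else 0)"
    by (rule sum.swap)
  also have "\<dots> = (\<Sum>v\<in>W - J. card {H \<in> between J W d. v \<in> H})"
    by (simp add: sum.If_cases finite_between Collect_conj_eq Int_commute)
  finally have "real (\<Sum>H\<in>between J W d. card (H - J)) = real (\<Sum>v\<in>W - J. card {H \<in> between J W d. v \<in> H})"
    by simp
  then have "real (card (between J W d)) * (real q ^ d - real q ^ ?j) = real (card (W - J)) * ?F (Suc ?j)"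
    using cHJ step by simp
  moreover have "real q ^ d - real q ^ ?j \<noteq> 0" using q_ge_2 jd by simp
  ultimately have "real (card (between J W d)) = (real q ^ sdim W - real q ^ ?j) / (real q ^ d - real q ^ ?j) * ?F (Suc ?j)"
    using cWJ by (simp add: field_simps)
  also have "\<dots> = ?F ?j" using jd by (simp add: prod.atLeast_Suc_lessThan)
  finally show ?case .
qed
qed

end

text \<open>Each factor increases with \<open>q\<close>, so that 2 is the worst case.\<close>

lemma prod_one_minus_inverse_power_ge:
  fixes q :: real assumes "q \<ge> 2"
  shows "(\<Prod>t = 1..n. 1 - 1 / q ^ t) \<ge> 1/4"
proof -
  have le: "(\<Prod>t = 1..n. 1 - 1 / q ^ t) \<ge> (\<Prod>t = 1..n. 1 - 1 / 2 ^ t)"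
  proof (rule prod_mono)
    fix t :: nat
    have a: "(2::real) ^ t \<le> q ^ t" using assms by (intro power_mono) auto
    have b: "(1::real) \<le> 2 ^ t" by simp
    have "1 / q ^ t \<le> 1 / 2 ^ t" by (rule divide_left_mono) (use a b assms in auto)
    moreover have "1 / (2::real) ^ t \<le> 1" using b by simp
    ultimately show "0 \<le> 1 - 1 / (2::real) ^ t \<and> 1 - 1 / 2 ^ t \<le> 1 - 1 / q ^ t" by simp
  qed
  \<comment> \<open>The bound 1/4 alone does not survive the induction; the additional term does,
    with equality for one factor.\<close>
  have step: "(\<Prod>t = 1..Suc n. 1 - 1 / 2 ^ t :: real) \<ge> 1/4 + 1/2^(Suc (Suc n))" for n
  proof (induction n)
    case (Suc n)
    define x where "x = (1::real) / 2 ^ Suc n"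
    have ih: "1/4 + x/2 \<le> (\<Prod>t = 1..Suc n. 1 - 1 / 2 ^ t :: real)" using Suc.IH by (simp add: x_def)
    have "(1::real) \<le> 2 ^ n" by simp
    then have x: "0 \<le> x" "x \<le> 1/2" by (simp_all add: x_def field_simps)
    have "(\<Prod>t = 1..Suc (Suc n). 1 - 1 / 2 ^ t :: real) = (\<Prod>t = 1..Suc n. 1 - 1 / 2 ^ t) * (1 - x/2)"
      by (simp add: x_def)
    moreover have "(1/4 + x/2) * (1 - x/2) \<le> (\<Prod>t = 1..Suc n. 1 - 1 / 2 ^ t) * (1 - x/2)"
      by (rule mult_right_mono) (use ih x in simp_all)
    moreover have "(1/4 + x/2) * (1 - x/2) = 1/4 + x/4 + (x/8) * (1 - 2*x)" by (simp add: field_simps)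
    moreover have "(x/8) * (1 - 2*x) \<ge> 0" using x by simp
    moreover have "1/4 + x/4 \<ge> 1/4 + 1/2^(Suc (Suc (Suc n)))" by (simp add: x_def)
    ultimately show ?case by linarith
  qed simp
  then have "(\<Prod>t = 1..n. 1 - 1 / 2 ^ t :: real) \<ge> 1/4" if npos: "n > 0" for n
  proof -
    obtain n' where n': "n = Suc n'" using npos by (cases n) auto
    have "0 \<le> 1 / (2::real) ^ Suc (Suc n')" by simp
    with step[of n'] show ?thesis unfolding n' by linarith
  qed
  then have "(\<Prod>t = 1..n. 1 - 1 / 2 ^ t :: real) \<ge> 1/4" by (cases "n = 0") simp_all
  with le show ?thesis by linarith
qed

context finite_vectorspace
begin

text \<open>Each factor of this Gaussian binomial coefficient lies between
  \<open>q ^ (sdim W - d)\<close> and that power divided by \<open>1 - 1 / q ^ (d - i)\<close>. The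
  product of these corrections is at most 4 by
  \<open>prod_one_minus_inverse_power_ge\<close>.\<close>

lemma card_between_bounds:
  assumes "subspace K J V" "subspace K W V" "J \<subseteq> W" "sdim J \<le> d" "d \<le> sdim W"
  shows "real (card (between J W d)) \<ge> real q ^ ((sdim W - d) * (d - sdim J))" (is ?A)
    "real (card (between J W d)) \<le> 4 * real q ^ ((sdim W - d) * (d - sdim J))" (is ?B)
proof -
  let ?w = "sdim W" and ?j = "sdim J" and ?q = "real q"
  have q: "?q \<ge> 2" using q_ge_2 by linarith
  have pos: "?q ^ d - ?q ^ i > 0" if "i < d" for i using q that by simp
  have w: "?q ^ ?w = ?q ^ (?w - d) * ?q ^ d" using assms(5) by (simp flip: power_add)
  have "(\<Prod>i = ?j..<d. ?q ^ (?w - d)) \<le> (\<Prod>i = ?j..<d. (?q ^ ?w - ?q ^ i) / (?q ^ d - ?q ^ i))"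
  proof (rule prod_mono)
    fix i assume i: "i \<in> {?j..<d}"
    have "1 * ?q ^ i \<le> ?q ^ (?w - d) * ?q ^ i" using q by (intro mult_right_mono) auto
    then have "?q ^ (?w - d) * (?q ^ d - ?q ^ i) \<le> ?q ^ ?w - ?q ^ i" by (simp add: w algebra_simps)
    then show "0 \<le> ?q ^ (?w - d) \<and> ?q ^ (?w - d) \<le> (?q ^ ?w - ?q ^ i) / (?q ^ d - ?q ^ i)"
      using pos[of i] i by (simp add: pos_le_divide_eq)
  qed
  then show ?A using card_between[OF assms] by (simp add: power_mult)
  have "(\<Prod>i = ?j..<d. (?q ^ ?w - ?q ^ i) / (?q ^ d - ?q ^ i)) \<le> (\<Prod>i = ?j..<d. ?q ^ (?w - d) * (1 / (1 - 1 / ?q ^ (d - i))))"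
  proof (rule prod_mono)
    fix i assume i: "i \<in> {?j..<d}"
    have d: "?q ^ d = ?q ^ (d - i) * ?q ^ i" using i by (simp flip: power_add)
    have "?q ^ (?w - d) * (1 / (1 - 1 / ?q ^ (d - i))) = ?q ^ ?w / (?q ^ d - ?q ^ i)"
    proof -
      have "1 - 1 / ?q ^ (d - i) = (?q ^ d - ?q ^ i) / ?q ^ d" using q by (simp add: d field_simps)
      then show ?thesis using q by (simp add: w)
    qed
    moreover have "?q ^ i \<le> ?q ^ ?w" using i q assms(5) by (intro power_increasing) auto
    ultimately show "0 \<le> (?q ^ ?w - ?q ^ i) / (?q ^ d - ?q ^ i) \<and>
       (?q ^ ?w - ?q ^ i) / (?q ^ d - ?q ^ i) \<le> ?q ^ (?w - d) * (1 / (1 - 1 / ?q ^ (d - i)))"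
      using pos[of i] i q by (auto intro!: divide_right_mono)
  qed
  also have "\<dots> = ?q ^ ((?w - d) * (d - ?j)) * (1 / (\<Prod>i = ?j..<d. 1 - 1 / ?q ^ (d - i)))"
    by (simp add: prod.distrib prod_dividef power_mult)
  also have "(\<Prod>i = ?j..<d. 1 - 1 / ?q ^ (d - i)) = (\<Prod>t = 1..d - ?j. 1 - 1 / ?q ^ t)"
    by (rule prod.reindex_bij_witness[of _ "\<lambda>t. d - t" "\<lambda>i. d - i"]) auto
  also have "1 / (\<Prod>t = 1..d - ?j. 1 - 1 / ?q ^ t) \<le> 4"
    using prod_one_minus_inverse_power_ge[OF q, of "d - ?j"] by (simp add: divide_simps)
  finally show ?B using card_between[OF assms] q by (simp add: mult.commute)
qed

end

section \<open>Alternating maps and the exterior power\<close>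

text \<open>Closure under additive inverses comes from the scalar -1.\<close>

lemma submodule_imp_Module_submodule:
  assumes "LinearCombinations.submodule R N M"
  shows "Module.submodule N R M"
proof -
  interpret N: LinearCombinations.submodule R N M by fact
  interpret M: module R M by (rule N.module)
  show ?thesis
  proof (rule M.submoduleI)
    fix a assume a: "a \<in> N"
    then have "(\<ominus>\<^bsub>R\<^esub> \<one>\<^bsub>R\<^esub>) \<odot>\<^bsub>M\<^esub> a \<in> N" by simp
    then show "\<ominus>\<^bsub>M\<^esub> a \<in> N" using a N.subset by (simp add: M.smult_minus_1 subsetD)
  qed (use N.subset in auto)
qed

text \<open>What the exterior power needs of the quotient besides \<open>module_quotient\<close>:
  the canonical map, and the way back from a coset to an element of \<open>M\<close>.\<close>

lemma quotient_module_hom: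
  assumes "module F M" "Module.submodule W F M"
  shows "(\<lambda>x. W +>\<^bsub>M\<^esub> x) \<in> module_hom F M (quotient_module M W)"
    and "carrier (quotient_module M W) = (\<lambda>x. W +>\<^bsub>M\<^esub> x) ` carrier M"
    and "\<And>x. x \<in> W \<Longrightarrow> W +>\<^bsub>M\<^esub> x = \<zero>\<^bsub>quotient_module M W\<^esub>"
    and "\<And>x y. x \<in> carrier M \<Longrightarrow> y \<in> W +>\<^bsub>M\<^esub> x \<Longrightarrow> \<exists>w\<in>W. y = w \<oplus>\<^bsub>M\<^esub> x"
    and "\<And>x. x \<in> carrier M \<Longrightarrow> x \<in> W +>\<^bsub>M\<^esub> x"
proof -
  interpret M: module F M by fact
  interpret W: Module.submodule W F M by fact
  have sg: "abelian_subgroup W M"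
    by (rule abelian_subgroupI3) (auto intro!: additive_subgroupI W.subgroup_axioms M.abelian_group_axioms)
  interpret A: abelian_subgroup W M by (rule sg)
  have smul: "a \<odot>\<^bsub>quotient_module M W\<^esub> (W +>\<^bsub>M\<^esub> x) = W +>\<^bsub>M\<^esub> (a \<odot>\<^bsub>M\<^esub> x)"
    if "a \<in> carrier F" "x \<in> carrier M" for a x
  proof -
    have "(\<lambda>x. a \<odot>\<^bsub>M\<^esub> x) ` (W +>\<^bsub>M\<^esub> x) <+>\<^bsub>M\<^esub> W
        = (\<Union>w\<in>W. \<Union>w'\<in>W. {a \<odot>\<^bsub>M\<^esub> (w \<oplus>\<^bsub>M\<^esub> x) \<oplus>\<^bsub>M\<^esub> w'})"
      by (auto simp: a_r_coset_def' set_add_def')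
    also have "\<dots> = (\<Union>w\<in>W. {w \<oplus>\<^bsub>M\<^esub> a \<odot>\<^bsub>M\<^esub> x})"
    proof (intro equalityI subsetI)
      fix z assume "z \<in> (\<Union>w\<in>W. \<Union>w'\<in>W. {a \<odot>\<^bsub>M\<^esub> (w \<oplus>\<^bsub>M\<^esub> x) \<oplus>\<^bsub>M\<^esub> w'})"
      then obtain w w' where w: "w \<in> W" "w' \<in> W" "z = a \<odot>\<^bsub>M\<^esub> (w \<oplus>\<^bsub>M\<^esub> x) \<oplus>\<^bsub>M\<^esub> w'" by auto
      then have "z = (a \<odot>\<^bsub>M\<^esub> w \<oplus>\<^bsub>M\<^esub> w') \<oplus>\<^bsub>M\<^esub> a \<odot>\<^bsub>M\<^esub> x"
        using that A.a_subset by (simp add: M.smult_r_distr M.a_ac subsetD)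
      then show "z \<in> (\<Union>w\<in>W. {w \<oplus>\<^bsub>M\<^esub> a \<odot>\<^bsub>M\<^esub> x})" using w that by (auto intro!: A.a_closed)
    next
      fix z assume "z \<in> (\<Union>w\<in>W. {w \<oplus>\<^bsub>M\<^esub> a \<odot>\<^bsub>M\<^esub> x})"
      then obtain w where w: "w \<in> W" "z = w \<oplus>\<^bsub>M\<^esub> a \<odot>\<^bsub>M\<^esub> x" by auto
      then have "z = a \<odot>\<^bsub>M\<^esub> (\<zero>\<^bsub>M\<^esub> \<oplus>\<^bsub>M\<^esub> x) \<oplus>\<^bsub>M\<^esub> w"
        using that A.a_subset by (simp add: M.a_ac subsetD)
      then show "z \<in> (\<Union>w\<in>W. \<Union>w'\<in>W. {a \<odot>\<^bsub>M\<^esub> (w \<oplus>\<^bsub>M\<^esub> x) \<oplus>\<^bsub>M\<^esub> w'})" using w A.zero_closed by blast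
    qed
    finally show ?thesis by (simp add: quotient_module_def a_r_coset_def')
  qed
  show car: "carrier (quotient_module M W) = (\<lambda>x. W +>\<^bsub>M\<^esub> x) ` carrier M"
    by (auto simp: quotient_module_def A_RCOSETS_def RCOSETS_def a_r_coset_def)
  show "(\<lambda>x. W +>\<^bsub>M\<^esub> x) \<in> module_hom F M (quotient_module M W)"
    unfolding module_hom_def using car smul by (auto simp: quotient_module_def A.a_rcos_sum)
  show "W +>\<^bsub>M\<^esub> x = \<zero>\<^bsub>quotient_module M W\<^esub>" if "x \<in> W" for x
    using A.a_rcos_const[OF that] by (simp add: quotient_module_def)
  show "\<exists>w\<in>W. y = w \<oplus>\<^bsub>M\<^esub> x" if "x \<in> carrier M" "y \<in> W +>\<^bsub>M\<^esub> x" for x y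
    using that by (auto simp: a_r_coset_def')
  show "x \<in> W +>\<^bsub>M\<^esub> x" if "x \<in> carrier M" for x
    using that A.zero_closed by (force simp: a_r_coset_def')
qed

section \<open>The exterior power and its universal property\<close>

context finite_vectorspace
begin

abbreviation tup :: "nat \<Rightarrow> (nat \<Rightarrow> 'c) set" where "tup k \<equiv> tuples k (carrier V)"

lemma finite_tup: "finite (tup k)"
  unfolding tuples_def by (intro finite_PiE) (auto simp: finite_V)

lemma tuples_upd: "t \<in> tuples k H \<Longrightarrow> i < k \<Longrightarrow> u \<in> H \<Longrightarrow> t(i := u) \<in> tuples k H"
  unfolding tuples_def by (auto simp: PiE_iff extensional_def)

lemma tuples_mem: "t \<in> tuples k H \<Longrightarrow> i < k \<Longrightarrow> t i \<in> H"
  unfolding tuples_def by auto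

lemma tuples_mono: "H \<subseteq> H' \<Longrightarrow> tuples k H \<subseteq> tuples k H'"
  unfolding tuples_def by (rule PiE_mono) auto

lemma free_tuples_simps:
  "carrier (free_tuples K k V) = tup k \<rightarrow>\<^sub>E carrier K"
  "f \<oplus>\<^bsub>free_tuples K k V\<^esub> g = (\<lambda>v\<in>tup k. f v \<oplus>\<^bsub>K\<^esub> g v)"
  "a \<odot>\<^bsub>free_tuples K k V\<^esub> f = (\<lambda>v\<in>tup k. a \<otimes>\<^bsub>K\<^esub> f v)"
  "\<zero>\<^bsub>free_tuples K k V\<^esub> = (\<lambda>v\<in>tup k. \<zero>\<^bsub>K\<^esub>)"
  by (simp_all add: free_tuples_def func_space_def)

lemma free_tuples_module: "module K (free_tuples K k V)"
  unfolding free_tuples_def by (rule func_space_is_module)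

lemma tuple_gen_closed: "tuple_gen K k V t \<in> carrier (free_tuples K k V)"
  unfolding free_tuples_simps tuple_gen_def by auto

lemma wedge_relations_subset: "wedge_relations K k V \<subseteq> carrier (free_tuples K k V)"
proof -
  interpret FT: module K "free_tuples K k V" by (rule free_tuples_module)
  note tuple_gen_closed[simp]
  show ?thesis unfolding wedge_relations_def by (auto simp del: fun_upd_apply)
qed

lemma wedge_kernel_submodule: "LinearCombinations.submodule K (wedge_kernel K k V) (free_tuples K k V)"
proof -
  interpret FT: module K "free_tuples K k V" by (rule free_tuples_module)
  show ?thesis unfolding wedge_kernel_def by (rule FT.span_is_submodule[OF wedge_relations_subset])
qed

lemma wedge_kernel_Msubmodule: "Module.submodule (wedge_kernel K k V) K (free_tuples K k V)"
  by (rule submodule_imp_Module_submodule[OF wedge_kernel_submodule])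

lemmas wedge_coset = quotient_module_hom[OF free_tuples_module wedge_kernel_Msubmodule, folded exterior_power_def]

lemma exterior_power_module: "module K (exterior_power K k V)"
  unfolding exterior_power_def by (rule module_quotient[OF free_tuples_module wedge_kernel_Msubmodule])

text \<open>The usual alternating multilinear maps. The clauses are the three families of
  \<open>wedge_relations\<close>, with equations in \<open>W\<close> in place of differences, so
  that such a map descends to the quotient.\<close>

definition alternating :: "nat \<Rightarrow> ('a, 'w, 'f) module_scheme \<Rightarrow> ((nat \<Rightarrow> 'c) \<Rightarrow> 'w) \<Rightarrow> bool" where
  "alternating k W T \<longleftrightarrow> T \<in> tup k \<rightarrow> carrier W
    \<and> (\<forall>t\<in>tup k. \<forall>i<k. \<forall>u\<in>carrier V. \<forall>v\<in>carrier V. T (t(i := u \<oplus>\<^bsub>V\<^esub> v)) = T (t(i := u)) \<oplus>\<^bsub>W\<^esub> T (t(i := v)))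
    \<and> (\<forall>t\<in>tup k. \<forall>i<k. \<forall>a\<in>carrier K. \<forall>u\<in>carrier V. T (t(i := a \<odot>\<^bsub>V\<^esub> u)) = a \<odot>\<^bsub>W\<^esub> T (t(i := u)))
    \<and> (\<forall>t\<in>tup k. \<forall>i j. i < j \<and> j < k \<and> t i = t j \<longrightarrow> T t = \<zero>\<^bsub>W\<^esub>)"

lemma alternatingD:
  assumes "alternating k W T"
  shows "\<And>t. t \<in> tup k \<Longrightarrow> T t \<in> carrier W"
    "\<And>t i u v. t \<in> tup k \<Longrightarrow> i < k \<Longrightarrow> u \<in> carrier V \<Longrightarrow> v \<in> carrier V \<Longrightarrow>
       T (t(i := u \<oplus>\<^bsub>V\<^esub> v)) = T (t(i := u)) \<oplus>\<^bsub>W\<^esub> T (t(i := v))"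
    "\<And>t i a u. t \<in> tup k \<Longrightarrow> i < k \<Longrightarrow> a \<in> carrier K \<Longrightarrow> u \<in> carrier V \<Longrightarrow>
       T (t(i := a \<odot>\<^bsub>V\<^esub> u)) = a \<odot>\<^bsub>W\<^esub> T (t(i := u))"
    "\<And>t i j. t \<in> tup k \<Longrightarrow> i < k \<Longrightarrow> j < k \<Longrightarrow> i \<noteq> j \<Longrightarrow> t i = t j \<Longrightarrow> T t = \<zero>\<^bsub>W\<^esub>"
proof -
  show "T t = \<zero>\<^bsub>W\<^esub>" if "t \<in> tup k" "i < k" "j < k" "i \<noteq> j" "t i = t j" for t i j
    using assms that unfolding alternating_def by (metis nat_neq_iff)
qed (use assms in \<open>unfold alternating_def, blast+\<close>)

lemma wedge_alternating: "alternating k (exterior_power K k V) (wedge K k V)"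
proof -
  interpret FT: module K "free_tuples K k V" by (rule free_tuples_module)
  interpret P: module K "exterior_power K k V" by (rule exterior_power_module)
  let ?FT = "free_tuples K k V" and ?P = "exterior_power K k V" and ?g = "tuple_gen K k V"
  let ?pi = "\<lambda>x. wedge_kernel K k V +>\<^bsub>free_tuples K k V\<^esub> x"
  interpret pi: mod_hom K ?FT ?P ?pi by unfold_locales (rule wedge_coset(1))
  have rel: "x \<in> wedge_kernel K k V" if "x \<in> wedge_relations K k V" for x
    using that FT.in_own_span[OF wedge_relations_subset]
    unfolding wedge_kernel_def by blast
  have eq: "?pi x = ?pi y" if "x \<ominus>\<^bsub>?FT\<^esub> y \<in> wedge_relations K k V" "x \<in> carrier ?FT" "y \<in> carrier ?FT" for x y
  proof -
    have "?pi x = ?pi ((x \<ominus>\<^bsub>?FT\<^esub> y) \<oplus>\<^bsub>?FT\<^esub> y)" using that by (simp add: FT.minus_eq FT.M.a_assoc FT.M.l_neg)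
    also have "\<dots> = ?pi (x \<ominus>\<^bsub>?FT\<^esub> y) \<oplus>\<^bsub>?P\<^esub> ?pi y" using that by (intro pi.f_add) auto
    also have "?pi (x \<ominus>\<^bsub>?FT\<^esub> y) = \<zero>\<^bsub>?P\<^esub>" using wedge_coset(3) rel that(1) by blast
    finally show ?thesis using that pi.f_im by simp
  qed
  note g = tuple_gen_closed
  show ?thesis unfolding alternating_def wedge_def
  proof (intro conjI ballI allI impI funcsetI)
    fix t show "?pi (?g t) \<in> carrier ?P" using pi.f_im g by auto
  next
    fix t i u v assume *: "t \<in> tup k" "i < k" "u \<in> carrier V" "v \<in> carrier V"
    have "?pi (?g (t(i := u \<oplus>\<^bsub>V\<^esub> v))) = ?pi (?g (t(i := u)) \<oplus>\<^bsub>?FT\<^esub> ?g (t(i := v)))"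
      by (rule eq) (use * g in \<open>auto simp: wedge_relations_def simp del: fun_upd_apply\<close>)
    then show "?pi (?g (t(i := u \<oplus>\<^bsub>V\<^esub> v))) = ?pi (?g (t(i := u))) \<oplus>\<^bsub>?P\<^esub> ?pi (?g (t(i := v)))"
      using pi.f_add g by simp
  next
    fix t i a u assume *: "t \<in> tup k" "i < k" "a \<in> carrier K" "u \<in> carrier V"
    have "?pi (?g (t(i := a \<odot>\<^bsub>V\<^esub> u))) = ?pi (a \<odot>\<^bsub>?FT\<^esub> ?g (t(i := u)))"
      by (rule eq) (use * g in \<open>auto simp: wedge_relations_def simp del: fun_upd_apply\<close>)
    then show "?pi (?g (t(i := a \<odot>\<^bsub>V\<^esub> u))) = a \<odot>\<^bsub>?P\<^esub> ?pi (?g (t(i := u)))"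
      using pi.f_smult g * by simp
  next
    fix t i j assume "t \<in> tup k" "i < j \<and> j < k \<and> t i = t j"
    then have "?g t \<in> wedge_relations K k V" unfolding wedge_relations_def by blast
    then show "?pi (?g t) = \<zero>\<^bsub>?P\<^esub>" using wedge_coset(3) rel by blast
  qed
qed

lemma alternating_hom_comp:
  assumes "alternating k P T" "\<theta> \<in> module_hom K P W" "module K P" "module K W"
  shows "alternating k W (\<lambda>t. \<theta> (T t))"
proof -
  interpret h: mod_hom K P W \<theta> using assms by (simp add: mod_hom_def mod_hom_axioms_def)
  note D = alternatingD[OF assms(1)]
  show ?thesis unfolding alternating_def
  proof (intro conjI ballI allI impI funcsetI)
    fix t i j assume "t \<in> tup k" "i < j \<and> j < k \<and> t i = t j"
    then have "T t = \<zero>\<^bsub>P\<^esub>" using D(4)[of t i j] by auto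
    then show "\<theta> (T t) = \<zero>\<^bsub>W\<^esub>" by simp
  next
    fix t assume "t \<in> tup k" then show "\<theta> (T t) \<in> carrier W" using D(1) by simp
  next
    fix t i u v assume *: "t \<in> tup k" "i < k" "u \<in> carrier V" "v \<in> carrier V"
    show "\<theta> (T (t(i := u \<oplus>\<^bsub>V\<^esub> v))) = \<theta> (T (t(i := u))) \<oplus>\<^bsub>W\<^esub> \<theta> (T (t(i := v)))"
      unfolding D(2)[OF *] using D(1)[OF tuples_upd[OF *(1,2)]] * by (intro h.f_add) blast+
  next
    fix t i a u assume *: "t \<in> tup k" "i < k" "a \<in> carrier K" "u \<in> carrier V"
    show "\<theta> (T (t(i := a \<odot>\<^bsub>V\<^esub> u))) = a \<odot>\<^bsub>W\<^esub> \<theta> (T (t(i := u)))"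
      unfolding D(3)[OF *] using D(1)[OF tuples_upd[OF *(1,2)]] * by (intro h.f_smult) blast+
  qed
qed

text \<open>The wedges generate the exterior power: every element is the image of a function
  \<open>f\<close> on tuples, and \<open>f\<close> is taken apart one tuple of its support at a
  time.\<close>

lemma exterior_hom_eqI:
  assumes "\<theta> \<in> module_hom K (exterior_power K k V) W" "\<theta>' \<in> module_hom K (exterior_power K k V) W"
    "module K W" "\<And>t. t \<in> tup k \<Longrightarrow> \<theta> (wedge K k V t) = \<theta>' (wedge K k V t)"
    "x \<in> carrier (exterior_power K k V)"
  shows "\<theta> x = \<theta>' x"
proof -
  let ?FT = "free_tuples K k V" and ?P = "exterior_power K k V" and ?g = "tuple_gen K k V"
  let ?pi = "\<lambda>x. wedge_kernel K k V +>\<^bsub>free_tuples K k V\<^esub> x"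
  interpret FT: module K ?FT by (rule free_tuples_module)
  interpret P: module K ?P by (rule exterior_power_module)
  interpret W: module K W by fact
  interpret pi: mod_hom K ?FT ?P ?pi by unfold_locales (rule wedge_coset(1))
  interpret t1: mod_hom K ?P W \<theta> using assms by unfold_locales
  interpret t2: mod_hom K ?P W \<theta>' using assms by unfold_locales
  have "\<theta> (?pi f) = \<theta>' (?pi f)"
    if "finite S" "S \<subseteq> tup k" "f \<in> carrier ?FT" "\<And>t. t \<in> tup k - S \<Longrightarrow> f t = \<zero>\<^bsub>K\<^esub>" for S f
    using that
  proof (induction S arbitrary: f rule: finite_induct)
    case empty
    then have "f = \<zero>\<^bsub>?FT\<^esub>" unfolding free_tuples_simps by (auto simp: PiE_iff extensional_def fun_eq_iff)
    then show ?case by simp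
  next
    case (insert s S)
    let ?f = "f(s := \<zero>\<^bsub>K\<^esub>)"
    have s: "s \<in> tup k" using insert by auto
    have fF: "?f \<in> carrier ?FT" using insert.prems s unfolding free_tuples_simps
      by (auto simp: PiE_iff extensional_def)
    have fs: "f s \<in> carrier K" using insert.prems s unfolding free_tuples_simps by auto
    have dec: "f = ?f \<oplus>\<^bsub>?FT\<^esub> f s \<odot>\<^bsub>?FT\<^esub> ?g s"
    proof
      fix x show "f x = (?f \<oplus>\<^bsub>?FT\<^esub> f s \<odot>\<^bsub>?FT\<^esub> ?g s) x"
        using insert.prems s fs unfolding free_tuples_simps tuple_gen_def
        by (cases "x \<in> tup k") (auto simp: PiE_iff extensional_def)
    qed
    have ih: "\<theta> (?pi ?f) = \<theta>' (?pi ?f)"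
      by (rule insert.IH[OF _ fF]) (use insert.prems in \<open>auto simp: fun_upd_apply\<close>)
    have g: "?g s \<in> carrier ?FT" "f s \<odot>\<^bsub>?FT\<^esub> ?g s \<in> carrier ?FT" using tuple_gen_closed fs by auto
    have "?pi f = ?pi ?f \<oplus>\<^bsub>?P\<^esub> f s \<odot>\<^bsub>?P\<^esub> ?pi (?g s)"
      by (subst dec) (simp only: pi.f_add[OF fF g(2)] pi.f_smult[OF fs g(1)])
    moreover have "\<theta> (?pi (?g s)) = \<theta>' (?pi (?g s))" using assms(4)[OF s] by (simp add: wedge_def)
    ultimately show ?case using ih pi.f_im[OF fF] pi.f_im[OF g(1)] fs by simp
  qed
  moreover obtain f where "f \<in> carrier ?FT" "x = ?pi f" using assms(5) wedge_coset(2) by auto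
  ultimately show ?thesis using finite_tup by blast
qed

text \<open>Universal property: the linear extension \<open>\<phi>\<close> of \<open>T\<close> to
  the free module kills every relation, hence factors through the quotient.\<close>

lemma alternating_lift:
  assumes T: "alternating k W T" and W: "module K W"
  shows "\<exists>\<theta>\<in>lin_maps K (exterior_power K k V) W. \<forall>t\<in>tup k. \<theta> (wedge K k V t) = T t"
proof -
  let ?FT = "free_tuples K k V" and ?P = "exterior_power K k V" and ?g = "tuple_gen K k V"
  let ?pi = "\<lambda>x. wedge_kernel K k V +>\<^bsub>free_tuples K k V\<^esub> x"
  interpret FT: module K ?FT by (rule free_tuples_module)
  interpret P: module K ?P by (rule exterior_power_module)
  interpret W: module K W by fact
  interpret pi: mod_hom K ?FT ?P ?pi by unfold_locales (rule wedge_coset(1))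
  define \<phi> where "\<phi> f = (\<Oplus>\<^bsub>W\<^esub>t\<in>tup k. f t \<odot>\<^bsub>W\<^esub> T t)" for f
  note D = alternatingD[OF T]
  have hom: "\<phi> \<in> module_hom K ?FT W"
    unfolding module_hom_def
  proof (intro CollectI conjI allI impI)
    show "\<phi> \<in> carrier ?FT \<rightarrow> carrier W" using D(1) unfolding \<phi>_def free_tuples_simps
      by (auto intro!: W.M.finsum_closed)
    fix f g assume fg: "f \<in> carrier ?FT \<and> g \<in> carrier ?FT"
    have "\<phi> (f \<oplus>\<^bsub>?FT\<^esub> g) = (\<Oplus>\<^bsub>W\<^esub>t\<in>tup k. f t \<odot>\<^bsub>W\<^esub> T t \<oplus>\<^bsub>W\<^esub> g t \<odot>\<^bsub>W\<^esub> T t)"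
      unfolding \<phi>_def using fg D(1) unfolding free_tuples_simps
      by (intro W.M.finsum_cong') (auto simp: W.smult_l_distr PiE_iff)
    also have "\<dots> = \<phi> f \<oplus>\<^bsub>W\<^esub> \<phi> g"
      unfolding \<phi>_def using fg D(1) unfolding free_tuples_simps
      by (intro W.M.finsum_addf) (auto simp: PiE_iff)
    finally show "\<phi> (f \<oplus>\<^bsub>?FT\<^esub> g) = \<phi> f \<oplus>\<^bsub>W\<^esub> \<phi> g" .
  next
    fix a f assume af: "a \<in> carrier K \<and> f \<in> carrier ?FT"
    have "\<phi> (a \<odot>\<^bsub>?FT\<^esub> f) = (\<Oplus>\<^bsub>W\<^esub>t\<in>tup k. a \<odot>\<^bsub>W\<^esub> (f t \<odot>\<^bsub>W\<^esub> T t))"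
      unfolding \<phi>_def using af D(1) unfolding free_tuples_simps
      by (intro W.M.finsum_cong') (auto simp: W.smult_assoc1 PiE_iff)
    also have "\<dots> = a \<odot>\<^bsub>W\<^esub> \<phi> f"
      unfolding \<phi>_def using af D(1) unfolding free_tuples_simps
      by (intro W.finsum_smult[symmetric]) (auto simp: PiE_iff)
    finally show "\<phi> (a \<odot>\<^bsub>?FT\<^esub> f) = a \<odot>\<^bsub>W\<^esub> \<phi> f" .
  qed
  interpret phi: mod_hom K ?FT W \<phi> using hom by unfold_locales
  have gen: "\<phi> (?g t) = T t" if t: "t \<in> tup k" for t
  proof -
    have "\<phi> (?g t) = (\<Oplus>\<^bsub>W\<^esub>s\<in>tup k. if t = s then T s else \<zero>\<^bsub>W\<^esub>)"
      unfolding \<phi>_def tuple_gen_def using D(1) by (intro W.M.finsum_cong') auto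
    also have "\<dots> = T t" using t finite_tup D(1) by (intro W.M.finsum_singleton) auto
    finally show ?thesis .
  qed
  note g = tuple_gen_closed
  have "wedge_relations K k V \<subseteq> phi.ker"
  proof
    fix x assume "x \<in> wedge_relations K k V"
    then show "x \<in> phi.ker"
      unfolding wedge_relations_def
    proof (elim UnE CollectE exE conjE)
      fix t i u v
      assume x: "x = ?g (t(i := u \<oplus>\<^bsub>V\<^esub> v)) \<ominus>\<^bsub>?FT\<^esub> (?g (t(i := u)) \<oplus>\<^bsub>?FT\<^esub> ?g (t(i := v)))"
        and *: "t \<in> tup k" "i < k" "u \<in> carrier V" "v \<in> carrier V"
      have up: "t(i := u) \<in> tup k" "t(i := v) \<in> tup k" "t(i := u \<oplus>\<^bsub>V\<^esub> v) \<in> tup k"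
        using * by (intro tuples_upd; simp)+
      have "\<phi> x = \<phi> (?g (t(i := u \<oplus>\<^bsub>V\<^esub> v))) \<ominus>\<^bsub>W\<^esub> (\<phi> (?g (t(i := u))) \<oplus>\<^bsub>W\<^esub> \<phi> (?g (t(i := v))))"
        unfolding x using g by (simp only: phi.f_minus phi.f_add FT.M.a_closed)
      also have "\<dots> = \<zero>\<^bsub>W\<^esub>"
        unfolding gen[OF up(1)] gen[OF up(2)] gen[OF up(3)] D(2)[OF *]
        using D(1)[OF up(1)] D(1)[OF up(2)] by (simp only: W.M.minus_eq W.M.r_neg W.M.a_closed)
      finally show ?thesis unfolding phi.ker_def x using g by simp
    next
      fix t i a u
      assume x: "x = ?g (t(i := a \<odot>\<^bsub>V\<^esub> u)) \<ominus>\<^bsub>?FT\<^esub> (a \<odot>\<^bsub>?FT\<^esub> ?g (t(i := u)))"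
        and *: "t \<in> tup k" "i < k" "a \<in> carrier K" "u \<in> carrier V"
      have up: "t(i := u) \<in> tup k" "t(i := a \<odot>\<^bsub>V\<^esub> u) \<in> tup k"
        using * by (intro tuples_upd; simp)+
      have "\<phi> x = \<phi> (?g (t(i := a \<odot>\<^bsub>V\<^esub> u))) \<ominus>\<^bsub>W\<^esub> (a \<odot>\<^bsub>W\<^esub> \<phi> (?g (t(i := u))))"
        unfolding x using g *(3) by (simp only: phi.f_minus phi.f_smult FT.smult_closed)
      also have "\<dots> = \<zero>\<^bsub>W\<^esub>"
        unfolding gen[OF up(1)] gen[OF up(2)] D(3)[OF *]
        using D(1)[OF up(1)] *(3) by (simp only: W.M.minus_eq W.M.r_neg W.smult_closed)
      finally show ?thesis unfolding phi.ker_def x using g *(3) by simp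
    next
      fix t i j assume *: "x = ?g t" "t \<in> tup k" "i < j" "j < k" "t i = t j"
      then show ?thesis using D(4)[of t i j] gen g by (simp add: phi.ker_def)
    qed
  qed
  then have ker: "wedge_kernel K k V \<subseteq> phi.ker"
    unfolding wedge_kernel_def by (rule FT.span_is_subset[OF _ phi.ker_is_submodule])
  \<comment> \<open>Any representative may be chosen, since two of them differ by an element of the
    kernel of \<open>\<phi>\<close>. The restriction to the carrier makes the map extensional, as
    \<open>lin_maps\<close> requires.\<close>
  define \<theta> where "\<theta> = (\<lambda>C\<in>carrier ?P. \<phi> (SOME x. x \<in> C))"
  have val: "\<theta> (?pi x) = \<phi> x" if x: "x \<in> carrier ?FT" for x
  proof -
    have "(SOME y. y \<in> ?pi x) \<in> ?pi x" using wedge_coset(5)[OF x] by (rule someI[where P = "\<lambda>y. y \<in> ?pi x"])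
    then obtain w where w: "w \<in> wedge_kernel K k V" "(SOME y. y \<in> ?pi x) = w \<oplus>\<^bsub>?FT\<^esub> x"
      using wedge_coset(4)[OF x] by blast
    have "w \<in> carrier ?FT" "\<phi> w = \<zero>\<^bsub>W\<^esub>" using w ker by (auto simp: phi.ker_def)
    then have "\<phi> (w \<oplus>\<^bsub>?FT\<^esub> x) = \<phi> x" using x phi.f_im[OF x] by simp
    then show ?thesis using w x pi.f_im[OF x] by (simp add: \<theta>_def)
  qed
  have "\<theta> \<in> module_hom K ?P W"
    unfolding module_hom_def
  proof (intro CollectI conjI allI impI)
    show "\<theta> \<in> carrier ?P \<rightarrow> carrier W" using val phi.f_im wedge_coset(2) by auto
    fix x y assume "x \<in> carrier ?P \<and> y \<in> carrier ?P"
    then obtain f g where fg: "f \<in> carrier ?FT" "g \<in> carrier ?FT" "x = ?pi f" "y = ?pi g"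
      using wedge_coset(2) by auto
    then show "\<theta> (x \<oplus>\<^bsub>?P\<^esub> y) = \<theta> x \<oplus>\<^bsub>W\<^esub> \<theta> y"
      by (simp add: val flip: pi.f_add)
  next
    fix a x assume "a \<in> carrier K \<and> x \<in> carrier ?P"
    then obtain f where fg: "a \<in> carrier K" "f \<in> carrier ?FT" "x = ?pi f"
      using wedge_coset(2) by auto
    then show "\<theta> (a \<odot>\<^bsub>?P\<^esub> x) = a \<odot>\<^bsub>W\<^esub> \<theta> x"
      by (simp add: val flip: pi.f_smult)
  qed
  then have "\<theta> \<in> lin_maps K ?P W" unfolding lin_maps_def \<theta>_def by auto
  moreover have "\<theta> (wedge K k V t) = T t" if "t \<in> tup k" for t
    unfolding wedge_def using val[OF g] gen[OF that] by simp
  ultimately show ?thesis by blast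
qed

end

section \<open>Determinants over a commutative ring\<close>

context cring
begin

text \<open>The Leibniz formula, with the permutations separated by parity so that no sign has to be
  represented in the ring. It supplies the minors that are dual to the basis wedges.\<close>

definition leibniz_det :: "nat \<Rightarrow> (nat \<Rightarrow> nat \<Rightarrow> 'a) \<Rightarrow> 'a" where
  "leibniz_det k a = (\<Oplus>p\<in>{p. p permutes {..<k} \<and> evenperm p}. \<Otimes>l\<in>{..<k}. a l (p l))
     \<ominus> (\<Oplus>p\<in>{p. p permutes {..<k} \<and> \<not> evenperm p}. \<Otimes>l\<in>{..<k}. a l (p l))"

lemma permutes_less: "p permutes {..<k} \<Longrightarrow> l < k \<Longrightarrow> p l < (k::nat)"
  using permutes_in_image[of p "{..<k}" l] by simp

lemma finite_permutations_filter: "finite {p. p permutes {..<k::nat} \<and> P p}"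
  by (rule finite_subset[OF _ finite_permutations[of "{..<k}"]]) auto

lemma leibniz_det_closed: "(\<And>l m. l < k \<Longrightarrow> m < k \<Longrightarrow> a l m \<in> carrier R) \<Longrightarrow> leibniz_det k a \<in> carrier R"
  unfolding leibniz_det_def by (intro minus_closed finsum_closed funcsetI finprod_closed) (auto simp: permutes_less)

lemma leibniz_det_cong:
  assumes "\<And>l m. l < k \<Longrightarrow> m < k \<Longrightarrow> a l m = b l m" "\<And>l m. l < k \<Longrightarrow> m < k \<Longrightarrow> b l m \<in> carrier R"
  shows "leibniz_det k a = leibniz_det k b"
proof -
  have "(\<Otimes>l\<in>{..<k}. a l (p l)) = (\<Otimes>l\<in>{..<k}. b l (p l))" if "p permutes {..<k}" for p
    using assms permutes_less[OF that] by (intro finprod_cong') auto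
  moreover have "(\<Otimes>l\<in>{..<k}. b l (p l)) \<in> carrier R" if "p permutes {..<k}" for p
    using assms permutes_less[OF that] by (intro finprod_closed) auto
  ultimately show ?thesis unfolding leibniz_det_def
    by (intro arg_cong2[where f = "\<lambda>x y. x \<ominus> y"] finsum_cong') auto
qed

lemma prod_row:
  assumes "(i::nat) < k" "p permutes {..<k}" "\<And>l m. l < k \<Longrightarrow> m < k \<Longrightarrow> a l m \<in> carrier R"
    "\<And>m. m < k \<Longrightarrow> x m \<in> carrier R"
  shows "(\<Otimes>l\<in>{..<k}. (a(i := x)) l (p l)) = x (p i) \<otimes> (\<Otimes>l\<in>{..<k} - {i}. a l (p l))"
proof -
  have "{..<k} = insert i ({..<k} - {i})" using assms(1) by auto
  then have "(\<Otimes>l\<in>{..<k}. (a(i := x)) l (p l)) = (\<Otimes>l\<in>insert i ({..<k} - {i}). (a(i := x)) l (p l))" by simp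
  also have "\<dots> = (a(i := x)) i (p i) \<otimes> (\<Otimes>l\<in>{..<k} - {i}. (a(i := x)) l (p l))"
    using assms permutes_less[OF assms(2)] by (intro finprod_insert) auto
  also have "(\<Otimes>l\<in>{..<k} - {i}. (a(i := x)) l (p l)) = (\<Otimes>l\<in>{..<k} - {i}. a l (p l))"
    using assms permutes_less[OF assms(2)] by (intro finprod_cong') auto
  finally show ?thesis by simp
qed

lemma rest_closed:
  assumes "p permutes {..<k::nat}" "\<And>l m. l < k \<Longrightarrow> m < k \<Longrightarrow> a l m \<in> carrier R"
  shows "(\<Otimes>l\<in>{..<k} - {i}. a l (p l)) \<in> carrier R"
  using assms permutes_less[OF assms(1)] by (intro finprod_closed) auto

text \<open>Every product contains exactly one factor from row \<open>i\<close>, so that each of the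
  two parity sums is additive in this row.\<close>

lemma leibniz_det_row_add:
  assumes "i < k" "\<And>l m. l < k \<Longrightarrow> m < k \<Longrightarrow> a l m \<in> carrier R"
    "\<And>m. m < k \<Longrightarrow> x m \<in> carrier R" "\<And>m. m < k \<Longrightarrow> y m \<in> carrier R"
  shows "leibniz_det k (a(i := \<lambda>m. x m \<oplus> y m)) = leibniz_det k (a(i := x)) \<oplus> leibniz_det k (a(i := y))"
proof -
  let ?R = "\<lambda>p. \<Otimes>l\<in>{..<k} - {i}. a l (p l)"
  have sum: "(\<Oplus>p\<in>S. \<Otimes>l\<in>{..<k}. (a(i := \<lambda>m. x m \<oplus> y m)) l (p l))
     = (\<Oplus>p\<in>S. \<Otimes>l\<in>{..<k}. (a(i := x)) l (p l)) \<oplus> (\<Oplus>p\<in>S. \<Otimes>l\<in>{..<k}. (a(i := y)) l (p l))"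
    if S: "S \<subseteq> {p. p permutes {..<k}}" for S
  proof -
    have p: "p permutes {..<k}" "p i < k" if "p \<in> S" for p using that S permutes_less[of p k i] assms(1) by auto
    have rc: "?R p \<in> carrier R" if "p \<in> S" for p
      by (rule rest_closed) (use p[OF that] assms(2) in auto)
    have row: "(\<Otimes>l\<in>{..<k}. (a(i := z)) l (p l)) = z (p i) \<otimes> ?R p"
      if "p \<in> S" "\<And>m. m < k \<Longrightarrow> z m \<in> carrier R" for z p
      by (rule prod_row) (use p[OF that(1)] that(2) assms(1,2) in auto)
    have c: "(\<Otimes>l\<in>{..<k}. (a(i := z)) l (p l)) \<in> carrier R" if "p \<in> S" "\<And>m. m < k \<Longrightarrow> z m \<in> carrier R" for z p
      using row[OF that] rc[OF that(1)] that(2) p[OF that(1)] by simp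
    have "(\<Oplus>p\<in>S. \<Otimes>l\<in>{..<k}. (a(i := \<lambda>m. x m \<oplus> y m)) l (p l))
      = (\<Oplus>p\<in>S. (\<Otimes>l\<in>{..<k}. (a(i := x)) l (p l)) \<oplus> (\<Otimes>l\<in>{..<k}. (a(i := y)) l (p l)))"
    proof (rule finsum_cong')
      fix q assume q: "q \<in> S"
      show "(\<Otimes>l\<in>{..<k}. (a(i := \<lambda>m. x m \<oplus> y m)) l (q l))
        = (\<Otimes>l\<in>{..<k}. (a(i := x)) l (q l)) \<oplus> (\<Otimes>l\<in>{..<k}. (a(i := y)) l (q l))"
        using row[OF q, of x] row[OF q, of y] row[OF q, of "\<lambda>m. x m \<oplus> y m"] rc[OF q] p[OF q] assms(3,4)
        by (simp add: l_distr)
    qed (use c assms(3,4) in auto)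
    also have "\<dots> = (\<Oplus>p\<in>S. \<Otimes>l\<in>{..<k}. (a(i := x)) l (p l)) \<oplus> (\<Oplus>p\<in>S. \<Otimes>l\<in>{..<k}. (a(i := y)) l (p l))"
      using c assms(3,4) by (intro finsum_addf) auto
    finally show ?thesis .
  qed
  have c: "(\<Oplus>p\<in>S. \<Otimes>l\<in>{..<k}. (a(i := z)) l (p l)) \<in> carrier R"
    if "S \<subseteq> {p. p permutes {..<k}}" "\<And>m. m < k \<Longrightarrow> z m \<in> carrier R" for z S
    using that assms(2) by (intro finsum_closed funcsetI finprod_closed) (auto dest!: subsetD simp: permutes_less)
  have ring: "(A \<oplus> B) \<ominus> (C \<oplus> D) = (A \<ominus> C) \<oplus> (B \<ominus> D)"
    if "A \<in> carrier R" "B \<in> carrier R" "C \<in> carrier R" "D \<in> carrier R" for A B C D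
    using that by (simp add: minus_eq minus_add a_ac)
  show ?thesis
    unfolding leibniz_det_def
    by (subst sum, force, subst sum, force, rule ring) (rule c; use assms in force)+
qed

lemma leibniz_det_row_smult:
  assumes "i < k" "\<And>l m. l < k \<Longrightarrow> m < k \<Longrightarrow> a l m \<in> carrier R"
    "\<And>m. m < k \<Longrightarrow> x m \<in> carrier R" "b \<in> carrier R"
  shows "leibniz_det k (a(i := \<lambda>m. b \<otimes> x m)) = b \<otimes> leibniz_det k (a(i := x))"
proof -
  have sum: "(\<Oplus>p\<in>S. \<Otimes>l\<in>{..<k}. (a(i := \<lambda>m. b \<otimes> x m)) l (p l))
     = b \<otimes> (\<Oplus>p\<in>S. \<Otimes>l\<in>{..<k}. (a(i := x)) l (p l))"
    if S: "S \<subseteq> {p. p permutes {..<k}}" for S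
  proof -
    have fS: "finite S" using S finite_permutations[of "{..<k}"] finite_subset by blast
    have p: "p permutes {..<k}" "p i < k" if "p \<in> S" for p using that S permutes_less[of p k i] assms(1) by auto
    have rc: "(\<Otimes>l\<in>{..<k} - {i}. a l (p l)) \<in> carrier R" if "p \<in> S" for p
      by (rule rest_closed) (use p[OF that] assms(2) in auto)
    have row: "(\<Otimes>l\<in>{..<k}. (a(i := z)) l (p l)) = z (p i) \<otimes> (\<Otimes>l\<in>{..<k} - {i}. a l (p l))"
      if "p \<in> S" "\<And>m. m < k \<Longrightarrow> z m \<in> carrier R" for z p
      by (rule prod_row) (use p[OF that(1)] that(2) assms(1,2) in auto)
    have c: "(\<Otimes>l\<in>{..<k}. (a(i := x)) l (p l)) \<in> carrier R" if "p \<in> S" for p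
      using row[OF that, of x] rc[OF that] assms(3) p[OF that] by simp
    have "(\<Oplus>p\<in>S. \<Otimes>l\<in>{..<k}. (a(i := \<lambda>m. b \<otimes> x m)) l (p l))
      = (\<Oplus>p\<in>S. b \<otimes> (\<Otimes>l\<in>{..<k}. (a(i := x)) l (p l)))"
    proof (rule finsum_cong')
      fix q assume q: "q \<in> S"
      show "(\<Otimes>l\<in>{..<k}. (a(i := \<lambda>m. b \<otimes> x m)) l (q l)) = b \<otimes> (\<Otimes>l\<in>{..<k}. (a(i := x)) l (q l))"
        using row[OF q, of x] row[OF q, of "\<lambda>m. b \<otimes> x m"] rc[OF q] p[OF q] assms(3,4)
        by (simp add: m_assoc)
    qed (use c assms(3,4) in auto)
    also have "\<dots> = b \<otimes> (\<Oplus>p\<in>S. \<Otimes>l\<in>{..<k}. (a(i := x)) l (p l))"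
      using c assms(4) fS by (intro finsum_rdistr[symmetric]) auto
    finally show ?thesis .
  qed
  have c: "(\<Oplus>p\<in>S. \<Otimes>l\<in>{..<k}. (a(i := x)) l (p l)) \<in> carrier R"
    if "S \<subseteq> {p. p permutes {..<k}}" for S
    using that assms(2,3) by (intro finsum_closed funcsetI finprod_closed) (auto dest!: subsetD simp: permutes_less)
  have ring: "b \<otimes> A \<ominus> b \<otimes> C = b \<otimes> (A \<ominus> C)"
    if "A \<in> carrier R" "C \<in> carrier R" for A C
    using that assms(4) by (simp add: minus_eq r_distr r_minus)
  show ?thesis
    unfolding leibniz_det_def
    by (subst sum, force, subst sum, force, rule ring) (rule c; force)+
qed

lemma leibniz_det_row_zero:
  assumes "i < k" "\<And>l m. l < k \<Longrightarrow> m < k \<Longrightarrow> a l m \<in> carrier R" "\<And>m. m < k \<Longrightarrow> a i m = \<zero>"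
  shows "leibniz_det k a = \<zero>"
proof -
  have "leibniz_det k a = leibniz_det k (a(i := \<lambda>m. \<zero> \<otimes> a i m))"
    using assms by (intro leibniz_det_cong) auto
  also have "\<dots> = \<zero> \<otimes> leibniz_det k (a(i := a i))" using assms by (intro leibniz_det_row_smult) auto
  also have "\<dots> = \<zero>" using leibniz_det_closed[of k a] assms(2) by simp
  finally show ?thesis .
qed

text \<open>Composition with the transposition of \<open>i\<close> and \<open>j\<close> exchanges
  even and odd permutations and, the two rows being equal, preserves the products. This argument
  also covers characteristic 2.\<close>

lemma leibniz_det_equal_rows:
  assumes "i < k" "j < k" "i \<noteq> j" "\<And>l m. l < k \<Longrightarrow> m < k \<Longrightarrow> a l m \<in> carrier R"
    "\<And>m. m < k \<Longrightarrow> a i m = a j m"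
  shows "leibniz_det k a = \<zero>"
proof -
  let ?t = "Transposition.transpose i j"
  let ?E = "{p. p permutes {..<k} \<and> evenperm p}" and ?O = "{p. p permutes {..<k} \<and> \<not> evenperm p}"
  let ?pr = "\<lambda>p. \<Otimes>l\<in>{..<k}. a l (p l)"
  have tp: "?t permutes {..<k}" using assms by (intro permutes_swap_id) auto
  have perm: "permutation p" if "p permutes {..<k}" for p using that permutation_permutes by blast
  have even: "evenperm (p \<circ> ?t) \<longleftrightarrow> \<not> evenperm p" if "p permutes {..<k}" for p
    using evenperm_comp[OF perm[OF that] perm[OF tp]] evenperm_swap[of i j] assms(3) by simp
  have pt: "p \<circ> ?t permutes {..<k}" if "p permutes {..<k}" for p using permutes_compose[OF tp that] .
  have invol: "p \<circ> ?t \<circ> ?t = p" for p :: "nat \<Rightarrow> nat" by (simp add: comp_assoc)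
  have im: "(\<lambda>p. p \<circ> ?t) ` ?E = ?O"
  proof
    show "?O \<subseteq> (\<lambda>p. p \<circ> ?t) ` ?E"
    proof
      fix p assume "p \<in> ?O"
      then have "p \<circ> ?t \<in> ?E" using pt even by auto
      then show "p \<in> (\<lambda>p. p \<circ> ?t) ` ?E" by (rule image_eqI[rotated]) (simp only: invol)
    qed
  qed (use pt even in auto)
  have inj: "inj_on (\<lambda>p. p \<circ> ?t) ?E"
  proof (rule inj_onI)
    fix p p' :: "nat \<Rightarrow> nat" assume "p \<circ> ?t = p' \<circ> ?t"
    then have "p \<circ> ?t \<circ> ?t = p' \<circ> ?t \<circ> ?t" by (rule arg_cong)
    from trans[OF invol[of p, symmetric] trans[OF this invol[of p']]] show "p = p'" .
  qed
  have cl: "?pr p \<in> carrier R" if "p permutes {..<k}" for p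
    using assms(4) permutes_less[OF that] by (intro finprod_closed) auto
  have pr: "?pr (p \<circ> ?t) = ?pr p" if p: "p permutes {..<k}" for p
  proof -
    \<comment> \<open>Rows \<open>i\<close> and \<open>j\<close> agree, so the row index may be
      transposed as well; after that the product is only reindexed.\<close>
    have "?pr (p \<circ> ?t) = (\<Otimes>l\<in>{..<k}. a (?t l) (p (?t l)))"
    proof (rule finprod_cong')
      fix l assume l: "l \<in> {..<k}"
      have pl: "p i < k" "p j < k" using permutes_less[OF p] assms by auto
      show "a l ((p \<circ> ?t) l) = a (?t l) (p (?t l))"
        using assms(5)[OF pl(1)] assms(5)[OF pl(2)] by (auto simp: Transposition.transpose_def)
    qed (use assms permutes_less[OF p] permutes_less[OF tp] in auto)
    also have "\<dots> = (\<Otimes>l\<in>?t ` {..<k}. a l (p l))"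
      using assms permutes_less[OF p] permutes_less[OF tp]
      by (intro finprod_reindex[symmetric]) (auto intro: inj_on_subset[OF permutes_inj[OF tp]])
    also have "?t ` {..<k} = {..<k}" using tp by (rule permutes_image)
    finally show ?thesis .
  qed
  have "(\<Oplus>p\<in>?O. ?pr p) = (\<Oplus>p\<in>?E. ?pr (p \<circ> ?t))"
    unfolding im[symmetric] by (rule finsum_reindex[OF _ inj]) (use cl pt in auto)
  also have "\<dots> = (\<Oplus>p\<in>?E. ?pr p)" by (rule finsum_cong') (use pr cl in auto)
  finally show ?thesis unfolding leibniz_det_def using cl by (simp add: minus_eq r_neg finsum_closed Pi_iff)
qed

text \<open>A permutation other than the identity meets an off-diagonal zero, and the identity is
  even.\<close>

lemma leibniz_det_ident:
  assumes "\<And>l m. l < k \<Longrightarrow> m < k \<Longrightarrow> a l m = (if l = m then \<one> else \<zero>)"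
  shows "leibniz_det k a = \<one>"
proof -
  let ?pr = "\<lambda>p. \<Otimes>l\<in>{..<k}. a l (p l)"
  have one: "?pr id = \<one>"
    using assms by (subst finprod_cong'[of _ "{..<k}" "\<lambda>_. \<one>"]) auto
  have zero: "?pr p = \<zero>" if p: "p permutes {..<k}" "p \<noteq> id" for p
  proof -
    obtain i where i: "p i \<noteq> i" using p(2) by (auto simp: fun_eq_iff)
    then have ik: "i < k" using p(1) by (auto simp: permutes_def)
    have ac: "a l m \<in> carrier R" if "l < k" "m < k" for l m using assms[OF that] by simp
    have "?pr p = (\<Otimes>l\<in>{..<k}. (a(i := a i)) l (p l))" by simp
    also have "\<dots> = a i (p i) \<otimes> (\<Otimes>l\<in>{..<k} - {i}. a l (p l))"
      using ik p ac by (intro prod_row) auto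
    finally have "?pr p = a i (p i) \<otimes> (\<Otimes>l\<in>{..<k} - {i}. a l (p l))" .
    moreover have "a i (p i) = \<zero>" using assms[OF ik permutes_less[OF p(1) ik]] i by simp
    moreover have "(\<Otimes>l\<in>{..<k} - {i}. a l (p l)) \<in> carrier R"
      by (rule rest_closed) (use p ac in auto)
    ultimately show ?thesis by simp
  qed
  have "(\<Oplus>p\<in>{p. p permutes {..<k} \<and> evenperm p}. ?pr p)
     = (\<Oplus>p\<in>{p. p permutes {..<k} \<and> evenperm p}. if id = p then \<one> else \<zero>)"
    by (rule finsum_cong') (use one zero in auto)
  also have "\<dots> = \<one>"
    by (rule finsum_singleton) (auto simp: permutes_id evenperm_id finite_permutations_filter)
  moreover have "(\<Oplus>p\<in>{p. p permutes {..<k} \<and> \<not> evenperm p}. ?pr p) = (\<Oplus>p\<in>{p. p permutes {..<k} \<and> \<not> evenperm p}. \<zero>)"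
  proof (rule finsum_cong')
    fix p assume "p \<in> {p. p permutes {..<k} \<and> \<not> evenperm p}"
    moreover from this have "p \<noteq> id" using evenperm_id by auto
    ultimately show "?pr p = \<zero>" using zero by auto
  qed auto
  moreover have "\<dots> = \<zero>" by (rule finsum_zero)
  ultimately show ?thesis unfolding leibniz_det_def by (simp add: minus_eq)
qed

end

definition ksub :: "nat \<Rightarrow> 'x set \<Rightarrow> 'x set set" where
  "ksub k A = {I. I \<subseteq> A \<and> card I = k}"

text \<open>An arbitrary enumeration: no order on the basis is needed, since permuting the arguments of an
  alternating map only changes the sign.\<close>

definition enum_tuple :: "nat \<Rightarrow> 'x set \<Rightarrow> nat \<Rightarrow> 'x" where
  "enum_tuple k I = (SOME t. t \<in> tuples k I \<and> bij_betw t {..<k} I)"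

lemma enum_tuple:
  assumes "finite I" "card I = k"
  shows "enum_tuple k I \<in> tuples k I" "bij_betw (enum_tuple k I) {..<k} I"
proof -
  obtain h where h: "bij_betw h {0..<card I} I" using ex_bij_betw_nat_finite[OF assms(1)] by blast
  then have "bij_betw (restrict h {..<k}) {..<k} I"
    using assms(2) by (subst bij_betw_cong[of _ _ h]) (auto simp: atLeast0LessThan)
  moreover from this have "restrict h {..<k} \<in> tuples k I" unfolding tuples_def by (auto simp: bij_betw_def)
  ultimately have "\<exists>t. t \<in> tuples k I \<and> bij_betw t {..<k} I" by blast
  from someI_ex[OF this] show "enum_tuple k I \<in> tuples k I" "bij_betw (enum_tuple k I) {..<k} I"
    unfolding enum_tuple_def by auto
qed

section \<open>Alternating maps on a spanning set\<close>

context finite_vectorspace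
begin

text \<open>Expanding \<open>T\<close> with the sum of the two entries in both positions leaves only
  the two mixed terms.\<close>

lemma alternating_swap:
  assumes T: "alternating k W T" and W: "module K W" and t: "t \<in> tup k" "i < k" "j < k" "i \<noteq> j"
  shows "T (t(i := t j, j := t i)) = \<ominus>\<^bsub>W\<^esub> T t"
proof -
  interpret W: module K W by fact
  note D = alternatingD[OF T]
  let ?a = "t i" and ?b = "t j"
  have ab: "?a \<in> carrier V" "?b \<in> carrier V" using t tuples_mem by auto
  have s: "?a \<oplus>\<^bsub>V\<^esub> ?b \<in> carrier V" using ab by simp
  have up: "t(i := x, j := y) \<in> tup k" if "x \<in> carrier V" "y \<in> carrier V" for x y
    using that t by (intro tuples_upd) auto
  have up1: "t(i := x) \<in> tup k" "t(j := x) \<in> tup k" if "x \<in> carrier V" for x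
    using that t by (auto intro!: tuples_upd)
  have tw: "t(i := x, j := y) = t(j := y, i := x)" for x y using t by (auto simp: fun_upd_twist)
  have "T (t(i := ?a \<oplus>\<^bsub>V\<^esub> ?b, j := ?a \<oplus>\<^bsub>V\<^esub> ?b)) = \<zero>\<^bsub>W\<^esub>"
    using D(4)[OF up[OF s s] t(2-4)] t(4) by simp
  moreover have "T (t(i := ?a \<oplus>\<^bsub>V\<^esub> ?b, j := ?a \<oplus>\<^bsub>V\<^esub> ?b))
      = T (t(i := ?a \<oplus>\<^bsub>V\<^esub> ?b, j := ?a)) \<oplus>\<^bsub>W\<^esub> T (t(i := ?a \<oplus>\<^bsub>V\<^esub> ?b, j := ?b))"
    using D(2)[OF up1(1)[OF s] t(3) ab] .
  moreover have "T (t(i := ?a \<oplus>\<^bsub>V\<^esub> ?b, j := x)) = T (t(i := ?a, j := x)) \<oplus>\<^bsub>W\<^esub> T (t(i := ?b, j := x))"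
    if "x \<in> carrier V" for x
    unfolding tw using D(2)[OF up1(2)[OF that] t(2) ab] .
  moreover have "T (t(i := x, j := x)) = \<zero>\<^bsub>W\<^esub>" if "x \<in> carrier V" for x
    using D(4)[OF up[OF that that] t(2-4)] t(4) by simp
  moreover have "t(i := ?a, j := ?b) = t" by simp
  moreover have "T (t(i := ?b, j := ?a)) \<in> carrier W" "T t \<in> carrier W"
    using D(1)[OF t(1)] D(1)[OF up[OF ab(2) ab(1)]] by auto
  ultimately have "T (t(i := ?b, j := ?a)) \<oplus>\<^bsub>W\<^esub> T t = \<zero>\<^bsub>W\<^esub>"
    using ab by (metis W.M.l_zero W.M.r_zero)
  then show ?thesis
    using W.M.minus_equality[OF _ D(1)[OF t(1)] D(1)[OF up[OF ab(2) ab(1)]]] by simp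
qed

lemma tuples_perm:
  assumes "e \<in> tuples k H" "p permutes {..<k}"
  shows "e \<circ> p \<in> tuples k H"
proof -
  have "p l < k" if "l < k" for l using permutes_in_image[OF assms(2), of l] that by simp
  moreover have "p l = l" if "\<not> l < k" for l using that assms(2) by (auto simp: permutes_def)
  ultimately show ?thesis using assms(1) unfolding tuples_def by (auto simp: PiE_iff extensional_def)
qed

text \<open>Comparing two maps makes the sign of the permutation invisible: each transposition
  negates both values.\<close>

lemma alternating_agree_perm:
  assumes T: "alternating k W T" and T': "alternating k W T'" and W: "module K W"
    and p: "p permutes {..<k}" and e: "e \<in> tup k" "T e = T' e"
  shows "T (e \<circ> p) = T' (e \<circ> p)"
proof -
  have "\<forall>e\<in>tup k. T e = T' e \<longrightarrow> T (e \<circ> p) = T' (e \<circ> p)"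
  proof (rule permutes_induct[OF p, where P = "\<lambda>p. \<forall>e\<in>tup k. T e = T' e \<longrightarrow> T (e \<circ> p) = T' (e \<circ> p)"])
    fix a b p
    assume 3: "a \<in> {..<k}" "b \<in> {..<k}" "a \<noteq> b" "p permutes {..<k}"
      "\<forall>e\<in>tup k. T e = T' e \<longrightarrow> T (e \<circ> p) = T' (e \<circ> p)"
    show "\<forall>e\<in>tup k. T e = T' e \<longrightarrow> T (e \<circ> (Transposition.transpose a b \<circ> p)) = T' (e \<circ> (Transposition.transpose a b \<circ> p))"
    proof (intro ballI impI)
      fix e assume e: "e \<in> tup k" "T e = T' e"
      let ?e = "e \<circ> Transposition.transpose a b"
      have eq: "?e = e(a := e b, b := e a)" by (auto simp: fun_eq_iff Transposition.transpose_def)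
      have "?e \<in> tup k" using tuples_perm[OF e(1) permutes_swap_id] 3 by auto
      moreover have "T ?e = T' ?e" unfolding eq
        using alternating_swap[OF T W e(1), of a b] alternating_swap[OF T' W e(1), of a b] 3 e by simp
      ultimately show "T (e \<circ> (Transposition.transpose a b \<circ> p)) = T' (e \<circ> (Transposition.transpose a b \<circ> p))"
        using 3(5) by (metis comp_assoc)
    qed
  qed auto
  then show ?thesis using e by auto
qed

text \<open>A tuple with entries in \<open>A\<close> either has a repetition, where both maps
  vanish, or is a rearrangement of the chosen enumeration of a \<open>k\<close>-subset.
  Multilinearity carries the agreement from \<open>A\<close> to its span.\<close>

lemma alternating_agree_span:
  assumes T: "alternating k W T" and T': "alternating k W T'" and W: "module K W" and A: "A \<subseteq> carrier V"
    and agree: "\<And>I. I \<in> ksub k A \<Longrightarrow> T (enum_tuple k I) = T' (enum_tuple k I)"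
    and t: "t \<in> tuples k (span A)"
  shows "T t = T' t"
proof -
  interpret W: module K W by fact
  note D = alternatingD[OF T] and D' = alternatingD[OF T']
  have fA: "finite A" using A finite_V finite_subset by blast
  have spA: "span A \<subseteq> carrier V" using A span_is_subset2 by auto
  have base: "T t = T' t" if t: "t \<in> tuples k A" for t
  proof (cases "inj_on t {..<k}")
    case True
    define I where "I = t ` {..<k}"
    have I: "I \<subseteq> A" "card I = k" "finite I" using t True by (auto simp: I_def tuples_def card_image)
    let ?e = "enum_tuple k I"
    note e = enum_tuple[OF I(3,2)]
    \<comment> \<open>The rearrangement that turns the enumeration of \<open>I\<close> into
      \<open>t\<close>; outside \<open>{..<k}\<close> it is the identity, as \<open>permutes\<close>
      demands.\<close>
    define p where "p l = (if l < k then inv_into {..<k} ?e (t l) else l)" for l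
    have "bij_betw t {..<k} I" using True by (simp add: I_def bij_betw_def)
    then have "bij_betw (inv_into {..<k} ?e \<circ> t) {..<k} {..<k}"
      using bij_betw_inv_into[OF e(2)] by (rule bij_betw_trans)
    then have "bij_betw p {..<k} {..<k}" by (subst bij_betw_cong) (auto simp: p_def)
    then have p: "p permutes {..<k}" by (rule bij_imp_permutes) (auto simp: p_def)
    have "?e \<circ> p = t"
    proof
      fix l show "(?e \<circ> p) l = t l"
      proof (cases "l < k")
        case True
        then have "t l \<in> ?e ` {..<k}" using e(2) by (auto simp: I_def bij_betw_def)
        then show ?thesis using True by (simp add: p_def f_inv_into_f)
      next
        case False
        then show ?thesis using t e(1) by (auto simp: p_def tuples_def PiE_iff extensional_def)
      qed
    qed
    moreover have "?e \<in> tup k" using e(1) tuples_mono[of I "carrier V" k] I A by auto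
    moreover have "T ?e = T' ?e" using agree I by (auto simp: ksub_def)
    ultimately show ?thesis using alternating_agree_perm[OF T T' W p, of ?e] by simp
  next
    case False
    then obtain i j where "i < k" "j < k" "i \<noteq> j" "t i = t j" by (auto simp: inj_on_def)
    moreover have "t \<in> tup k" using t tuples_mono[OF A] by auto
    ultimately show ?thesis using D(4)[of t i j] D'(4)[of t i j] by simp
  qed
  \<comment> \<open>The entries are released from \<open>A\<close> to \<open>span A\<close> position
    by position, the first \<open>n\<close> being already free.\<close>
  have "\<forall>t\<in>tup k. (\<forall>l<n. t l \<in> span A) \<longrightarrow> (\<forall>l. n \<le> l \<and> l < k \<longrightarrow> t l \<in> A) \<longrightarrow> T t = T' t" if "n \<le> k" for n
    using that
  proof (induction n)
    case 0
    show ?case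
    proof (intro ballI impI)
      fix t assume "t \<in> tup k" "\<forall>l. 0 \<le> l \<and> l < k \<longrightarrow> t l \<in> A"
      then have "t \<in> tuples k A" unfolding tuples_def by (auto simp: PiE_iff)
      then show "T t = T' t" by (rule base)
    qed
  next
    case (Suc n)
    show ?case
    proof (intro ballI impI)
      fix t assume t: "t \<in> tup k" "\<forall>l<Suc n. t l \<in> span A" "\<forall>l. Suc n \<le> l \<and> l < k \<longrightarrow> t l \<in> A"
      have nk: "n < k" using Suc by simp
      \<comment> \<open>The vectors that may stand at position \<open>n\<close> without breaking the
        agreement form a subspace, which contains \<open>A\<close> by the induction
        hypothesis.\<close>
      define E where "E = {v \<in> carrier V. T (t(n := v)) = T' (t(n := v))}"
      have "subspace K E V"
      proof (rule subspaceI)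
        fix u v assume "u \<in> E" "v \<in> E"
        then show "u \<oplus>\<^bsub>V\<^esub> v \<in> E" unfolding E_def using D(2)[OF t(1) nk] D'(2)[OF t(1) nk] by auto
      next
        fix a v assume "a \<in> carrier K" "v \<in> E"
        then show "a \<odot>\<^bsub>V\<^esub> v \<in> E" unfolding E_def using D(3)[OF t(1) nk] D'(3)[OF t(1) nk] by auto
      next
        have z: "\<zero>\<^bsub>V\<^esub> = \<zero>\<^bsub>K\<^esub> \<odot>\<^bsub>V\<^esub> \<zero>\<^bsub>V\<^esub>" by simp
        have "t(n := \<zero>\<^bsub>V\<^esub>) \<in> tup k" using t nk by (intro tuples_upd) auto
        then have "T (t(n := \<zero>\<^bsub>V\<^esub>)) = \<zero>\<^bsub>W\<^esub>" "T' (t(n := \<zero>\<^bsub>V\<^esub>)) = \<zero>\<^bsub>W\<^esub>"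
          using D(3)[OF t(1) nk, of "\<zero>\<^bsub>K\<^esub>" "\<zero>\<^bsub>V\<^esub>"] D'(3)[OF t(1) nk, of "\<zero>\<^bsub>K\<^esub>" "\<zero>\<^bsub>V\<^esub>"] D(1) D'(1) by auto
        then show "\<zero>\<^bsub>V\<^esub> \<in> E" unfolding E_def by simp
      qed (auto simp: E_def)
      moreover have "A \<subseteq> E"
      proof
        fix v assume v: "v \<in> A"
        then have "t(n := v) \<in> tup k" using t nk A by (intro tuples_upd) auto
        moreover have "\<forall>l<n. (t(n := v)) l \<in> span A" "\<forall>l. n \<le> l \<and> l < k \<longrightarrow> (t(n := v)) l \<in> A"
          using t v by auto
        ultimately show "v \<in> E" using Suc v A unfolding E_def by auto
      qed
      ultimately have "span A \<subseteq> E" by (rule span_subset)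
      then have "t n \<in> E" using t by auto
      then show "T t = T' t" unfolding E_def by simp
    qed
  qed
  from this[of k] have "t \<in> tup k \<Longrightarrow> T t = T' t" using tuples_mem[OF t] by auto
  then show ?thesis using t tuples_mono[OF spA, of k] by blast
qed

lemma alternating_zero: "module K W \<Longrightarrow> alternating k W (\<lambda>t. \<zero>\<^bsub>W\<^esub>)"
proof -
  assume "module K W"
  then interpret W: module K W .
  show ?thesis unfolding alternating_def by auto
qed


section \<open>Coordinates, and alternating maps with prescribed values on a basis\<close>

definition coordinate :: "'c set \<Rightarrow> 'c \<Rightarrow> 'c \<Rightarrow> 'a" where
  "coordinate B v = (THE a. a \<in> B \<rightarrow>\<^sub>E carrier K \<and> lincomb a B = v)"

context
  fixes B assumes B: "basis B"
begin

lemma basis_subset: "B \<subseteq> carrier V" and finite_basis: "finite B"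
  using B finite_V finite_subset unfolding basis_def by auto

lemma coordinate_unique: "v \<in> carrier V \<Longrightarrow> \<exists>!a. a \<in> B \<rightarrow>\<^sub>E carrier K \<and> lincomb a B = v"
  using basis_criterion[OF finite_basis basis_subset] B by blast

lemma coordinate: assumes "v \<in> carrier V" shows "coordinate B v \<in> B \<rightarrow>\<^sub>E carrier K" "lincomb (coordinate B v) B = v"
  using theI'[OF coordinate_unique[OF assms]] unfolding coordinate_def by auto

lemma coordinate_closed: "v \<in> carrier V \<Longrightarrow> b \<in> B \<Longrightarrow> coordinate B v b \<in> carrier K"
  using coordinate(1) by auto

lemma coordinate_eqI:
  assumes "a \<in> B \<rightarrow> carrier K" "lincomb a B = v" "b \<in> B"
  shows "coordinate B v b = a b"
proof -
  have v: "v \<in> carrier V" using assms basis_subset by auto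
  have "lincomb (restrict a B) B = v"
    using assms basis_subset by (intro trans[OF _ assms(2)] lincomb_cong) auto
  moreover have "restrict a B \<in> B \<rightarrow>\<^sub>E carrier K" using assms by auto
  ultimately have "coordinate B v = restrict a B" using coordinate_unique[OF v] coordinate[OF v] by blast
  then show ?thesis using assms by simp
qed

lemma coordinate_add:
  assumes "u \<in> carrier V" "v \<in> carrier V" "b \<in> B"
  shows "coordinate B (u \<oplus>\<^bsub>V\<^esub> v) b = coordinate B u b \<oplus>\<^bsub>K\<^esub> coordinate B v b"
proof (rule coordinate_eqI[OF _ _ assms(3)])
  show "lincomb (\<lambda>v'. coordinate B u v' \<oplus>\<^bsub>K\<^esub> coordinate B v v') B = u \<oplus>\<^bsub>V\<^esub> v"
    using lincomb_sum[OF finite_basis basis_subset, of "coordinate B u" "coordinate B v"] coordinate[OF assms(1)] coordinate[OF assms(2)]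
    by (auto simp: PiE_iff)
qed (use coordinate_closed assms in auto)

lemma coordinate_smult:
  assumes "a \<in> carrier K" "v \<in> carrier V" "b \<in> B"
  shows "coordinate B (a \<odot>\<^bsub>V\<^esub> v) b = a \<otimes>\<^bsub>K\<^esub> coordinate B v b"
proof (rule coordinate_eqI[OF _ _ assms(3)])
  show "lincomb (\<lambda>v'. a \<otimes>\<^bsub>K\<^esub> coordinate B v v') B = a \<odot>\<^bsub>V\<^esub> v"
    using lincomb_smult[OF basis_subset, of "coordinate B v" a] coordinate[OF assms(2)] assms(1)
    by (auto simp: PiE_iff)
qed (use coordinate_closed assms in auto)

lemma coordinate_basis:
  assumes "b \<in> B" "x \<in> B"
  shows "coordinate B b x = (if x = b then \<one>\<^bsub>K\<^esub> else \<zero>\<^bsub>K\<^esub>)"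
proof (rule coordinate_eqI[OF _ _ assms(2)])
  have "lincomb (\<lambda>x. if x = b then \<one>\<^bsub>K\<^esub> else \<zero>\<^bsub>K\<^esub>) B = (\<Oplus>\<^bsub>V\<^esub>x\<in>B. if b = x then x else \<zero>\<^bsub>V\<^esub>)"
    unfolding lincomb_def using basis_subset by (intro M.finsum_cong') auto
  also have "\<dots> = b" using assms basis_subset finite_basis by (intro M.finsum_singleton) auto
  finally show "lincomb (\<lambda>x. if x = b then \<one>\<^bsub>K\<^esub> else \<zero>\<^bsub>K\<^esub>) B = b" .
qed auto

lemma ksub_basis: "I \<in> ksub k B \<Longrightarrow> finite I \<and> I \<subseteq> B \<and> card I = k"
  using finite_basis finite_subset unfolding ksub_def by auto

lemma enum_tuple_ksub:
  assumes "I \<in> ksub k B"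
  shows "enum_tuple k I \<in> tup k" "bij_betw (enum_tuple k I) {..<k} I" "\<And>l. l < k \<Longrightarrow> enum_tuple k I l \<in> I"
    "\<And>l. l < k \<Longrightarrow> enum_tuple k I l \<in> B"
proof -
  have I: "finite I" "card I = k" "I \<subseteq> B" using ksub_basis[OF assms] by auto
  note e = enum_tuple[OF I(1,2)]
  show "bij_betw (enum_tuple k I) {..<k} I" by (rule e(2))
  show "enum_tuple k I \<in> tup k" using e(1) tuples_mono[of I "carrier V" k] I basis_subset by auto
  show "enum_tuple k I l \<in> I" "enum_tuple k I l \<in> B" if "l < k" for l using tuples_mem[OF e(1) that] I by auto
qed

text \<open>\<open>w I\<close> is the minor of the coordinate matrix in the columns
  \<open>I\<close>. The minors are alternating and dual to the enumerated \<open>k\<close>-subsets,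
  so that their combination with coefficients \<open>f I\<close> has the required values.\<close>

lemma alternating_exists:
  assumes W: "module K W" and f: "f \<in> ksub k B \<rightarrow> carrier W"
  shows "\<exists>T. alternating k W T \<and> (\<forall>I\<in>ksub k B. T (enum_tuple k I) = f I)"
proof -
  interpret W: module K W by fact
  define Mt where "Mt I t = (\<lambda>l m. coordinate B (t l) (enum_tuple k I m))" for I and t :: "nat \<Rightarrow> 'c"
  have Mt_upd: "Mt I (t(i := u)) = (Mt I t)(i := \<lambda>m. coordinate B u (enum_tuple k I m))" for I t i u
    by (auto simp: Mt_def fun_eq_iff)
  have Mt_closed: "Mt I t l m \<in> carrier K" if "I \<in> ksub k B" "t \<in> tup k" "l < k" "m < k" for I t l m
    unfolding Mt_def using that enum_tuple_ksub(4)[OF that(1)] tuples_mem[OF that(2)] by (intro coordinate_closed) auto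
  have row_closed: "coordinate B u (enum_tuple k I m) \<in> carrier K" if "I \<in> ksub k B" "u \<in> carrier V" "m < k" for I u m
    using that enum_tuple_ksub(4)[OF that(1)] by (intro coordinate_closed) auto
  define w where "w I t = leibniz_det k (Mt I t)" for I t
  have w_closed: "w I t \<in> carrier K" if "I \<in> ksub k B" "t \<in> tup k" for I t
    unfolding w_def using Mt_closed[OF that] by (rule leibniz_det_closed)
  have w_add: "w I (t(i := u \<oplus>\<^bsub>V\<^esub> v)) = w I (t(i := u)) \<oplus>\<^bsub>K\<^esub> w I (t(i := v))"
    if "I \<in> ksub k B" "t \<in> tup k" "i < k" "u \<in> carrier V" "v \<in> carrier V" for I t i u v
  proof -
    have "w I (t(i := u \<oplus>\<^bsub>V\<^esub> v)) = leibniz_det k ((Mt I t)(i := \<lambda>m. coordinate B u (enum_tuple k I m) \<oplus>\<^bsub>K\<^esub> coordinate B v (enum_tuple k I m)))"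
      unfolding w_def Mt_upd
      by (rule leibniz_det_cong) (use that in \<open>auto simp: coordinate_add[OF that(4,5)] enum_tuple_ksub(4) Mt_closed row_closed\<close>)
    also have "\<dots> = w I (t(i := u)) \<oplus>\<^bsub>K\<^esub> w I (t(i := v))"
      unfolding w_def Mt_upd by (rule leibniz_det_row_add) (use that in \<open>auto simp: Mt_closed row_closed\<close>)
    finally show ?thesis .
  qed
  have w_smult: "w I (t(i := a \<odot>\<^bsub>V\<^esub> u)) = a \<otimes>\<^bsub>K\<^esub> w I (t(i := u))"
    if "I \<in> ksub k B" "t \<in> tup k" "i < k" "a \<in> carrier K" "u \<in> carrier V" for I t i a u
  proof -
    have "w I (t(i := a \<odot>\<^bsub>V\<^esub> u)) = leibniz_det k ((Mt I t)(i := \<lambda>m. a \<otimes>\<^bsub>K\<^esub> coordinate B u (enum_tuple k I m)))"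
      unfolding w_def Mt_upd
      by (rule leibniz_det_cong) (use that in \<open>auto simp: coordinate_smult[OF that(4,5)] enum_tuple_ksub(4) Mt_closed row_closed\<close>)
    also have "\<dots> = a \<otimes>\<^bsub>K\<^esub> w I (t(i := u))"
      unfolding w_def Mt_upd by (rule leibniz_det_row_smult) (use that in \<open>auto simp: Mt_closed row_closed\<close>)
    finally show ?thesis .
  qed
  have w_alt: "w I t = \<zero>\<^bsub>K\<^esub>" if "I \<in> ksub k B" "t \<in> tup k" "i < j" "j < k" "t i = t j" for I t i j
    unfolding w_def by (rule leibniz_det_equal_rows[of i k j]) (use that Mt_closed in \<open>auto simp: Mt_def\<close>)
  have w_diag: "w I (enum_tuple k I) = \<one>\<^bsub>K\<^esub>" if I: "I \<in> ksub k B" for I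
    unfolding w_def
  proof (rule leibniz_det_ident)
    fix l m assume lm: "l < k" "m < k"
    have "(enum_tuple k I m = enum_tuple k I l) = (m = l)"
      using enum_tuple_ksub(2)[OF I] lm by (auto simp: bij_betw_def inj_on_def)
    then show "Mt I (enum_tuple k I) l m = (if l = m then \<one>\<^bsub>K\<^esub> else \<zero>\<^bsub>K\<^esub>)"
      unfolding Mt_def using coordinate_basis enum_tuple_ksub(4)[OF I] lm by auto
  qed
  have w_off: "w I (enum_tuple k J) = \<zero>\<^bsub>K\<^esub>" if I: "I \<in> ksub k B" and J: "J \<in> ksub k B" and "I \<noteq> J" for I J
  proof -
    \<comment> \<open>Two distinct sets of equal size: some \<open>b\<close> in \<open>J - I\<close>
      exists, and its row in the matrix for \<open>I\<close> is zero.\<close>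
    have "\<not> J \<subseteq> I" using that ksub_basis[OF I] ksub_basis[OF J] card_subset_eq[of I J] by auto
    then obtain b where b: "b \<in> J" "b \<notin> I" by auto
    have "b \<in> enum_tuple k J ` {..<k}" using b(1) enum_tuple_ksub(2)[OF J] by (simp add: bij_betw_def)
    then obtain l where l: "l < k" "enum_tuple k J l = b" by blast
    show ?thesis unfolding w_def
    proof (rule leibniz_det_row_zero[OF l(1)])
      fix m assume m: "m < k"
      have "enum_tuple k I m \<noteq> b" using enum_tuple_ksub(3)[OF I m] b by auto
      then show "Mt I (enum_tuple k J) l m = \<zero>\<^bsub>K\<^esub>"
        unfolding Mt_def l(2) using coordinate_basis[of b "enum_tuple k I m"] enum_tuple_ksub(4)[OF I m] b ksub_basis[OF J] by auto
    qed (use Mt_closed I enum_tuple_ksub(1)[OF J] in auto)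
  qed
  define T where "T t = (\<Oplus>\<^bsub>W\<^esub>I\<in>ksub k B. w I t \<odot>\<^bsub>W\<^esub> f I)" for t
  have fin: "finite (ksub k B)" unfolding ksub_def
    by (rule finite_subset[of _ "Pow B"]) (auto simp: finite_basis)
  have fc: "f I \<in> carrier W" if "I \<in> ksub k B" for I using f that by auto
  have "alternating k W T"
    unfolding alternating_def
  proof (intro conjI ballI allI impI funcsetI)
    fix t assume "t \<in> tup k"
    then show "T t \<in> carrier W" unfolding T_def using w_closed fc by (intro W.M.finsum_closed) auto
  next
    fix t i u v assume *: "t \<in> tup k" "i < k" "u \<in> carrier V" "v \<in> carrier V"
    have up: "t(i := u) \<in> tup k" "t(i := v) \<in> tup k" using * by (auto intro!: tuples_upd)
    have "T (t(i := u \<oplus>\<^bsub>V\<^esub> v)) = (\<Oplus>\<^bsub>W\<^esub>I\<in>ksub k B. w I (t(i := u)) \<odot>\<^bsub>W\<^esub> f I \<oplus>\<^bsub>W\<^esub> w I (t(i := v)) \<odot>\<^bsub>W\<^esub> f I)"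
      unfolding T_def using w_add[OF _ *] fc w_closed[OF _ up(1)] w_closed[OF _ up(2)]
      by (intro W.M.finsum_cong') (auto simp: W.smult_l_distr simp del: fun_upd_apply)
    also have "\<dots> = T (t(i := u)) \<oplus>\<^bsub>W\<^esub> T (t(i := v))"
      unfolding T_def using fc w_closed[OF _ up(1)] w_closed[OF _ up(2)]
      by (intro W.M.finsum_addf) (auto simp del: fun_upd_apply)
    finally show "T (t(i := u \<oplus>\<^bsub>V\<^esub> v)) = T (t(i := u)) \<oplus>\<^bsub>W\<^esub> T (t(i := v))" .
  next
    fix t i a u assume *: "t \<in> tup k" "i < k" "a \<in> carrier K" "u \<in> carrier V"
    have up: "t(i := u) \<in> tup k" using * by (auto intro!: tuples_upd)
    have "T (t(i := a \<odot>\<^bsub>V\<^esub> u)) = (\<Oplus>\<^bsub>W\<^esub>I\<in>ksub k B. a \<odot>\<^bsub>W\<^esub> (w I (t(i := u)) \<odot>\<^bsub>W\<^esub> f I))"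
      unfolding T_def using w_smult[OF _ *] fc w_closed[OF _ up] *(3)
      by (intro W.M.finsum_cong') (auto simp: W.smult_assoc1 simp del: fun_upd_apply)
    also have "\<dots> = a \<odot>\<^bsub>W\<^esub> T (t(i := u))"
      unfolding T_def using fc w_closed[OF _ up] *(3)
      by (intro W.finsum_smult[symmetric]) (auto simp del: fun_upd_apply)
    finally show "T (t(i := a \<odot>\<^bsub>V\<^esub> u)) = a \<odot>\<^bsub>W\<^esub> T (t(i := u))" .
  next
    fix t i j assume *: "t \<in> tup k" "i < j \<and> j < k \<and> t i = t j"
    have "T t = (\<Oplus>\<^bsub>W\<^esub>I\<in>ksub k B. \<zero>\<^bsub>W\<^esub>)"
      unfolding T_def using w_alt[OF _ *(1)] * fc by (intro W.M.finsum_cong') auto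
    then show "T t = \<zero>\<^bsub>W\<^esub>" by simp
  qed
  moreover have "T (enum_tuple k I) = f I" if I: "I \<in> ksub k B" for I
  proof -
    have "T (enum_tuple k I) = (\<Oplus>\<^bsub>W\<^esub>J\<in>ksub k B. if I = J then f J else \<zero>\<^bsub>W\<^esub>)"
      unfolding T_def using w_diag w_off[OF _ I] fc by (intro W.M.finsum_cong') auto
    also have "\<dots> = f I" using I fin fc by (intro W.M.finsum_singleton) auto
    finally show ?thesis .
  qed
  ultimately show ?thesis by blast
qed

end

end

section \<open>Counting forms with prescribed null spaces\<close>

text \<open>As \<open>Q\<close> ignores the coordinates in \<open>D\<close>, these may be
  overwritten, by \<open>z\<close> or by arbitrary values. In counting form this says that
  \<open>Q\<close> and the coordinates in \<open>D\<close> are independent.\<close>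

lemma card_free_coordinates:
  assumes "finite S" "finite C" "D \<subseteq> S" "z \<in> C"
    and Q: "\<And>f g. f \<in> S \<rightarrow>\<^sub>E C \<Longrightarrow> g \<in> S \<rightarrow>\<^sub>E C \<Longrightarrow> (\<And>x. x \<in> S - D \<Longrightarrow> f x = g x) \<Longrightarrow> Q f = Q g"
  shows "card {f \<in> S \<rightarrow>\<^sub>E C. Q f} = card {f \<in> S \<rightarrow>\<^sub>E C. Q f \<and> (\<forall>x\<in>D. f x = z)} * card C ^ card D"
proof -
  let ?X = "{f \<in> S \<rightarrow>\<^sub>E C. Q f \<and> (\<forall>x\<in>D. f x = z)}" and ?Y = "{f \<in> S \<rightarrow>\<^sub>E C. Q f}"
  let ?f = "\<lambda>(f, g). \<lambda>x\<in>S. if x \<in> D then g x else f x"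
  let ?g = "\<lambda>h. (\<lambda>x\<in>S. if x \<in> D then z else h x, restrict h D)"
  have cl: "(\<lambda>x\<in>S. if x \<in> D then g x else f x) \<in> S \<rightarrow>\<^sub>E C" if "f \<in> S \<rightarrow>\<^sub>E C" "g \<in> D \<rightarrow> C" for f g
    using that by (auto simp: PiE_iff)
  have "bij_betw ?f (?X \<times> (D \<rightarrow>\<^sub>E C)) ?Y"
  proof (rule bij_betw_byWitness[where f' = ?g])
    show "\<forall>a\<in>?X \<times> (D \<rightarrow>\<^sub>E C). ?g (?f a) = a"
    proof
      fix a assume "a \<in> ?X \<times> (D \<rightarrow>\<^sub>E C)"
      then obtain f g where a: "a = (f, g)" "f \<in> S \<rightarrow>\<^sub>E C" "\<forall>x\<in>D. f x = z" "g \<in> D \<rightarrow>\<^sub>E C" by auto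
      have "(\<lambda>x\<in>S. if x \<in> D then z else f x) = f"
      proof
        fix x show "(\<lambda>x\<in>S. if x \<in> D then z else f x) x = f x" using a PiE_arb[OF a(2), of x] by auto
      qed
      moreover have "restrict (\<lambda>x\<in>S. if x \<in> D then g x else f x) D = g"
      proof
        fix x show "restrict (\<lambda>x\<in>S. if x \<in> D then g x else f x) D x = g x"
          using PiE_arb[OF a(4), of x] assms(3) by (cases "x \<in> D") auto
      qed
      moreover have "(\<lambda>x\<in>S. if x \<in> D then z else (\<lambda>x\<in>S. if x \<in> D then g x else f x) x) = (\<lambda>x\<in>S. if x \<in> D then z else f x)"
        by auto
      ultimately show "?g (?f a) = a" by (simp only: a prod.case)
    qed
    show "\<forall>h\<in>?Y. ?f (?g h) = h"
    proof
      fix h assume h: "h \<in> ?Y"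
      show "?f (?g h) = h"
      proof
        fix x show "?f (?g h) x = h x" using h PiE_arb[of h S "\<lambda>_. C" x] by auto
      qed
    qed
    show "?f ` (?X \<times> (D \<rightarrow>\<^sub>E C)) \<subseteq> ?Y"
    proof (clarify)
      fix f g assume f: "f \<in> S \<rightarrow>\<^sub>E C" "Q f" and g: "g \<in> D \<rightarrow>\<^sub>E C"
      have c: "(\<lambda>x\<in>S. if x \<in> D then g x else f x) \<in> S \<rightarrow>\<^sub>E C" using f g by (intro cl) auto
      then have "Q (\<lambda>x\<in>S. if x \<in> D then g x else f x) = Q f" by (intro Q f) auto
      then show "(\<lambda>x\<in>S. if x \<in> D then g x else f x) \<in> S \<rightarrow>\<^sub>E C \<and> Q (\<lambda>x\<in>S. if x \<in> D then g x else f x)"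
        using c f by simp
    qed
    show "?g ` ?Y \<subseteq> ?X \<times> (D \<rightarrow>\<^sub>E C)"
    proof (rule image_subsetI)
      fix h assume "h \<in> ?Y"
      then have h: "h \<in> S \<rightarrow>\<^sub>E C" "Q h" by auto
      have c: "(\<lambda>x\<in>S. if x \<in> D then z else h x) \<in> S \<rightarrow>\<^sub>E C" using h assms(4) by (intro cl) auto
      then have "Q (\<lambda>x\<in>S. if x \<in> D then z else h x) = Q h" by (intro Q h) auto
      then show "?g h \<in> ?X \<times> (D \<rightarrow>\<^sub>E C)" using c h assms(3) by (auto simp: PiE_iff)
    qed
  qed
  then have "card ?Y = card (?X \<times> (D \<rightarrow>\<^sub>E C))" by (rule bij_betw_same_card[symmetric])
  moreover have "finite D" using assms finite_subset by auto
  ultimately show ?thesis by (simp add: card_cartesian_product card_PiE)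
qed

context finite_vectorspace
begin

text \<open>The condition inside \<open>null_spaces\<close>, for an arbitrary target module.\<close>

definition null_on :: "nat \<Rightarrow> ('a, 'w, 'f) module_scheme \<Rightarrow> (((nat \<Rightarrow> 'c) \<Rightarrow> 'a) set \<Rightarrow> 'w) \<Rightarrow> 'c set \<Rightarrow> bool" where
  "null_on k W \<theta> H \<longleftrightarrow> (\<forall>\<omega>\<in>exterior_subspace K k V H. \<theta> \<omega> = \<zero>\<^bsub>W\<^esub>)"

definition coef :: "nat \<Rightarrow> 'c set \<Rightarrow> (((nat \<Rightarrow> 'c) \<Rightarrow> 'a) set \<Rightarrow> 'w) \<Rightarrow> 'c set \<Rightarrow> 'w" where
  "coef k B \<theta> = (\<lambda>I\<in>ksub k B. \<theta> (wedge K k V (enum_tuple k I)))"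

lemma lin_maps_hom: "\<theta> \<in> lin_maps K P W \<Longrightarrow> \<theta> \<in> module_hom K P W"
  unfolding lin_maps_def by auto

lemma lin_maps_alternating:
  "\<theta> \<in> lin_maps K (exterior_power K k V) W \<Longrightarrow> module K W \<Longrightarrow> alternating k W (\<lambda>t. \<theta> (wedge K k V t))"
  by (rule alternating_hom_comp[OF wedge_alternating lin_maps_hom exterior_power_module])

text \<open>The kernel of \<open>\<theta>\<close> is a submodule, so that the generating wedges
  suffice.\<close>

lemma null_on_iff:
  assumes \<theta>: "\<theta> \<in> lin_maps K (exterior_power K k V) W" and W: "module K W" and H: "H \<subseteq> carrier V"
  shows "null_on k W \<theta> H \<longleftrightarrow> (\<forall>t\<in>tuples k H. \<theta> (wedge K k V t) = \<zero>\<^bsub>W\<^esub>)"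
proof -
  let ?P = "exterior_power K k V"
  interpret P: module K ?P by (rule exterior_power_module)
  interpret W: module K W by fact
  interpret h: mod_hom K ?P W \<theta> using lin_maps_hom[OF \<theta>] by unfold_locales
  have sub: "wedge K k V ` tuples k H \<subseteq> carrier ?P"
    using alternatingD(1)[OF wedge_alternating] tuples_mono[OF H] by auto
  show ?thesis
  proof
    assume "null_on k W \<theta> H"
    then show "\<forall>t\<in>tuples k H. \<theta> (wedge K k V t) = \<zero>\<^bsub>W\<^esub>"
      unfolding null_on_def exterior_subspace_def using P.in_own_span[OF sub] by auto
  next
    assume "\<forall>t\<in>tuples k H. \<theta> (wedge K k V t) = \<zero>\<^bsub>W\<^esub>"
    then have "wedge K k V ` tuples k H \<subseteq> h.ker" using sub by (auto simp: h.ker_def)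
    then have "P.span (wedge K k V ` tuples k H) \<subseteq> h.ker"
      by (rule P.span_is_subset[OF _ h.ker_is_submodule])
    then show "null_on k W \<theta> H" unfolding null_on_def exterior_subspace_def by (auto simp: h.ker_def)
  qed
qed

lemma null_on_mono:
  assumes "\<theta> \<in> lin_maps K (exterior_power K k V) W" "module K W" "U \<subseteq> carrier V" "S \<subseteq> U" "null_on k W \<theta> U"
  shows "null_on k W \<theta> S"
  using assms null_on_iff[OF assms(1,2), of U] null_on_iff[OF assms(1,2), of S] tuples_mono[OF assms(4), of k] by auto

text \<open>The counting form of independent uniform coefficients. Injectivity is agreement on the
  span of \<open>B\<close>; surjectivity is the existence of an alternating map with prescribed
  values, followed by the universal property.\<close>

lemma coef_bij:
  assumes B: "basis B" and W: "module K W"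
  shows "bij_betw (coef k B) (lin_maps K (exterior_power K k V) W) (ksub k B \<rightarrow>\<^sub>E carrier W)"
proof -
  let ?L = "lin_maps K (exterior_power K k V) W"
  have sp: "span B = carrier V" using B unfolding basis_def by auto
  show ?thesis unfolding bij_betw_def
  proof
    show "inj_on (coef k B) ?L"
    proof (rule inj_onI)
      fix \<theta> \<theta>' assume *: "\<theta> \<in> ?L" "\<theta>' \<in> ?L" "coef k B \<theta> = coef k B \<theta>'"
      have "\<theta> (wedge K k V (enum_tuple k I)) = \<theta>' (wedge K k V (enum_tuple k I))" if "I \<in> ksub k B" for I
        using fun_cong[OF *(3), of I] that by (simp add: coef_def)
      then have "\<theta> (wedge K k V t) = \<theta>' (wedge K k V t)" if "t \<in> tup k" for t
        using alternating_agree_span[OF lin_maps_alternating[OF *(1) W] lin_maps_alternating[OF *(2) W] W basis_subset[OF B]] that sp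
        by simp
      then have eq: "\<theta> x = \<theta>' x" if "x \<in> carrier (exterior_power K k V)" for x
        using exterior_hom_eqI[OF lin_maps_hom[OF *(1)] lin_maps_hom[OF *(2)] W _ that] by blast
      have "\<theta> \<in> extensional (carrier (exterior_power K k V))" "\<theta>' \<in> extensional (carrier (exterior_power K k V))"
        using *(1,2) unfolding lin_maps_def by auto
      then show "\<theta> = \<theta>'" using eq by (rule extensionalityI)
    qed
    show "coef k B ` ?L = ksub k B \<rightarrow>\<^sub>E carrier W"
    proof
      show "coef k B ` ?L \<subseteq> ksub k B \<rightarrow>\<^sub>E carrier W"
        using alternatingD(1)[OF lin_maps_alternating[OF _ W]] enum_tuple_ksub(1)[OF B] by (auto simp: coef_def)
      show "ksub k B \<rightarrow>\<^sub>E carrier W \<subseteq> coef k B ` ?L"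
      proof
        fix f assume f: "f \<in> ksub k B \<rightarrow>\<^sub>E carrier W"
        obtain T where T: "alternating k W T" "\<forall>I\<in>ksub k B. T (enum_tuple k I) = f I"
          using alternating_exists[OF B W, of f k] f by (auto simp: PiE_iff)
        obtain \<theta> where t: "\<theta> \<in> ?L" "\<forall>t\<in>tup k. \<theta> (wedge K k V t) = T t" using alternating_lift[OF T(1) W] by blast
        have "coef k B \<theta> = f"
        proof
          fix I show "coef k B \<theta> I = f I"
            using t T enum_tuple_ksub(1)[OF B, of I k] PiE_arb[OF f, of I] by (auto simp: coef_def)
        qed
        then show "f \<in> coef k B ` ?L" using t by blast
      qed
    qed
  qed
qed

text \<open>Vanishing on the basis wedges is agreement with the zero map, and agreement extends to
  \<open>span A\<close>.\<close>

lemma null_on_span: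
  assumes B: "basis B" and W: "module K W" and \<theta>: "\<theta> \<in> lin_maps K (exterior_power K k V) W" and A: "A \<subseteq> B"
  shows "null_on k W \<theta> (span A) \<longleftrightarrow> (\<forall>I\<in>ksub k A. coef k B \<theta> I = \<zero>\<^bsub>W\<^esub>)"
proof -
  have AV: "A \<subseteq> carrier V" using A basis_subset[OF B] by auto
  have spA: "span A \<subseteq> carrier V" using AV span_is_subset2 by auto
  have kAB: "I \<in> ksub k B" if "I \<in> ksub k A" for I using that A unfolding ksub_def by auto
  have enumA: "enum_tuple k I \<in> tuples k (span A)" if "I \<in> ksub k A" for I
  proof -
    have I: "finite I" "card I = k" "I \<subseteq> A" using ksub_basis[OF B kAB[OF that]] that by (auto simp: ksub_def)
    then show ?thesis using enum_tuple(1)[OF I(1,2)] tuples_mono[of I "span A" k] in_own_span[OF AV] by auto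
  qed
  show ?thesis unfolding null_on_iff[OF \<theta> W spA]
  proof
    assume "\<forall>t\<in>tuples k (span A). \<theta> (wedge K k V t) = \<zero>\<^bsub>W\<^esub>"
    then show "\<forall>I\<in>ksub k A. coef k B \<theta> I = \<zero>\<^bsub>W\<^esub>" using enumA kAB by (simp add: coef_def)
  next
    assume "\<forall>I\<in>ksub k A. coef k B \<theta> I = \<zero>\<^bsub>W\<^esub>"
    then have "\<theta> (wedge K k V (enum_tuple k I)) = \<zero>\<^bsub>W\<^esub>" if "I \<in> ksub k A" for I
      using that kAB by (auto simp: coef_def)
    then show "\<forall>t\<in>tuples k (span A). \<theta> (wedge K k V t) = \<zero>\<^bsub>W\<^esub>"
      using alternating_agree_span[OF lin_maps_alternating[OF \<theta> W] alternating_zero[OF W] W AV] by blast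
  qed
qed

lemma finite_ksub: "finite A \<Longrightarrow> finite (ksub k A)"
  unfolding ksub_def by (rule finite_subset[of _ "Pow A"]) auto

lemma card_ksub: "finite A \<Longrightarrow> card (ksub k A) = card A choose k"
  unfolding ksub_def by (rule n_subsets)

lemma finite_lin_maps:
  assumes "module K W" "finite (carrier W)"
  shows "finite (lin_maps K (exterior_power K k V) W)" "lin_maps K (exterior_power K k V) W \<noteq> {}"
proof -
  interpret W: module K W by fact
  obtain B where B: "basis B"
    using subspace_basis[OF subspace_carrier] unfolding basis_def by metis
  have "finite (ksub k B \<rightarrow>\<^sub>E carrier W)"
    using assms finite_ksub[OF finite_basis[OF B]] by (intro finite_PiE) auto
  moreover have "(\<lambda>I\<in>ksub k B. \<zero>\<^bsub>W\<^esub>) \<in> (ksub k B \<rightarrow>\<^sub>E carrier W)" by auto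
  ultimately show "finite (lin_maps K (exterior_power K k V) W)" "lin_maps K (exterior_power K k V) W \<noteq> {}"
    using bij_betw_finite[OF coef_bij[OF B assms(1), of k]] coef_bij[OF B assms(1), of k]
    unfolding bij_betw_def by blast+
qed

text \<open>In a basis containing adapted bases \<open>A\<close> of \<open>H\<close> and
  \<open>B0\<close> of \<open>U\<close>, conditions on subspaces of \<open>U\<close> involve only
  the coefficients on \<open>k\<close>-subsets of \<open>B0\<close>. The family \<open>D\<close> of
  \<open>k\<close>-subsets of \<open>A\<close> not contained in \<open>C = A \<inter> B0\<close> is
  disjoint from these. If \<open>H\<close> is null, the \<open>e\<close> coefficients indexed by
  \<open>D\<close> vanish, at the price of exactly \<open>card (carrier W) ^ e\<close>; conversely
  their vanishing suffices once \<open>H \<inter> U\<close> is known to be null.\<close>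

lemma count_null_extend:
  fixes k :: nat and W :: "('a, 'w, 'f) module_scheme"
  assumes W: "module K W" "finite (carrier W)" and H: "subspace K H V" and U: "subspace K U V"
    and SU: "\<And>S. S \<in> SS \<Longrightarrow> S \<subseteq> U"
  defines "L \<equiv> lin_maps K (exterior_power K k V) W"
  defines "e \<equiv> (sdim H choose k) - (sdim (H \<inter> U) choose k)"
  shows "card {\<theta> \<in> L. (\<forall>S\<in>SS. null_on k W \<theta> S) \<and> null_on k W \<theta> H} * card (carrier W) ^ e
      \<le> card {\<theta> \<in> L. \<forall>S\<in>SS. null_on k W \<theta> S}" (is ?A)
    and "(\<And>\<theta>. \<theta> \<in> L \<Longrightarrow> (\<forall>S\<in>SS. null_on k W \<theta> S) \<Longrightarrow> null_on k W \<theta> (H \<inter> U)) \<Longrightarrow>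
      card {\<theta> \<in> L. (\<forall>S\<in>SS. null_on k W \<theta> S) \<and> null_on k W \<theta> H} * card (carrier W) ^ e
      = card {\<theta> \<in> L. \<forall>S\<in>SS. null_on k W \<theta> S}" (is "PROP ?hyp \<Longrightarrow> ?B")
proof -
  interpret W: module K W by (rule W(1))
  have J: "subspace K (H \<inter> U) V" using subspace_Int[OF H U] .
  obtain C where C: "C \<subseteq> H \<inter> U" "lin_indpt C" "span C = H \<inter> U" "card C = sdim (H \<inter> U)"
    using subspace_basis[OF J] by blast
  obtain A where A: "C \<subseteq> A" "A \<subseteq> H" "lin_indpt A" "span A = H"
    using extend_basis[OF C(2) _ H] C(1) by (metis Int_subset_iff)
  obtain B0 where B0: "C \<subseteq> B0" "B0 \<subseteq> U" "lin_indpt B0" "span B0 = U"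
    using extend_basis[OF C(2) _ U] C(1) by (metis Int_subset_iff)
  note glue = glue_bases[OF H U A(3,4,2) B0(3,4,2) A(1) B0(1) C(3)]
  have HV: "H \<subseteq> carrier V" and UV: "U \<subseteq> carrier V" using subspace_subset H U by auto
  have "B0 \<union> A \<subseteq> carrier V" using A B0 HV UV by auto
  then obtain B where B: "B0 \<union> A \<subseteq> B" "B \<subseteq> carrier V" "lin_indpt B" "span B = carrier V"
    using extend_basis[OF glue(1) _ subspace_carrier] by blast
  have bB: "basis B" using B unfolding basis_def by auto
  have fB: "finite B" by (rule finite_basis[OF bB])
  have fA: "finite A" and fC: "finite C" using B(1) A(1) fB finite_subset by (auto intro: finite_subset)
  have cA: "card A = sdim H" using sdim_span[OF A(3)] A HV by auto
  define D where "D = ksub k A - ksub k C"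
  have kCA: "ksub k C \<subseteq> ksub k A" using A(1) unfolding ksub_def by auto
  have cD: "card D = e"
    unfolding D_def e_def using kCA finite_ksub[OF fC] by (simp add: card_Diff_subset card_ksub fA fC cA C(4))
  have DB: "D \<subseteq> ksub k B" using B(1) unfolding D_def ksub_def by auto
  have DB0: "D \<inter> ksub k B0 = {}" using glue(2) unfolding D_def ksub_def by auto
  note bij = coef_bij[OF bB W(1), of k, folded L_def]
  let ?co = "coef k B"
  let ?F = "ksub k B \<rightarrow>\<^sub>E carrier W"
  let ?null = "\<lambda>\<theta>. \<forall>S\<in>SS. null_on k W \<theta> S"
  \<comment> \<open>The condition on forms, transported to families of coefficients so that
    \<open>card_free_coordinates\<close> applies.\<close>
  define Q where "Q f = (\<exists>\<theta>\<in>L. ?co \<theta> = f \<and> ?null \<theta>)" for f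
  have Qco: "Q (?co \<theta>) = ?null \<theta>" if "\<theta> \<in> L" for \<theta>
    unfolding Q_def using that bij unfolding bij_betw_def inj_on_def by blast
  have null_cong: "?null \<theta> = ?null \<theta>'"
    if "\<theta> \<in> L" "\<theta>' \<in> L" "\<And>I. I \<in> ksub k B0 \<Longrightarrow> ?co \<theta> I = ?co \<theta>' I" for \<theta> \<theta>'
  proof -
    have B0B: "B0 \<subseteq> carrier V" using B0 UV by auto
    have "I \<in> ksub k B" if "I \<in> ksub k B0" for I using that B(1) unfolding ksub_def by auto
    then have "\<theta> (wedge K k V (enum_tuple k I)) = \<theta>' (wedge K k V (enum_tuple k I))" if "I \<in> ksub k B0" for I
      using \<open>\<And>I. I \<in> ksub k B0 \<Longrightarrow> ?co \<theta> I = ?co \<theta>' I\<close>[OF that] that by (simp add: coef_def)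
    then have ag: "\<theta> (wedge K k V t) = \<theta>' (wedge K k V t)" if "t \<in> tuples k U" for t
      using alternating_agree_span[OF lin_maps_alternating[OF _ W(1)] lin_maps_alternating[OF _ W(1)] W(1) B0B]
        \<open>\<theta> \<in> L\<close> \<open>\<theta>' \<in> L\<close> that B0(4) unfolding L_def by blast
    have "null_on k W \<theta> S = null_on k W \<theta>' S" if "S \<in> SS" for S
    proof -
      have S: "S \<subseteq> carrier V" "tuples k S \<subseteq> tuples k U" using SU[OF that] UV tuples_mono[OF SU[OF that], of k] by auto
      show ?thesis
        using null_on_iff[OF _ W(1) S(1), of \<theta> k] null_on_iff[OF _ W(1) S(1), of \<theta>' k]
          \<open>\<theta> \<in> L\<close> \<open>\<theta>' \<in> L\<close> ag S(2) unfolding L_def by (metis subsetD)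
    qed
    then show ?thesis by auto
  qed
  have Qcong: "Q f = Q g" if fg: "f \<in> ?F" "g \<in> ?F" "\<And>x. x \<in> ksub k B - D \<Longrightarrow> f x = g x" for f g
  proof -
    obtain \<theta> \<theta>' where t: "\<theta> \<in> L" "?co \<theta> = f" "\<theta>' \<in> L" "?co \<theta>' = g"
    proof -
      have "f \<in> ?co ` L" "g \<in> ?co ` L" using fg(1,2) bij unfolding bij_betw_def by simp_all
      then show ?thesis using that by blast
    qed
    have "I \<in> ksub k B - D" if "I \<in> ksub k B0" for I using that DB0 B(1) unfolding ksub_def by auto
    then have "?null \<theta> = ?null \<theta>'" using null_cong[OF t(1,3)] t fg(3) by auto
    then show ?thesis using Qco[OF t(1)] Qco[OF t(3)] t by simp
  qed
  have card_eq: "card {\<theta> \<in> L. R (?co \<theta>)} = card {f \<in> ?F. R f}" for R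
  proof -
    have "bij_betw ?co {\<theta> \<in> L. R (?co \<theta>)} {f \<in> ?F. R f}"
      using bij unfolding bij_betw_def inj_on_def by auto
    then show ?thesis by (rule bij_betw_same_card)
  qed
  have main: "card {\<theta> \<in> L. ?null \<theta>} = card {\<theta> \<in> L. ?null \<theta> \<and> (\<forall>I\<in>D. ?co \<theta> I = \<zero>\<^bsub>W\<^esub>)} * card (carrier W) ^ e"
  proof -
    have "{\<theta> \<in> L. ?null \<theta>} = {\<theta> \<in> L. Q (?co \<theta>)}" using Qco by auto
    moreover have "{\<theta> \<in> L. ?null \<theta> \<and> (\<forall>I\<in>D. ?co \<theta> I = \<zero>\<^bsub>W\<^esub>)} = {\<theta> \<in> L. Q (?co \<theta>) \<and> (\<forall>I\<in>D. ?co \<theta> I = \<zero>\<^bsub>W\<^esub>)}"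
      using Qco by auto
    moreover have "card {f \<in> ?F. Q f} = card {f \<in> ?F. Q f \<and> (\<forall>x\<in>D. f x = \<zero>\<^bsub>W\<^esub>)} * card (carrier W) ^ card D"
      by (rule card_free_coordinates[OF finite_ksub[OF fB] W(2) DB _ Qcong]) auto
    ultimately show ?thesis using card_eq[of Q] card_eq[of "\<lambda>f. Q f \<and> (\<forall>I\<in>D. f I = \<zero>\<^bsub>W\<^esub>)"] cD by simp
  qed
  have fL: "finite L" unfolding L_def by (rule finite_lin_maps[OF W])
  have nH: "null_on k W \<theta> H \<longleftrightarrow> (\<forall>I\<in>ksub k A. ?co \<theta> I = \<zero>\<^bsub>W\<^esub>)" if "\<theta> \<in> L" for \<theta>
    using null_on_span[OF bB W(1), of \<theta> k A] that A B(1) unfolding L_def by auto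
  have sub: "{\<theta> \<in> L. ?null \<theta> \<and> null_on k W \<theta> H} \<subseteq> {\<theta> \<in> L. ?null \<theta> \<and> (\<forall>I\<in>D. ?co \<theta> I = \<zero>\<^bsub>W\<^esub>)}"
    using nH unfolding D_def by auto
  have "card {\<theta> \<in> L. ?null \<theta> \<and> null_on k W \<theta> H} \<le> card {\<theta> \<in> L. ?null \<theta> \<and> (\<forall>I\<in>D. ?co \<theta> I = \<zero>\<^bsub>W\<^esub>)}"
    by (rule card_mono[OF _ sub]) (use fL in auto)
  then show ?A unfolding main by (rule mult_right_mono) simp
  show ?B if hyp: "PROP ?hyp"
  proof -
    have nC: "null_on k W \<theta> (H \<inter> U) \<longleftrightarrow> (\<forall>I\<in>ksub k C. ?co \<theta> I = \<zero>\<^bsub>W\<^esub>)" if "\<theta> \<in> L" for \<theta>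
      using null_on_span[OF bB W(1), of \<theta> k C] that A(1) B(1) C(3) unfolding L_def by auto
    have "{\<theta> \<in> L. ?null \<theta> \<and> null_on k W \<theta> H} = {\<theta> \<in> L. ?null \<theta> \<and> (\<forall>I\<in>D. ?co \<theta> I = \<zero>\<^bsub>W\<^esub>)}"
    proof (intro equalityI sub subsetI)
      fix \<theta> assume "\<theta> \<in> {\<theta> \<in> L. ?null \<theta> \<and> (\<forall>I\<in>D. ?co \<theta> I = \<zero>\<^bsub>W\<^esub>)}"
      then have t: "\<theta> \<in> L" "?null \<theta>" "\<And>I. I \<in> D \<Longrightarrow> ?co \<theta> I = \<zero>\<^bsub>W\<^esub>" by auto
      have "null_on k W \<theta> (H \<inter> U)" by (rule hyp[OF t(1)]) (use t(2) in auto)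
      then have "?co \<theta> I = \<zero>\<^bsub>W\<^esub>" if "I \<in> ksub k A" for I
        using nC[OF t(1)] t(3)[of I] that unfolding D_def by (cases "I \<in> ksub k C") auto
      then have "null_on k W \<theta> H" using nH[OF t(1)] by auto
      then show "\<theta> \<in> {\<theta> \<in> L. ?null \<theta> \<and> null_on k W \<theta> H}" using t by auto
    qed
    then show ?thesis using main by simp
  qed
qed

end

section \<open>The number of null subspaces\<close>

lemma tv_dist_ge: "\<bar>measure_pmf.prob P A - measure_pmf.prob Q A\<bar> \<le> tv_dist P Q"
proof -
  have "\<bar>measure_pmf.prob P B - measure_pmf.prob Q B\<bar> \<le> 1" for B
    using measure_pmf.prob_le_1[of P B] measure_pmf.prob_le_1[of Q B]
      measure_nonneg[of "measure_pmf P" B] measure_nonneg[of "measure_pmf Q" B] by linarith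
  then show ?thesis unfolding tv_dist_def
    by (intro cSUP_upper bdd_aboveI[where M = 1]) auto
qed

text \<open>An event of the image laws is pulled back along \<open>f\<close>.\<close>

lemma tv_dist_map_le: "tv_dist (map_pmf f P) (map_pmf f Q) \<le> tv_dist P Q"
  unfolding tv_dist_def[of "map_pmf f P"]
  by (intro cSUP_least) (auto simp: tv_dist_ge)

text \<open>Only the points where \<open>P\<close> exceeds \<open>Q\<close> contribute positively,
  and there \<open>f\<close> is at most \<open>M\<close>. The cut at \<open>N\<close> keeps the sums
  finite, so that \<open>f\<close> may be unbounded beyond it.\<close>

lemma tv_dist_test_function:
  fixes P Q :: "nat pmf" and f :: "nat \<Rightarrow> real"
  assumes "\<And>n. n \<le> N \<Longrightarrow> 0 \<le> f n" "\<And>n. n \<le> N \<Longrightarrow> f n \<le> M"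
  shows "(\<Sum>n\<le>N. f n * pmf P n) - (\<Sum>n\<le>N. f n * pmf Q n) \<le> M * tv_dist P Q"
proof -
  let ?A = "{n. n \<le> N \<and> pmf Q n < pmf P n}"
  have M: "0 \<le> M" using assms[of 0] by simp
  have "(\<Sum>n\<le>N. f n * pmf P n) - (\<Sum>n\<le>N. f n * pmf Q n) = (\<Sum>n\<le>N. f n * (pmf P n - pmf Q n))"
    by (simp add: sum_subtractf algebra_simps)
  also have "\<dots> \<le> (\<Sum>n\<le>N. if n \<in> ?A then M * (pmf P n - pmf Q n) else 0)"
  proof (rule sum_mono)
    fix n assume "n \<in> {..N}"
    then show "f n * (pmf P n - pmf Q n) \<le> (if n \<in> ?A then M * (pmf P n - pmf Q n) else 0)"
      using assms[of n] by (auto intro: mult_right_mono simp: mult_nonneg_nonpos)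
  qed
  also have "\<dots> = (\<Sum>n\<in>?A. M * (pmf P n - pmf Q n))"
    by (subst sum.inter_filter[symmetric]) auto
  also have "\<dots> = M * (measure_pmf.prob P ?A - measure_pmf.prob Q ?A)"
    by (simp add: measure_measure_pmf_finite sum_distrib_left sum_subtractf right_diff_distrib)
  also have "\<dots> \<le> M * tv_dist P Q"
    using tv_dist_ge[of P ?A Q] M by (intro mult_left_mono) auto
  finally show ?thesis .
qed

lemma sum_pmf_map_of_set:
  fixes f :: "nat \<Rightarrow> real"
  assumes "finite L" "L \<noteq> {}"
  shows "(\<Sum>n\<le>N. f n * pmf (map_pmf X (pmf_of_set L)) n) = (\<Sum>\<theta>\<in>{\<theta>\<in>L. X \<theta> \<le> N}. f (X \<theta>)) / card L"
proof -
  have "(\<Sum>n\<le>N. f n * pmf (map_pmf X (pmf_of_set L)) n) = (\<Sum>n\<le>N. f n * card {\<theta>\<in>L. X \<theta> = n}) / card L"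
    using assms by (simp add: pmf_map measure_pmf_of_set sum_divide_distrib vimage_def Int_def)
  also have "(\<Sum>n\<le>N. f n * card {\<theta>\<in>L. X \<theta> = n}) = (\<Sum>n\<le>N. \<Sum>\<theta>\<in>{\<theta>\<in>{\<theta>\<in>L. X \<theta> \<le> N}. X \<theta> = n}. f (X \<theta>))"
  proof (rule sum.cong[OF refl])
    fix n assume "n \<in> {..N}"
    then have "{\<theta>\<in>{\<theta>\<in>L. X \<theta> \<le> N}. X \<theta> = n} = {\<theta>\<in>L. X \<theta> = n}" by auto
    then show "f n * card {\<theta>\<in>L. X \<theta> = n} = (\<Sum>\<theta>\<in>{\<theta>\<in>{\<theta>\<in>L. X \<theta> \<le> N}. X \<theta> = n}. f (X \<theta>))" by simp
  qed
  also have "\<dots> = (\<Sum>\<theta>\<in>{\<theta>\<in>L. X \<theta> \<le> N}. f (X \<theta>))"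
    using assms by (intro sum.group) auto
  finally show ?thesis .
qed

text \<open>A step from \<open>n\<close> to \<open>n + 1\<close> reduces to
  \<open>(n + 1) * (n + 1 - k) \<le> n ^ 2\<close>, which holds as \<open>2 \<le> k\<close>. Hence
  \<open>n choose k\<close> divided by \<open>n ^ 2\<close> does not decrease, and the exponent
  estimates can compare squares in place of binomial coefficients.\<close>

lemma choose_square_mono:
  assumes "2 \<le> k" "j \<le> n"
  shows "(j choose k) * n\<^sup>2 \<le> (n choose k) * j\<^sup>2"
  using assms(2)
proof (induction n rule: dec_induct)
  case (step n)
  have s: "(n choose k) * (Suc n)\<^sup>2 \<le> (Suc n choose k) * n\<^sup>2"
  proof (cases "k \<le> n")
    case True
    have "Suc n * (Suc n - k) \<le> n\<^sup>2"
    proof -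
      have "Suc n - k \<le> n - 1" using assms by simp
      then have "Suc n * (Suc n - k) \<le> Suc n * (n - 1)" by (rule mult_le_mono2)
      also have "\<dots> \<le> n\<^sup>2" by (cases n) (auto simp: power2_eq_square)
      finally show ?thesis .
    qed
    then have "Suc n * (Suc n - k) * (Suc n * (n choose k)) \<le> n\<^sup>2 * (Suc n * (n choose k))" by (rule mult_le_mono1)
    also have "n\<^sup>2 * (Suc n * (n choose k)) = (Suc n - k) * ((Suc n choose k) * n\<^sup>2)"
    proof -
      have e: "Suc n * (n choose k) = (Suc n - k) * (Suc n choose k)" using binomial_absorb_comp[of "Suc n" k] by simp
      show ?thesis unfolding e by (simp only: ac_simps)
    qed
    also have "Suc n * (Suc n - k) * (Suc n * (n choose k)) = (Suc n - k) * ((n choose k) * (Suc n)\<^sup>2)"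
      by (simp only: power2_eq_square ac_simps)
    finally have "(Suc n - k) * ((n choose k) * (Suc n)\<^sup>2) \<le> (Suc n - k) * ((Suc n choose k) * n\<^sup>2)" .
    moreover have "0 < Suc n - k" using True by simp
    ultimately show ?thesis by (simp only: nat_mult_le_cancel1)
  qed (simp add: binomial_eq_0)
  show ?case
  proof (cases "n = 0")
    case False
    have "(j choose k) * n\<^sup>2 * (Suc n)\<^sup>2 \<le> (n choose k) * j\<^sup>2 * (Suc n)\<^sup>2" using step by simp
    also have "\<dots> = ((n choose k) * (Suc n)\<^sup>2) * j\<^sup>2" by simp
    also have "\<dots> \<le> ((Suc n choose k) * n\<^sup>2) * j\<^sup>2" using s by (rule mult_le_mono1)
    finally have "n\<^sup>2 * ((j choose k) * (Suc n)\<^sup>2) \<le> n\<^sup>2 * ((Suc n choose k) * j\<^sup>2)" by (simp add: algebra_simps)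
    then show ?thesis using False by simp
  next
    case True
    then have "j = 0" using step by simp
    then show ?thesis using assms by (simp add: binomial_eq_0)
  qed
qed simp

text \<open>The first condition yields \<open>16 r \<le> c\<close>; the second one yields \<open>r\<^sup>4 \<le> c\<close> as soon as
  \<open>2 k c > q\<^sup>r\<^sup>-\<^sup>1\<close>.\<close>

definition sufficiently_large :: "nat \<Rightarrow> nat \<Rightarrow> bool" where
  "sufficiently_large k r \<longleftrightarrow> 16 * k ^ 3 \<le> r \<and> 2 * k * r ^ 4 \<le> 2 ^ (r - 1)"

lemma eventually_sufficiently_large: "eventually (sufficiently_large k) sequentially"
proof -
  have "((\<lambda>r::nat. real r ^ 4 / 2 ^ r) \<longlongrightarrow> 0) at_top" by real_asymp
  then have "eventually (\<lambda>r::nat. real r ^ 4 / 2 ^ r < 1 / (4 * real k + 1)) sequentially"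
    by (rule order_tendstoD) simp
  moreover have "eventually (\<lambda>r::nat. 16 * k ^ 3 + 1 \<le> r) sequentially" by (rule eventually_ge_at_top)
  ultimately show ?thesis
  proof eventually_elim
    case (elim r)
    have "4 * real k * real r ^ 4 \<le> (4 * real k + 1) * real r ^ 4" by (intro mult_right_mono) auto
    also have "\<dots> \<le> 2 ^ r" using elim(1) by (simp add: field_simps)
    also have "\<dots> = 2 * 2 ^ (r - 1)" using elim(2) by (simp flip: power_Suc)
    finally have "real (2 * k * r ^ 4) \<le> real (2 ^ (r - 1))" by simp
    then have "2 * k * r ^ 4 \<le> 2 ^ (r - 1)" by (simp only: of_nat_le_iff)
    then show ?case using elim(2) unfolding sufficiently_large_def by simp
  qed
qed

text \<open>The interface between geometry and probability: probabilities appear as numbers of forms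
  in \<open>L\<close>, multiplied by powers of \<open>q\<close>. \<open>null_pair\<close> is
  nonnegative correlation; \<open>null_near\<close> supplies partners that meet \<open>H\<close> in
  a hyperplane; \<open>null_step\<close> bounds the expected number of further null spaces once
  those in \<open>Hs\<close> are null, \<open>j\<close> being the dimension of the intersection with
  a space containing all of \<open>Hs\<close>; \<open>null_super\<close> provides the null
  hyperplanes of a null space of dimension \<open>r + 1\<close>.\<close>

locale null_model =
  fixes q k r m c :: nat and L :: "'o set" and G :: "nat \<Rightarrow> 's set" and nul :: "'o \<Rightarrow> 's \<Rightarrow> bool"
  assumes q_ge: "2 \<le> q" and k_ge: "3 \<le> k" and m_ge: "1 \<le> m" and sufficiently_large: "sufficiently_large k r"
    and finL: "finite L" and neL: "L \<noteq> {}" and finG: "\<And>d. finite (G d)"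
    and rc: "r * c = m * (r choose k)"
    and card_G: "\<And>d. d \<le> r + c \<Longrightarrow> real q ^ (d * (r + c - d)) \<le> real (card (G d))"
      "\<And>d. d \<le> r + c \<Longrightarrow> real (card (G d)) \<le> 4 * real q ^ (d * (r + c - d))"
    and null_single: "\<And>d H. H \<in> G d \<Longrightarrow> card {\<theta>\<in>L. nul \<theta> H} * q ^ (m * (d choose k)) = card L"
    and null_pair: "\<And>d H H'. H \<in> G d \<Longrightarrow> H' \<in> G d \<Longrightarrow>
      card L \<le> card {\<theta>\<in>L. nul \<theta> H \<and> nul \<theta> H'} * q ^ (2 * (m * (d choose k)))"
    and null_near: "\<And>H. H \<in> G r \<Longrightarrow> \<exists>S \<subseteq> G r - {H}. q ^ c \<le> card S + 1 \<and>
      (\<forall>H'\<in>S. card {\<theta>\<in>L. nul \<theta> H \<and> nul \<theta> H'} * q ^ (m * (2 * (r choose k) - (r - 1 choose k))) = card L)"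
    and null_step: "\<And>d Hs. d \<le> r + c \<Longrightarrow> set Hs \<subseteq> G d \<Longrightarrow>
      (\<Sum>H\<in>G d. real (card {\<theta>\<in>L. (\<forall>S\<in>set Hs. nul \<theta> S) \<and> nul \<theta> H}))
      \<le> real (card {\<theta>\<in>L. \<forall>S\<in>set Hs. nul \<theta> S}) *
        (\<Sum>j\<le>d. 16 * real q ^ (j * (length Hs * d - j) + (d - j) * (r + c - d)) / real q ^ (m * ((d choose k) - (j choose k))))"
    and null_super: "\<And>\<theta> T. \<theta> \<in> L \<Longrightarrow> T \<in> G (Suc r) \<Longrightarrow> nul \<theta> T \<Longrightarrow> q ^ r \<le> card {H\<in>G r. nul \<theta> H}"
begin

section \<open>Sizes of the parameters\<close>

definition X :: "'o \<Rightarrow> nat" where "X \<theta> = card {H\<in>G r. nul \<theta> H}"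
definition mu :: real where "mu = card (G r) / real q ^ (r * c)"

lemma q_pos: "real q \<ge> 2" "real q > 0" "real q \<ge> 1" using q_ge by auto

lemma nL: "real (card L) > 0" using finL neL by (simp add: card_gt_0_iff)

lemma r_ge: "16 * k ^ 3 \<le> r" "2 * k * r ^ 4 \<le> 2 ^ (r - 1)" using sufficiently_large unfolding sufficiently_large_def by auto

lemma r_bounds: "432 \<le> r" "16 * k \<le> r" "2 * k\<^sup>2 \<le> r"
proof -
  have "3 ^ 3 \<le> k ^ 3" using k_ge by (intro power_mono) auto
  then show "432 \<le> r" using r_ge(1) by simp
  have "k ^ 1 \<le> k ^ 3" "k ^ 2 \<le> k ^ 3" using k_ge by (intro power_increasing; simp)+
  then show "16 * k \<le> r" "2 * k\<^sup>2 \<le> r" using r_ge(1) by auto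
qed

text \<open>In dimension \<open>r + c\<close> the order \<open>q ^ (r * c)\<close> of the number of
  \<open>r\<close>-spaces cancels the null probability; 1 and 4 are the constants of
  \<open>card_G\<close>.\<close>

lemma mu_bounds: "1 \<le> mu" "mu \<le> 4"
  using card_G[of r] q_pos unfolding mu_def by (simp_all add: divide_simps)

text \<open>\<open>r * c \<ge> (r choose k) \<ge> (r / k) ^ k \<ge> (r / k) ^ 3\<close> yields
  \<open>c \<ge> r ^ 2 / k ^ 3\<close>, and \<open>r \<ge> 16 * k ^ 3\<close>.\<close>

lemma c_ge: "16 * r \<le> c"
proof -
  have kr: "k \<le> r" using r_bounds by simp
  have "(real r / real k) ^ 3 \<le> (real r / real k) ^ k"
    using k_ge kr by (intro power_increasing) (auto simp: divide_simps)
  also have "\<dots> \<le> real (r choose k)" using kr by (rule binomial_ge_n_over_k_pow_k)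
  also have "\<dots> \<le> real (m * (r choose k))"
  proof -
    have "(r choose k) \<le> m * (r choose k)" using m_ge by (cases m) auto
    then show ?thesis by (simp only: of_nat_le_iff)
  qed
  also have "\<dots> = real r * real c" using rc by (metis of_nat_mult)
  finally have 1: "(real r / real k) ^ 3 \<le> real r * real c" .
  have k3: "0 < real k ^ 3" using k_ge by simp
  have r0: "real r > 0" using r_bounds by simp
  have "real r ^ 3 \<le> real r * real c * real k ^ 3"
    using 1 k3 by (simp add: power_divide divide_simps)
  then have "real r * (real r * real r) \<le> real r * (real c * real k ^ 3)" by (simp add: power3_eq_cube algebra_simps)
  then have "real r * real r \<le> real c * real k ^ 3" using r0 by simp
  moreover have "real r * (16 * real k ^ 3) \<le> real r * real r"
    using r_ge(1) by (intro mult_left_mono) (auto simp flip: of_nat_power of_nat_mult simp del: of_nat_power of_nat_mult)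
  ultimately have "real k ^ 3 * (16 * real r) \<le> real k ^ 3 * real c" by (simp add: algebra_simps)
  then have "16 * real r \<le> real c" using k3 by simp
  then show ?thesis by linarith
qed

lemma c_pos: "c \<ge> 1" "real c > 0" using c_ge r_bounds by auto

text \<open>Linearity of expectation, as a double count.\<close>

lemma sum_count: "finite A \<Longrightarrow> (\<Sum>\<theta>\<in>L. real (card {H\<in>A. P \<theta> H})) = (\<Sum>H\<in>A. real (card {\<theta>\<in>L. P \<theta> H}))"
proof -
  assume A: "finite A"
  have "(\<Sum>\<theta>\<in>L. real (card {H\<in>A. P \<theta> H})) = (\<Sum>\<theta>\<in>L. \<Sum>H\<in>A. if P \<theta> H then 1 else 0)"
    using A by (simp add: sum.If_cases Int_def conj_commute)
  also have "\<dots> = (\<Sum>H\<in>A. \<Sum>\<theta>\<in>L. if P \<theta> H then 1 else 0)" by (rule sum.swap)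
  also have "\<dots> = (\<Sum>H\<in>A. real (card {\<theta>\<in>L. P \<theta> H}))"
    using finL by (simp add: sum.If_cases Int_def conj_commute)
  finally show ?thesis .
qed

lemma card_null: "H \<in> G d \<Longrightarrow> real (card {\<theta>\<in>L. nul \<theta> H}) = card L / real q ^ (m * (d choose k))"
  using null_single[of H d] q_pos by (simp add: field_simps flip: of_nat_power of_nat_mult)

subsection \<open>Null subspaces of dimension \<open>r + 1\<close>\<close>

lemma choose_Suc_r: "real (m * (Suc r choose k)) = real r * real c * real (Suc r) / real (Suc r - k)"
proof -
  have "(Suc r - k) * (Suc r choose k) = Suc r * (r choose k)" using binomial_absorb_comp[of "Suc r" k] by simp
  then have "(Suc r - k) * (m * (Suc r choose k)) = Suc r * (r * c)" using rc by (metis mult.left_commute)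
  then have "real (Suc r - k) * real (m * (Suc r choose k)) = real (Suc r) * (real r * real c)"
    by (metis of_nat_mult)
  moreover have "real (Suc r - k) > 0" using r_bounds by simp
  ultimately show ?thesis by (simp add: field_simps)
qed

lemma choose_Suc_r_ge: "Suc r * c \<le> m * (Suc r choose k)"
proof -
  have "(Suc r - k) * (Suc r choose k) = Suc r * (r choose k)" using binomial_absorb_comp[of "Suc r" k] by simp
  then have "(Suc r - k) * (m * (Suc r choose k)) = Suc r * (r * c)" using rc by (metis mult.left_commute)
  moreover have "(Suc r - k) * (m * (Suc r choose k)) \<le> r * (m * (Suc r choose k))"
    using k_ge by (intro mult_le_mono1) simp
  ultimately have "r * (Suc r * c) \<le> r * (m * (Suc r choose k))" by (simp add: algebra_simps)
  moreover have "0 < r" using r_bounds by simp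
  ultimately show ?thesis by (simp only: nat_mult_le_cancel1)
qed

text \<open>The exponents in \<open>null_step\<close> for two spaces of dimension
  \<open>R = r + 1\<close> that meet in dimension \<open>j\<close>. By
  \<open>m * (R choose k) \<ge> R * c\<close> and the quadratic comparison, the right side is at
  least \<open>c * (R - j) * (R + j) / R\<close>, which is at least \<open>(R - j) * (c + j)\<close>
  because \<open>R \<le> c\<close>.\<close>

lemma exponent_Suc_r:
  assumes "j \<le> Suc r"
  shows "j * (Suc r - j) + (Suc r - j) * (c - 1) \<le> m * ((Suc r choose k) - (j choose k))"
proof -
  let ?R = "Suc r"
  have sq: "(j choose k) * (?R)\<^sup>2 \<le> (?R choose k) * j\<^sup>2" using choose_square_mono[OF _ assms, of k] k_ge by simp
  have mono: "(j choose k) \<le> (?R choose k)" using assms by (rule binomial_right_mono)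
  have "real m * real (j choose k) * (real ?R)\<^sup>2 \<le> real m * real (?R choose k) * (real j)\<^sup>2"
  proof -
    have "m * ((j choose k) * (?R)\<^sup>2) \<le> m * ((?R choose k) * j\<^sup>2)" using sq by (rule mult_le_mono2)
    then have "real (m * ((j choose k) * (?R)\<^sup>2)) \<le> real (m * ((?R choose k) * j\<^sup>2))" by (simp only: of_nat_le_iff)
    then show ?thesis by (simp add: algebra_simps)
  qed
  then have 1: "real m * real (?R choose k) * ((real ?R)\<^sup>2 - (real j)\<^sup>2)
     \<le> (real m * real (?R choose k) - real m * real (j choose k)) * (real ?R)\<^sup>2" by (simp add: algebra_simps)
  have "real (?R * c) \<le> real (m * (?R choose k))" using choose_Suc_r_ge by (simp only: of_nat_le_iff)
  then have "real ?R * real c \<le> real m * real (?R choose k)" by (simp only: of_nat_mult)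
  moreover have "(real ?R)\<^sup>2 - (real j)\<^sup>2 \<ge> 0" using assms by (simp add: power_mono)
  ultimately have 2: "real ?R * real c * ((real ?R)\<^sup>2 - (real j)\<^sup>2)
     \<le> (real m * real (?R choose k) - real m * real (j choose k)) * (real ?R)\<^sup>2"
    using 1 mult_right_mono order_trans by blast
  have cR: "real ?R \<le> real c" using c_ge r_bounds by simp
  have "real ?R * (real c + real j) \<le> real c * (real ?R + real j)"
    using cR mult_right_mono[OF cR, of "real j"] by (simp add: algebra_simps)
  then have "real ?R * (real ?R - real j) * (real ?R * (real c + real j))
      \<le> real ?R * (real ?R - real j) * (real c * (real ?R + real j))"
    using assms by (intro mult_left_mono) auto
  also have "\<dots> = real ?R * real c * ((real ?R)\<^sup>2 - (real j)\<^sup>2)" by (simp add: power2_eq_square algebra_simps)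
  also note 2
  finally have "(real ?R)\<^sup>2 * ((real ?R - real j) * (real c + real j))
      \<le> (real ?R)\<^sup>2 * (real m * real (?R choose k) - real m * real (j choose k))"
    by (simp add: power2_eq_square algebra_simps)
  moreover have "(real ?R)\<^sup>2 > 0" by simp
  ultimately have "(real ?R - real j) * (real c + real j) \<le> real m * real (?R choose k) - real m * real (j choose k)"
    by (simp only: mult_le_cancel_left_pos)
  then have "real ((?R - j) * (c + j)) \<le> real (m * ((?R choose k) - (j choose k)))"
    by (simp only: of_nat_mult of_nat_add of_nat_diff[OF assms] of_nat_diff[OF mono] right_diff_distrib)
  then have "(?R - j) * (c + j) \<le> m * ((?R choose k) - (j choose k))" by (simp only: of_nat_le_iff)
  moreover have "(?R - j) * ((c - 1) + j) \<le> (?R - j) * (c + j)" by (intro mult_le_mono2) simp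
  moreover have "j * (?R - j) + (?R - j) * (c - 1) = (?R - j) * ((c - 1) + j)" by (simp only: add_mult_distrib2 ac_simps)
  ultimately show ?thesis by linarith
qed

definition Z :: "'o \<Rightarrow> nat" where "Z \<theta> = card {T\<in>G (Suc r). nul \<theta> T}"

lemma Suc_r_le: "Suc r \<le> r + c" using c_pos by simp

text \<open>Given a null \<open>T\<close>, each of the \<open>r + 2\<close> possible dimensions of
  \<open>T \<inter> T'\<close> contributes at most 16 to the expected number of null
  \<open>T'\<close>, since \<open>exponent_Suc_r\<close> leaves no positive power of
  \<open>q\<close>. Clustering thus costs only a factor linear in \<open>r\<close>.\<close>

lemma sum_Z_square: "(\<Sum>\<theta>\<in>L. real (Z \<theta>) ^ 2) \<le> 16 * (real r + 2) * (\<Sum>\<theta>\<in>L. real (Z \<theta>))"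
proof -
  let ?R = "Suc r"
  have step: "(\<Sum>T'\<in>G ?R. real (card {\<theta>\<in>L. nul \<theta> T \<and> nul \<theta> T'})) \<le> real (card {\<theta>\<in>L. nul \<theta> T}) * (16 * (real r + 2))"
    if "T \<in> G ?R" for T
  proof -
    have "(\<Sum>j\<le>?R. 16 * real q ^ (j * (1 * ?R - j) + (?R - j) * (r + c - ?R)) / real q ^ (m * ((?R choose k) - (j choose k))))
       \<le> (\<Sum>j\<le>?R. 16)"
    proof (rule sum_mono)
      fix j assume "j \<in> {..?R}"
      then have "real q ^ (j * (1 * ?R - j) + (?R - j) * (r + c - ?R)) \<le> real q ^ (m * ((?R choose k) - (j choose k)))"
        using exponent_Suc_r[of j] q_pos by (intro power_increasing) auto
      then show "16 * real q ^ (j * (1 * ?R - j) + (?R - j) * (r + c - ?R)) / real q ^ (m * ((?R choose k) - (j choose k))) \<le> 16"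
        using q_pos by (simp add: divide_simps)
    qed
    also have "\<dots> = 16 * (real r + 2)" by simp
    finally have "(\<Sum>j\<le>?R. 16 * real q ^ (j * (1 * ?R - j) + (?R - j) * (r + c - ?R)) / real q ^ (m * ((?R choose k) - (j choose k))))
        \<le> 16 * (real r + 2)" .
    from mult_left_mono[OF this, of "real (card {\<theta>\<in>L. nul \<theta> T})"]
    show ?thesis using null_step[OF Suc_r_le, of "[T]"] that by simp
  qed
  have "(\<Sum>\<theta>\<in>L. real (Z \<theta>) ^ 2) = (\<Sum>\<theta>\<in>L. real (card {p \<in> G ?R \<times> G ?R. nul \<theta> (fst p) \<and> nul \<theta> (snd p)}))"
  proof (rule sum.cong[OF refl])
    fix \<theta>
    have "{p \<in> G ?R \<times> G ?R. nul \<theta> (fst p) \<and> nul \<theta> (snd p)} = {T\<in>G ?R. nul \<theta> T} \<times> {T\<in>G ?R. nul \<theta> T}" by auto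
    then show "real (Z \<theta>) ^ 2 = real (card {p \<in> G ?R \<times> G ?R. nul \<theta> (fst p) \<and> nul \<theta> (snd p)})"
      by (simp add: Z_def card_cartesian_product power2_eq_square)
  qed
  also have "\<dots> = (\<Sum>p\<in>G ?R \<times> G ?R. real (card {\<theta>\<in>L. nul \<theta> (fst p) \<and> nul \<theta> (snd p)}))"
    by (rule sum_count) (simp add: finG)
  also have "\<dots> = (\<Sum>T\<in>G ?R. \<Sum>T'\<in>G ?R. real (card {\<theta>\<in>L. nul \<theta> T \<and> nul \<theta> T'}))"
    by (simp add: sum.cartesian_product case_prod_unfold)
  also have "\<dots> \<le> (\<Sum>T\<in>G ?R. real (card {\<theta>\<in>L. nul \<theta> T}) * (16 * (real r + 2)))"
    by (rule sum_mono) (rule step)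
  also have "\<dots> = 16 * (real r + 2) * (\<Sum>\<theta>\<in>L. real (Z \<theta>))"
    unfolding Z_def sum_count[OF finG] sum_distrib_left by (intro sum.cong refl) (simp only: mult.commute)
  finally show ?thesis .
qed

text \<open>By Cauchy-Schwarz the probability of \<open>Z > 0\<close> is at least the squared mean
  over the second moment, and \<open>sum_Z_square\<close> reduces this to the mean divided by
  \<open>16 * (r + 2)\<close>.\<close>

lemma prob_super:
  "real (card {\<theta>\<in>L. Z \<theta> > 0}) / card L \<ge> real q ^ (Suc r * (c - 1)) / real q ^ (m * (Suc r choose k)) / (16 * (real r + 2))"
proof -
  let ?E = "{\<theta>\<in>L. Z \<theta> > 0}" and ?S = "\<Sum>\<theta>\<in>L. real (Z \<theta>)" and ?e = "real q ^ (m * (Suc r choose k))"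
  have S: "?S = card (G (Suc r)) * (card L / ?e)"
    unfolding Z_def sum_count[OF finG] using card_null by simp
  have cG: "real q ^ (Suc r * (c - 1)) \<le> card (G (Suc r))" using card_G(1)[OF Suc_r_le] by simp
  have "0 < real q ^ (Suc r * (c - 1))" using q_pos by simp
  then have "real (card (G (Suc r))) > 0" using cG by linarith
  then have Spos: "?S > 0" unfolding S using nL q_pos by (intro mult_pos_pos divide_pos_pos) auto
  have "?S = (\<Sum>\<theta>\<in>?E. real (Z \<theta>) * 1)"
    using finL by (intro sum.mono_neutral_cong_right) auto
  then have "?S\<^sup>2 = (\<Sum>\<theta>\<in>?E. real (Z \<theta>) * 1)\<^sup>2" by simp
  also have "\<dots> \<le> (\<Sum>\<theta>\<in>?E. (real (Z \<theta>))\<^sup>2) * (\<Sum>\<theta>\<in>?E. 1\<^sup>2)" by (rule Cauchy_Schwarz_ineq_sum)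
  also have "(\<Sum>\<theta>\<in>?E. (real (Z \<theta>))\<^sup>2) \<le> (\<Sum>\<theta>\<in>L. (real (Z \<theta>))\<^sup>2)"
    using finL by (intro sum_mono2) auto
  also have "\<dots> \<le> 16 * (real r + 2) * ?S" by (rule sum_Z_square)
  finally have "?S\<^sup>2 \<le> 16 * (real r + 2) * ?S * card ?E" by (simp add: mult_right_mono)
  then have "?S * ?S \<le> ?S * (16 * (real r + 2) * card ?E)" by (simp add: power2_eq_square algebra_simps)
  then have "?S \<le> 16 * (real r + 2) * card ?E" using Spos by simp
  then have "?S / card L / (16 * (real r + 2)) \<le> card ?E / card L"
    using nL by (simp add: divide_simps mult.commute)
  moreover have "real q ^ (Suc r * (c - 1)) / ?e \<le> ?S / card L"
    unfolding S using cG nL q_pos by (simp add: divide_right_mono)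
  then have "real q ^ (Suc r * (c - 1)) / ?e / (16 * (real r + 2)) \<le> ?S / card L / (16 * (real r + 2))"
    by (rule divide_right_mono) simp
  ultimately show ?thesis by linarith
qed

text \<open>The exponent of \<open>prob_super\<close> with its losses:
  \<open>2 * k ^ 2 * c / r\<close> comes from the binomial coefficient, the terms of order
  \<open>r\<close> come from the count of \<open>(r + 1)\<close>-spaces and from the factor
  \<open>16 * (r + 2)\<close>.\<close>

lemma prob_X_ge:
  "measure_pmf.prob (map_pmf X (pmf_of_set L)) {q ^ r..} \<ge> real q powr (- (real (k - 1) * c + 2 * real k ^ 2 * c / r + 2 * real r + 6))"
proof -
  let ?R = "real (Suc r)" and ?q = "real q"
  have "{\<theta>\<in>L. Z \<theta> > 0} \<subseteq> L \<inter> X -` {q ^ r..}"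
  proof
    fix \<theta> assume t: "\<theta> \<in> {\<theta>\<in>L. Z \<theta> > 0}"
    then obtain T where "T \<in> G (Suc r)" "nul \<theta> T" unfolding Z_def by (auto simp: card_gt_0_iff)
    then show "\<theta> \<in> L \<inter> X -` {q ^ r..}" using t null_super[of \<theta> T] by (auto simp: X_def)
  qed
  then have "card {\<theta>\<in>L. Z \<theta> > 0} \<le> card (L \<inter> X -` {q ^ r..})" using finL by (intro card_mono) auto
  then have "real (card {\<theta>\<in>L. Z \<theta> > 0}) / card L \<le> measure_pmf.prob (map_pmf X (pmf_of_set L)) {q ^ r..}"
    using finL neL nL by (simp add: measure_pmf_of_set divide_right_mono)
  moreover have "?q powr (- (real (k - 1) * c + 2 * real k ^ 2 * c / r + 2 * real r + 6))
    \<le> ?q ^ (Suc r * (c - 1)) / ?q ^ (m * (Suc r choose k)) / (16 * (real r + 2))"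
  proof -
    \<comment> \<open>Crude, but an exponent of order \<open>r\<close> is affordable in the end,
      because \<open>m * r ^ (k - 1) \<ge> r ^ 2\<close>.\<close>
    have "16 * (real r + 2) \<le> ?q ^ (r + 5)"
    proof -
      have "r + 2 \<le> 2 ^ (r + 1)" by (induction r) auto
      then have "real (r + 2) \<le> real (2 ^ (r + 1))" by (simp only: of_nat_le_iff)
      then have "16 * (real r + 2) \<le> 2 ^ (r + 5)" by (simp add: power_add)
      also have "\<dots> \<le> ?q ^ (r + 5)" using q_pos by (intro power_mono) auto
      finally show ?thesis .
    qed
    moreover have "real (m * (Suc r choose k)) \<le> real (Suc r * (c - 1)) + real (k - 1) * c + 2 * real k ^ 2 * c / r + real r + 1"
    proof -
      define d where "d = real (Suc r - k)"
      have d: "d = ?R - real k" unfolding d_def using r_bounds by simp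
      have d2: "real r \<le> 2 * d" "d > 0" unfolding d using r_bounds by simp_all
      have r0: "real r > 0" using r_bounds by simp
      \<comment> \<open>With \<open>R = r + 1\<close> this rests on
        \<open>r * R = (R + k - 1) * (R - k) + k * (k - 1)\<close>.\<close>
      have "real r * c * ?R / d = ?R * c + real (k - 1) * c + (real (k - 1) * real k * c) / d"
      proof -
        have "real r * c * ?R = (?R * c + real (k - 1) * c) * d + real (k - 1) * real k * c"
          unfolding d using k_ge by (simp add: of_nat_diff algebra_simps)
        then show ?thesis using d2(2) by (simp add: add_divide_distrib)
      qed
      moreover have "(real (k - 1) * real k * c) / d \<le> 2 * real k ^ 2 * c / r"
      proof -
        have "(real (k - 1) * real k * c) * real r \<le> (real k * real k * c) * (2 * d)"
          using d2 by (intro mult_mono) auto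
        also have "\<dots> = (2 * real k ^ 2 * c) * d" by (simp add: power2_eq_square)
        finally show ?thesis using d2(2) r0 by (simp only: frac_le_eq divide_le_eq_1 pos_divide_le_eq pos_le_divide_eq times_divide_eq_left)
      qed
      moreover have "?R * c = real (Suc r * (c - 1)) + ?R" using c_pos(1) by (cases c) (simp_all add: algebra_simps)
      ultimately show ?thesis unfolding choose_Suc_r d_def[symmetric] by simp
    qed
    ultimately have a: "16 * (real r + 2) \<le> ?q powr (real r + 5)"
      and b: "?q ^ (m * (Suc r choose k)) \<le> ?q powr (real (Suc r * (c - 1)) + real (k - 1) * c + 2 * real k ^ 2 * c / r + real r + 1)"
      using q_pos by (simp_all flip: powr_realpow)
    have e: "?q ^ (Suc r * (c - 1)) = ?q powr real (Suc r * (c - 1))" using q_pos by (intro powr_realpow[symmetric])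
    have "?q powr (- (real (k - 1) * c + 2 * real k ^ 2 * c / r + 2 * real r + 6))
      = ?q ^ (Suc r * (c - 1)) / ?q powr (real (Suc r * (c - 1)) + real (k - 1) * c + 2 * real k ^ 2 * c / r + real r + 1) / ?q powr (real r + 5)"
      unfolding e powr_diff[symmetric] by (rule arg_cong[where f = "\<lambda>x. ?q powr x"]) simp
    also have "\<dots> \<le> ?q ^ (Suc r * (c - 1)) / ?q ^ (m * (Suc r choose k)) / (16 * (real r + 2))"
      using a b q_pos by (intro frac_le divide_left_mono divide_nonneg_nonneg mult_pos_pos) auto
    finally show ?thesis .
  qed
  ultimately show ?thesis using prob_super by linarith
qed

text \<open>The tail of \<open>D\<close> is at most half of the lower bound in
  \<open>prob_X_ge\<close>; the halving is paid by one more factor \<open>q\<close>, which turns the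
  6 there into 7.\<close>

lemma tv_small_c:
  assumes D: "measure_pmf.prob D {q ^ r..} \<le> 128 / 2 ^ (q ^ r)" and cA: "2 * k * c \<le> q ^ (r - 1)"
  shows "tv_dist (map_pmf X (pmf_of_set L)) D \<ge> real q powr (- (real (k - 1) * c + 2 * real k ^ 2 * c / r + 2 * real r + 7))"
proof -
  let ?q = "real q"
  define y where "y = real (k - 1) * c + 2 * real k ^ 2 * c / r + 2 * real r + 6"
  have "2 * real k ^ 2 * c / r \<le> c"
  proof -
    have "2 * real k ^ 2 * c \<le> real r * c"
      using r_bounds(3) by (intro mult_right_mono) (auto simp flip: of_nat_power of_nat_mult simp del: of_nat_power of_nat_mult)
    then show ?thesis using r_bounds by (simp add: divide_simps mult.commute)
  qed
  moreover have "2 * real r + 14 \<le> real c" using c_ge r_bounds by linarith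
  moreover have "real (k - 1) * c = real k * c - c" using k_ge by (simp add: of_nat_diff algebra_simps)
  moreover have "3 * real c \<le> real k * c" using k_ge by (intro mult_right_mono) auto
  ultimately have y: "y + 8 \<le> 2 * real k * c" unfolding y_def by linarith
  have "real (2 * k * c) \<le> real (q ^ (r - 1))" using cA by (simp only: of_nat_le_iff)
  then have y2: "y + 8 \<le> real (q ^ (r - 1))" using y by simp
  \<comment> \<open>This turns the doubly exponential tail into a power of \<open>q\<close> whose
    exponent \<open>q ^ (r - 1)\<close> can be compared with \<open>2 * k * c\<close>.\<close>
  have "q \<le> 2 ^ q" by (rule less_imp_le[OF less_exp])
  then have "q ^ (q ^ (r - 1)) \<le> (2 ^ q) ^ (q ^ (r - 1))" by (rule power_mono) simp
  also have "\<dots> = 2 ^ (q ^ r)" using r_bounds by (simp flip: power_mult power_Suc)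
  finally have "real (q ^ (q ^ (r - 1))) \<le> real (2 ^ (q ^ r))" by (simp only: of_nat_le_iff)
  moreover have "?q powr (real (q ^ (r - 1))) = real (q ^ (q ^ (r - 1)))"
    using powr_realpow[OF q_pos(2), of "q ^ (r - 1)"] by (simp only: of_nat_power)
  ultimately have pw: "?q powr (real (q ^ (r - 1))) \<le> 2 ^ (q ^ r)" by simp
  \<comment> \<open>\<open>q ^ 8 \<ge> 256\<close> pays for the constant 128 and for the
    halving.\<close>
  have "128 * 2 * ?q powr y \<le> ?q ^ 8 * ?q powr y"
    using power_mono[of 2 ?q 8] q_pos by (intro mult_right_mono) auto
  also have "\<dots> = ?q powr (y + 8)" using q_pos by (simp add: powr_add)
  also have "\<dots> \<le> ?q powr (real (q ^ (r - 1)))" using y2 q_pos by (intro powr_mono) auto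
  also note pw
  finally have "128 / 2 ^ (q ^ r) \<le> ?q powr (- y) / 2"
    using q_pos by (simp add: powr_minus divide_simps mult.commute)
  then have "measure_pmf.prob D {q ^ r..} \<le> ?q powr (- y) / 2" using D by linarith
  then have "?q powr (- y) / 2 \<le> tv_dist (map_pmf X (pmf_of_set L)) D"
    using prob_X_ge[folded y_def] tv_dist_ge[of "map_pmf X (pmf_of_set L)" "{q ^ r..}" D] by linarith
  moreover have "?q powr (- (y + 1)) \<le> ?q powr (- y) / 2"
  proof -
    have "?q powr (- (y + 1)) = ?q powr (- y) / ?q powr 1"
      unfolding powr_diff[symmetric] by (rule arg_cong[where f = "\<lambda>x. ?q powr x"]) simp
    also have "\<dots> = ?q powr (- y) / ?q" using q_pos by simp
    also have "\<dots> \<le> ?q powr (- y) / 2" using q_pos by (intro divide_left_mono) auto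
    finally show ?thesis .
  qed
  moreover have "y + 1 = real (k - 1) * c + 2 * real k ^ 2 * c / r + 2 * real r + 7" unfolding y_def by simp
  ultimately show ?thesis by simp
qed


subsection \<open>Moments of the number of null subspaces\<close>

text \<open>By the quadratic comparison with dimension \<open>r\<close>, the left side is at most
  \<open>r * c * (j / r) ^ 2\<close>, and \<open>j / r \<le> 1\<close>.\<close>

lemma null_le_prod: assumes "j \<le> r" shows "m * (j choose k) \<le> j * c"
proof -
  have "(j choose k) * r\<^sup>2 \<le> (r choose k) * j\<^sup>2" using choose_square_mono[OF _ assms, of k] k_ge by simp
  then have "m * ((j choose k) * r\<^sup>2) \<le> m * ((r choose k) * j\<^sup>2)" by (rule mult_le_mono2)
  also have "\<dots> = r * c * j\<^sup>2" by (simp only: rc mult.assoc)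
  also have "\<dots> = r * (j * c) * j" by (simp add: power2_eq_square)
  also have "\<dots> \<le> r * (j * c) * r" using assms by (rule mult_le_mono2)
  finally have "r\<^sup>2 * (m * (j choose k)) \<le> r\<^sup>2 * (j * c)" by (simp add: power2_eq_square mult_ac)
  moreover have "0 < r\<^sup>2" using r_bounds by simp
  ultimately show ?thesis by (simp only: nat_mult_le_cancel1)
qed

text \<open>By \<open>null_le_prod\<close> the null probability absorbs the exponent
  \<open>(r - j) * c\<close>, which counts the spaces above a given intersection. What remains is
  the choice of the intersection in a space of dimension at most \<open>s * r\<close>; a factor
  \<open>q ^ (r ^ 2)\<close> pays for the constant and the sum over \<open>j\<close>.\<close>

lemma step_factor_le:
  "(\<Sum>j\<le>r. 16 * real q ^ (j * (s * r - j) + (r - j) * (r + c - r)) / real q ^ (m * ((r choose k) - (j choose k))))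
     \<le> real q ^ (Suc s * r\<^sup>2)"
proof -
  have "(\<Sum>j\<le>r. 16 * real q ^ (j * (s * r - j) + (r - j) * (r + c - r)) / real q ^ (m * ((r choose k) - (j choose k))))
     \<le> (\<Sum>j\<le>r. 16 * real q ^ (s * r\<^sup>2))"
  proof (rule sum_mono)
    fix j assume j: "j \<in> {..r}"
    have "(r - j) * c \<le> m * ((r choose k) - (j choose k))"
      using null_le_prod[of j] j rc by (simp add: diff_mult_distrib diff_mult_distrib2)
    moreover have "j * (s * r - j) \<le> r * (s * r)" using j by (intro mult_le_mono) auto
    ultimately have "j * (s * r - j) + (r - j) * (r + c - r) \<le> s * r\<^sup>2 + m * ((r choose k) - (j choose k))"
      by (simp add: power2_eq_square mult_ac)
    then have "real q ^ (j * (s * r - j) + (r - j) * (r + c - r)) \<le> real q ^ (s * r\<^sup>2 + m * ((r choose k) - (j choose k)))"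
      using q_pos by (intro power_increasing) auto
    then show "16 * real q ^ (j * (s * r - j) + (r - j) * (r + c - r)) / real q ^ (m * ((r choose k) - (j choose k))) \<le> 16 * real q ^ (s * r\<^sup>2)"
      using q_pos by (simp add: power_add divide_le_eq)
  qed
  also have "\<dots> = 16 * (real r + 1) * real q ^ (s * r\<^sup>2)" by simp
  also have "\<dots> \<le> real q ^ r\<^sup>2 * real q ^ (s * r\<^sup>2)"
  proof (rule mult_right_mono)
    have "r + 1 \<le> 2 ^ r" by (induction r) auto
    then have "real (r + 1) \<le> real (2 ^ r)" by (simp only: of_nat_le_iff)
    then have "16 * (real r + 1) \<le> 2 ^ (r + 4)" by (simp add: power_add)
    also have "(2::real) ^ (r + 4) \<le> 2 ^ r\<^sup>2"
    proof -
      have "r * 2 \<le> r * r" using r_bounds by (intro mult_le_mono2) simp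
      then have "r + 4 \<le> r\<^sup>2" unfolding power2_eq_square using r_bounds by linarith
      then show ?thesis by (intro power_increasing) auto
    qed
    also have "\<dots> \<le> real q ^ r\<^sup>2" using q_pos by (intro power_mono) auto
    finally show "16 * (real r + 1) \<le> real q ^ r\<^sup>2" .
  qed (use q_pos in simp)
  also have "\<dots> = real q ^ (Suc s * r\<^sup>2)" by (simp add: power_add)
  finally show ?thesis .
qed

text \<open>The power counts lists of \<open>s\<close> null spaces, with repetition. Appending one
  more space multiplies the bound by at most \<open>q ^ (Suc s * r ^ 2)\<close>, and
  \<open>s ^ 2 + s + 1 \<le> (s + 1) ^ 2\<close>.\<close>

lemma sum_X_power: "(\<Sum>\<theta>\<in>L. real (X \<theta>) ^ s) \<le> card L * real q ^ (s\<^sup>2 * r\<^sup>2)"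
proof -
  define Ls where "Ls s = {xs. set xs \<subseteq> G r \<and> length xs = s}" for s
  have fLs: "finite (Ls s)" for s unfolding Ls_def by (rule finite_lists_length_eq[OF finG])
  let ?all = "\<lambda>\<theta> xs. \<forall>S\<in>set xs. nul \<theta> S"
  have pow: "real (X \<theta>) ^ s = real (card {xs\<in>Ls s. ?all \<theta> xs})" for \<theta> s
  proof -
    have "{xs\<in>Ls s. ?all \<theta> xs} = {xs. set xs \<subseteq> {H\<in>G r. nul \<theta> H} \<and> length xs = s}" unfolding Ls_def by auto
    then show ?thesis using card_lists_length_eq[of "{H\<in>G r. nul \<theta> H}" s] finG by (simp add: X_def)
  qed
  have suc: "(\<Sum>\<theta>\<in>L. real (X \<theta>) ^ Suc s) \<le> (\<Sum>\<theta>\<in>L. real (X \<theta>) ^ s) * real q ^ (Suc s * r\<^sup>2)" for s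
  proof -
    have "(\<Sum>\<theta>\<in>L. real (X \<theta>) ^ Suc s) = (\<Sum>\<theta>\<in>L. real (card {p \<in> Ls s \<times> G r. ?all \<theta> (fst p) \<and> nul \<theta> (snd p)}))"
    proof (rule sum.cong[OF refl])
      fix \<theta>
      have "{p \<in> Ls s \<times> G r. ?all \<theta> (fst p) \<and> nul \<theta> (snd p)} = {xs\<in>Ls s. ?all \<theta> xs} \<times> {H\<in>G r. nul \<theta> H}" by auto
      then show "real (X \<theta>) ^ Suc s = real (card {p \<in> Ls s \<times> G r. ?all \<theta> (fst p) \<and> nul \<theta> (snd p)})"
        using pow[of \<theta> s] by (simp add: card_cartesian_product X_def mult.commute)
    qed
    also have "\<dots> = (\<Sum>p\<in>Ls s \<times> G r. real (card {\<theta>\<in>L. ?all \<theta> (fst p) \<and> nul \<theta> (snd p)}))"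
      by (rule sum_count) (simp add: finG fLs)
    also have "\<dots> = (\<Sum>xs\<in>Ls s. \<Sum>H\<in>G r. real (card {\<theta>\<in>L. ?all \<theta> xs \<and> nul \<theta> H}))"
      by (simp add: sum.cartesian_product case_prod_unfold)
    also have "\<dots> \<le> (\<Sum>xs\<in>Ls s. real (card {\<theta>\<in>L. ?all \<theta> xs}) * real q ^ (Suc s * r\<^sup>2))"
    proof (rule sum_mono)
      fix xs assume "xs \<in> Ls s"
      then have xs: "set xs \<subseteq> G r" "length xs = s" unfolding Ls_def by auto
      from mult_left_mono[OF step_factor_le[of s], of "real (card {\<theta>\<in>L. ?all \<theta> xs})"]
      show "(\<Sum>H\<in>G r. real (card {\<theta>\<in>L. ?all \<theta> xs \<and> nul \<theta> H})) \<le> real (card {\<theta>\<in>L. ?all \<theta> xs}) * real q ^ (Suc s * r\<^sup>2)"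
        using null_step[of r xs] xs by simp
    qed
    also have "\<dots> = (\<Sum>\<theta>\<in>L. real (card {xs\<in>Ls s. ?all \<theta> xs})) * real q ^ (Suc s * r\<^sup>2)"
      unfolding sum_count[OF fLs] by (simp only: sum_distrib_right)
    finally show ?thesis unfolding pow[symmetric] .
  qed
  show ?thesis
  proof (induction s)
    case (Suc s)
    have "(\<Sum>\<theta>\<in>L. real (X \<theta>) ^ Suc s) \<le> (\<Sum>\<theta>\<in>L. real (X \<theta>) ^ s) * real q ^ (Suc s * r\<^sup>2)" by (rule suc)
    also have "\<dots> \<le> (card L * real q ^ (s\<^sup>2 * r\<^sup>2)) * real q ^ (Suc s * r\<^sup>2)"
      using Suc q_pos by (intro mult_right_mono) auto
    also have "\<dots> = card L * real q ^ (s\<^sup>2 * r\<^sup>2 + Suc s * r\<^sup>2)" by (simp only: power_add mult.assoc)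
    also have "\<dots> \<le> card L * real q ^ ((Suc s)\<^sup>2 * r\<^sup>2)"
      using q_pos by (intro mult_left_mono power_increasing) (auto simp: power2_eq_square algebra_simps)
    finally show ?case .
  qed simp
qed

text \<open>From \<open>(r - k) * (r choose k) = r * (r - 1 choose k)\<close> follows
  \<open>m * (r - 1 choose k) = (r - k) * c\<close>: sharing a hyperplane saves that much of the
  exponent \<open>2 * r * c\<close> of an independent pair.\<close>

lemma near_exponent: "m * (2 * (r choose k) - (r - 1 choose k)) = r * c + k * c"
proof -
  have "(r - k) * (r choose k) = r * (r - 1 choose k)" by (rule binomial_absorb_comp)
  then have "(r - k) * (m * (r choose k)) = r * (m * (r - 1 choose k))" by (metis mult.left_commute)
  then have "r * ((r - k) * c) = r * (m * (r - 1 choose k))" unfolding rc[symmetric] by (metis mult.left_commute)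
  moreover have r0: "0 < r" using r_bounds by simp
  ultimately have 1: "(r - k) * c = m * (r - 1 choose k)" by simp
  have "m * (2 * (r choose k) - (r - 1 choose k)) = 2 * (r * c) - (r - k) * c"
    unfolding 1 rc by (simp add: diff_mult_distrib2 mult.left_commute)
  also have "\<dots> = r * c + k * c"
  proof -
    have "r * c = (r - k) * c + k * c" using r_bounds by (simp flip: add_mult_distrib)
    then show ?thesis by simp
  qed
  finally show ?thesis .
qed

text \<open>For fixed \<open>H\<close>, the pairs from \<open>null_near\<close> have probability
  \<open>1 / (P * A)\<close> and all others at least \<open>1 / (P * P)\<close>. The latter value
  for all pairs would give \<open>mu ^ 2\<close> up to the missing diagonal; the excess of the near
  pairs is of order \<open>B / A\<close>, that is \<open>q\<close> to the power
  \<open>-(k - 1) * c\<close>.\<close>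

lemma second_moment:
  "(\<Sum>\<theta>\<in>L. real (X \<theta>) * (real (X \<theta>) - 1)) \<ge> card L * (mu\<^sup>2 + 1 / (8 * real q ^ ((k - 1) * c)))"
proof -
  let ?n = "real (card L)" and ?q = "real q" and ?g = "real (card (G r))"
  define P where "P = ?q ^ (r * c)"
  define A where "A = ?q ^ (k * c)"
  define B where "B = ?q ^ c"
  have pos: "P > 0" "A > 0" "B > 0" using q_pos by (simp_all add: P_def A_def B_def)
  have BB: "16 \<le> B"
  proof -
    have "(2::real) ^ 4 \<le> ?q ^ 4" using q_pos by (intro power_mono) auto
    also have "\<dots> \<le> B" unfolding B_def using c_ge r_bounds q_pos by (intro power_increasing) auto
    finally show ?thesis by simp
  qed
  have PA: "16 * A \<le> P"
  proof -
    have "c + k * c \<le> r * c"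
      using mult_le_mono1[of "1 + k" r c] r_bounds by simp
    then have "?q ^ (c + k * c) \<le> P" unfolding P_def using q_pos by (intro power_increasing) auto
    then have "B * A \<le> P" by (simp add: power_add A_def B_def)
    moreover have "16 * A \<le> B * A" using BB pos by (intro mult_right_mono) auto
    ultimately show ?thesis by linarith
  qed
  have AB: "?q ^ ((k - 1) * c) = A / B"
  proof -
    have "k * c = (k - 1) * c + c" using k_ge by (cases k) auto
    then show ?thesis using pos unfolding A_def B_def by (simp add: power_add)
  qed
  have g: "mu * P = ?g" unfolding mu_def P_def using q_pos by simp
  have pairs: "(\<Sum>H'\<in>G r - {H}. real (card {\<theta>\<in>L. nul \<theta> H \<and> nul \<theta> H'})) \<ge> ?n / P * (mu + 1 / (8 * (A / B)))"
    if H: "H \<in> G r" for H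
  proof -
    obtain S where S: "S \<subseteq> G r - {H}" "q ^ c \<le> card S + 1"
      "\<forall>H'\<in>S. card {\<theta>\<in>L. nul \<theta> H \<and> nul \<theta> H'} * q ^ (m * (2 * (r choose k) - (r - 1 choose k))) = card L"
      using null_near[OF H] by blast
    have fS: "finite S" using S(1) finG finite_subset by blast
    have near: "real (card {\<theta>\<in>L. nul \<theta> H \<and> nul \<theta> H'}) = ?n / (P * A)" if "H' \<in> S" for H'
    proof -
      have "card {\<theta>\<in>L. nul \<theta> H \<and> nul \<theta> H'} * q ^ (r * c + k * c) = card L"
        using S(3) that unfolding near_exponent by blast
      then have "real (card {\<theta>\<in>L. nul \<theta> H \<and> nul \<theta> H'}) * (P * A) = ?n"
        unfolding P_def A_def power_add[symmetric] by (metis of_nat_mult of_nat_power)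
      then show ?thesis using pos by (simp add: eq_divide_eq)
    qed
    have far: "real (card {\<theta>\<in>L. nul \<theta> H \<and> nul \<theta> H'}) \<ge> ?n / (P * P)" if "H' \<in> G r" for H'
    proof -
      have "card L \<le> card {\<theta>\<in>L. nul \<theta> H \<and> nul \<theta> H'} * q ^ (2 * (m * (r choose k)))"
        using null_pair[OF H that] .
      then have "card L \<le> card {\<theta>\<in>L. nul \<theta> H \<and> nul \<theta> H'} * (q ^ (r * c) * q ^ (r * c))"
        unfolding rc[symmetric] by (simp add: power_add mult_2)
      then have "?n \<le> real (card {\<theta>\<in>L. nul \<theta> H \<and> nul \<theta> H'} * (q ^ (r * c) * q ^ (r * c)))" by (simp only: of_nat_le_iff)
      then have "?n \<le> real (card {\<theta>\<in>L. nul \<theta> H \<and> nul \<theta> H'}) * (P * P)" by (simp add: P_def)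
      then show ?thesis using pos by (simp add: divide_le_eq)
    qed
    have split: "(\<Sum>H'\<in>G r - {H}. real (card {\<theta>\<in>L. nul \<theta> H \<and> nul \<theta> H'}))
      = (\<Sum>H'\<in>S. real (card {\<theta>\<in>L. nul \<theta> H \<and> nul \<theta> H'})) + (\<Sum>H'\<in>G r - {H} - S. real (card {\<theta>\<in>L. nul \<theta> H \<and> nul \<theta> H'}))"
      using S(1) finG by (subst sum.subset_diff[of S]) auto
    have s1: "(\<Sum>H'\<in>S. real (card {\<theta>\<in>L. nul \<theta> H \<and> nul \<theta> H'})) = card S * (?n / (P * A))"
      using near by simp
    have cc: "real (card (G r - {H} - S)) = ?g - 1 - card S"
    proof -
      have "card (G r - {H} - S) = card (G r - {H}) - card S" "card S \<le> card (G r - {H})"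
        using S(1) finG fS by (auto simp: card_Diff_subset intro: card_mono)
      moreover have "card (G r) \<ge> 1" using H finG[of r] by (metis One_nat_def Suc_leI card_gt_0_iff empty_iff)
      ultimately show ?thesis using H finG by (simp add: of_nat_diff)
    qed
    have "(\<Sum>H'\<in>G r - {H} - S. real (card {\<theta>\<in>L. nul \<theta> H \<and> nul \<theta> H'})) \<ge> (\<Sum>H'\<in>G r - {H} - S. ?n / (P * P))"
      using far by (intro sum_mono) auto
    then have s2: "(\<Sum>H'\<in>G r - {H} - S. real (card {\<theta>\<in>L. nul \<theta> H \<and> nul \<theta> H'})) \<ge> (mu * P - 1 - card S) * (?n / (P * P))"
      unfolding g using cc by simp
    have sB: "B / 2 \<le> card S"
    proof -
      have "real (q ^ c) \<le> real (card S + 1)" using S(2) by (simp only: of_nat_le_iff)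
      then show ?thesis using BB by (simp add: B_def)
    qed
    have "card S * (?n / (P * A)) + (mu * P - 1 - card S) * (?n / (P * P))
       = ?n / P * (mu + (card S * (1 / A - 1 / P) - 1 / P))" using pos by (simp add: field_simps)
    \<comment> \<open>Origin of the 8: \<open>card S \<ge> B / 2\<close> and
      \<open>1 / A - 1 / P \<ge> 1 / (2 * A)\<close> give \<open>B / (4 * A)\<close>, half of which
      covers the lost diagonal term \<open>1 / P\<close>.\<close>
    moreover have "card S * (1 / A - 1 / P) - 1 / P \<ge> 1 / (8 * (A / B))"
    proof -
      have iP: "1 / P \<le> 1 / (16 * A)" using PA pos by (intro divide_left_mono) auto
      have "1 / A - 1 / P \<ge> 1 / (2 * A)" using iP pos by (simp add: field_simps)
      then have "(B / 2) * (1 / (2 * A)) \<le> card S * (1 / A - 1 / P)"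
        using sB pos by (intro mult_mono) auto
      moreover have "1 / (16 * A) \<le> B / (8 * A)" using BB pos by (simp add: field_simps)
      moreover have "(B / 2) * (1 / (2 * A)) = B / (8 * A) + B / (8 * A)" using pos by (simp add: field_simps)
      ultimately show ?thesis using iP by simp
    qed
    then have "?n / P * (mu + (card S * (1 / A - 1 / P) - 1 / P)) \<ge> ?n / P * (mu + 1 / (8 * (A / B)))"
      using pos nL by (intro mult_left_mono) auto
    ultimately show ?thesis using split s1 s2 by linarith
  qed
  have "(\<Sum>\<theta>\<in>L. real (X \<theta>) * (real (X \<theta>) - 1))
     = (\<Sum>\<theta>\<in>L. real (card {p \<in> Sigma (G r) (\<lambda>H. G r - {H}). nul \<theta> (fst p) \<and> nul \<theta> (snd p)}))"
  proof (rule sum.cong[OF refl])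
    fix \<theta>
    let ?N = "{H\<in>G r. nul \<theta> H}"
    have fN: "finite ?N" using finG by auto
    have "{p \<in> Sigma (G r) (\<lambda>H. G r - {H}). nul \<theta> (fst p) \<and> nul \<theta> (snd p)} = Sigma ?N (\<lambda>H. ?N - {H})" by auto
    then have "real (card {p \<in> Sigma (G r) (\<lambda>H. G r - {H}). nul \<theta> (fst p) \<and> nul \<theta> (snd p)})
       = (\<Sum>H\<in>?N. real (card (?N - {H})))" using fN by simp
    also have "\<dots> = (\<Sum>H\<in>?N. real (X \<theta>) - 1)"
    proof (rule sum.cong[OF refl])
      fix H assume H: "H \<in> ?N"
      then have "card ?N \<ge> 1" using fN by (metis One_nat_def Suc_leI card_gt_0_iff empty_iff)
      then show "real (card (?N - {H})) = real (X \<theta>) - 1" using H fN by (simp add: X_def of_nat_diff)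
    qed
    finally show "real (X \<theta>) * (real (X \<theta>) - 1)
      = real (card {p \<in> Sigma (G r) (\<lambda>H. G r - {H}). nul \<theta> (fst p) \<and> nul \<theta> (snd p)})" by (simp add: X_def)
  qed
  also have "\<dots> = (\<Sum>p\<in>Sigma (G r) (\<lambda>H. G r - {H}). real (card {\<theta>\<in>L. nul \<theta> (fst p) \<and> nul \<theta> (snd p)}))"
    by (rule sum_count) (simp add: finG)
  also have "\<dots> = (\<Sum>H\<in>G r. \<Sum>H'\<in>G r - {H}. real (card {\<theta>\<in>L. nul \<theta> H \<and> nul \<theta> H'}))"
    by (subst sum.Sigma) (auto simp: finG case_prod_unfold)
  finally have eq: "(\<Sum>\<theta>\<in>L. real (X \<theta>) * (real (X \<theta>) - 1)) = \<dots>" .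
  have "(\<Sum>H\<in>G r. ?n / P * (mu + 1 / (8 * (A / B)))) \<le> (\<Sum>\<theta>\<in>L. real (X \<theta>) * (real (X \<theta>) - 1))"
    unfolding eq by (rule sum_mono) (rule pairs)
  moreover have "(\<Sum>H\<in>G r. ?n / P * (mu + 1 / (8 * (A / B)))) = ?n * (mu * (mu + 1 / (8 * (A / B))))"
    unfolding mu_def P_def by simp
  \<comment> \<open>Here \<open>mu \<ge> 1\<close> keeps the whole excess.\<close>
  moreover have "mu\<^sup>2 + 1 / (8 * (A / B)) \<le> mu * (mu + 1 / (8 * (A / B)))"
    using mult_right_mono[OF mu_bounds(1), of "1 / (8 * (A / B))"] pos by (simp add: power2_eq_square distrib_left)
  then have "?n * (mu\<^sup>2 + 1 / (8 * (A / B))) \<le> ?n * (mu * (mu + 1 / (8 * (A / B))))"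
    by (rule mult_left_mono) simp
  ultimately show ?thesis unfolding AB by linarith
qed

text \<open>The condition on \<open>a\<close> limits the contribution of \<open>X > q ^ a\<close> to
  half of the excess in \<open>second_moment\<close>. The other half is seen by a test function
  bounded by \<open>q ^ (2 * a)\<close>.\<close>

lemma tv_large_c:
  assumes D: "\<And>N. (\<Sum>n\<le>N. real n * (real n - 1) * pmf D n) \<le> mu\<^sup>2"
    and a: "(r + 2)\<^sup>2 * r\<^sup>2 + k * c \<le> a * r"
  shows "tv_dist (map_pmf X (pmf_of_set L)) D \<ge> 1 / (16 * real q ^ ((k - 1) * c + 2 * a))"
proof -
  let ?q = "real q" and ?n = "real (card L)" and ?f = "\<lambda>n::nat. real n * (real n - 1)"
  let ?P = "map_pmf X (pmf_of_set L)"
  define N where "N = q ^ a"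
  define E where "E = ?q ^ ((k - 1) * c)"
  have Npos: "real N > 0" "N \<ge> 1" using q_ge by (auto simp: N_def)
  have f0: "0 \<le> ?f n" for n by (cases n) auto
  have fle: "?f n \<le> real n ^ 2" for n by (simp add: power2_eq_square algebra_simps)
  have Epos: "E > 0" using q_pos by (simp add: E_def)
  \<comment> \<open>Where \<open>X > N\<close>, the square of \<open>X\<close> is at most
    \<open>X ^ (r + 2) / N ^ r\<close>. With a moment of order growing like \<open>r\<close>, the
    exponent \<open>k * c\<close> enters \<open>a\<close> only after division by
    \<open>r\<close>.\<close>
  have tail: "(\<Sum>\<theta>\<in>{\<theta>\<in>L. \<not> X \<theta> \<le> N}. ?f (X \<theta>)) \<le> ?n / (16 * E)"
  proof -
    have "(\<Sum>\<theta>\<in>{\<theta>\<in>L. \<not> X \<theta> \<le> N}. ?f (X \<theta>)) \<le> (\<Sum>\<theta>\<in>{\<theta>\<in>L. \<not> X \<theta> \<le> N}. real (X \<theta>) ^ (r + 2) / real N ^ r)"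
    proof (rule sum_mono)
      fix \<theta> assume "\<theta> \<in> {\<theta>\<in>L. \<not> X \<theta> \<le> N}"
      then have "real N ^ r \<le> real (X \<theta>) ^ r" by (intro power_mono) auto
      then have "real (X \<theta>) ^ 2 * real N ^ r \<le> real (X \<theta>) ^ 2 * real (X \<theta>) ^ r" by (rule mult_left_mono) simp
      then have "real (X \<theta>) ^ 2 * real N ^ r \<le> real (X \<theta>) ^ (r + 2)" by (simp only: power_add mult.commute)
      then have "real (X \<theta>) ^ 2 \<le> real (X \<theta>) ^ (r + 2) / real N ^ r" using Npos by (simp add: le_divide_eq)
      then show "?f (X \<theta>) \<le> real (X \<theta>) ^ (r + 2) / real N ^ r" using fle[of "X \<theta>"] by linarith
    qed
    also have "\<dots> \<le> (\<Sum>\<theta>\<in>L. real (X \<theta>) ^ (r + 2) / real N ^ r)"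
      using finL by (intro sum_mono2) auto
    also have "\<dots> = (\<Sum>\<theta>\<in>L. real (X \<theta>) ^ (r + 2)) / real N ^ r" by (simp add: sum_divide_distrib)
    also have "\<dots> \<le> ?n * ?q ^ ((r + 2)\<^sup>2 * r\<^sup>2) / real N ^ r"
      by (rule divide_right_mono[OF sum_X_power]) simp
    also have "\<dots> \<le> ?n / ?q ^ (k * c)"
    proof -
      have "?q ^ ((r + 2)\<^sup>2 * r\<^sup>2) * ?q ^ (k * c) \<le> real N ^ r"
      proof -
        have "?q ^ ((r + 2)\<^sup>2 * r\<^sup>2 + k * c) \<le> ?q ^ (a * r)" using a q_pos by (intro power_increasing) auto
        then show ?thesis by (simp add: N_def power_add power_mult)
      qed
      then have "?n * (?q ^ ((r + 2)\<^sup>2 * r\<^sup>2) * ?q ^ (k * c)) \<le> ?n * real N ^ r" by (rule mult_left_mono) simp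
      moreover have "?q ^ (k * c) > 0" "real N ^ r > 0" using q_pos Npos by auto
      ultimately show ?thesis by (simp only: pos_divide_le_eq pos_le_divide_eq times_divide_eq_left mult.assoc)
    qed
    also have "\<dots> \<le> ?n / (16 * E)"
    proof -
      have "k * c = c + (k - 1) * c" using k_ge by (cases k) auto
      then have "?q ^ (k * c) = ?q ^ c * E" by (simp add: E_def power_add)
      moreover have "16 \<le> ?q ^ c"
      proof -
        have "(2::real) ^ 4 \<le> ?q ^ 4" using q_pos by (intro power_mono) auto
        also have "\<dots> \<le> ?q ^ c" using c_ge r_bounds q_pos by (intro power_increasing) auto
        finally show ?thesis by simp
      qed
      ultimately show ?thesis using Epos q_pos by (intro divide_left_mono) auto
    qed
    finally show ?thesis .
  qed
  have "(\<Sum>\<theta>\<in>L. ?f (X \<theta>)) = (\<Sum>\<theta>\<in>{\<theta>\<in>L. X \<theta> \<le> N}. ?f (X \<theta>)) + (\<Sum>\<theta>\<in>{\<theta>\<in>L. \<not> X \<theta> \<le> N}. ?f (X \<theta>))"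
    using finL by (subst sum.union_disjoint[symmetric]) (auto intro: sum.cong)
  then have "(\<Sum>\<theta>\<in>{\<theta>\<in>L. X \<theta> \<le> N}. ?f (X \<theta>)) \<ge> ?n * (mu\<^sup>2 + 1 / (8 * E)) - ?n / (16 * E)"
    using second_moment tail unfolding E_def by linarith
  also have "?n * (mu\<^sup>2 + 1 / (8 * E)) - ?n / (16 * E) = ?n * (mu\<^sup>2 + 1 / (16 * E))"
    using Epos by (simp add: field_simps)
  finally have "mu\<^sup>2 + 1 / (16 * E) \<le> (\<Sum>\<theta>\<in>{\<theta>\<in>L. X \<theta> \<le> N}. ?f (X \<theta>)) / ?n"
    using nL by (simp add: pos_le_divide_eq mult.commute)
  also have "\<dots> = (\<Sum>n\<le>N. ?f n * pmf ?P n)" using sum_pmf_map_of_set[OF finL neL, where f = ?f and N = N and X = X] by simp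
  finally have "1 / (16 * E) \<le> (\<Sum>n\<le>N. ?f n * pmf ?P n) - (\<Sum>n\<le>N. ?f n * pmf D n)"
    using D[of N] by linarith
  also have "\<dots> \<le> real N ^ 2 * tv_dist ?P D"
  proof (rule tv_dist_test_function)
    fix n assume "n \<le> N"
    then have "real n ^ 2 \<le> real N ^ 2" by (intro power_mono) auto
    then show "?f n \<le> real N ^ 2" using fle[of n] by linarith
  qed (rule f0)
  finally have "1 / (16 * E) \<le> tv_dist ?P D * real N ^ 2" by (simp only: mult.commute)
  moreover have "0 < real N ^ 2" using Npos by simp
  ultimately have "1 / (16 * E) / real N ^ 2 \<le> tv_dist ?P D" by (simp only: pos_divide_le_eq)
  moreover have "real N ^ 2 = ?q ^ (2 * a)"
    unfolding N_def by (simp add: power_mult[symmetric] mult.commute)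
  then have "1 / (16 * E) / real N ^ 2 = 1 / (16 * ?q ^ ((k - 1) * c + 2 * a))"
    by (simp add: E_def power_add)
  ultimately show ?thesis by (simp only:)
qed

text \<open>All losses are measured in units of \<open>S / r\<close>, where
  \<open>S = m * r ^ (k - 1)\<close>, by means of \<open>fact k * c \<le> S\<close> and
  \<open>r \<le> S / r\<close>. The constant \<open>2 * k ^ 2 + 24\<close> is large enough for both
  cases.\<close>

theorem tv_lower_bound:
  assumes D1: "\<And>M. measure_pmf.prob D {M..} \<le> 128 / 2 ^ M"
    and D2: "\<And>N. (\<Sum>n\<le>N. real n * (real n - 1) * pmf D n) \<le> mu\<^sup>2"
  shows "real q powr (- ((real k - 1) / fact k + (2 * real k ^ 2 + 24) / r) * real m * real r ^ (k - 1))
     \<le> tv_dist (map_pmf X (pmf_of_set L)) D"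
proof -
  define S where "S = real m * real r ^ (k - 1)"
  have r0: "real r > 0" using r_bounds by simp
  have kr: "k \<le> r" using r_bounds by simp
  have cS: "fact k * real c \<le> S"
  proof -
    have "fact k * (r choose k) \<le> r ^ k"
    proof -
      have "fact k * (r choose k) = fact r div fact (r - k)"
        using binomial_fact_lemma[OF kr] by (metis div_mult_self1_is_m fact_gt_zero mult.assoc mult.commute)
      then show ?thesis using fact_div_fact_le_pow[OF kr] by simp
    qed
    then have "m * (fact k * (r choose k)) \<le> m * r ^ k" by (rule mult_le_mono2)
    then have "fact k * (r * c) \<le> m * r ^ k" unfolding rc by (simp add: mult_ac)
    also have "r ^ k = r * r ^ (k - 1)" using k_ge by (cases k) auto
    finally have "r * (fact k * c) \<le> r * (m * r ^ (k - 1))" by (simp add: mult_ac)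
    then have "fact k * c \<le> m * r ^ (k - 1)" using r_bounds by simp
    then have "real (fact k * c) \<le> real (m * r ^ (k - 1))" by (simp only: of_nat_le_iff)
    then show ?thesis by (simp add: S_def)
  qed
  have S0: "S > 0" unfolding S_def using m_ge r0 by simp
  have c1: "real c \<le> S"
  proof -
    have "1 * real c \<le> fact k * real c" by (intro mult_right_mono) auto
    then show ?thesis using cS by simp
  qed
  have rS: "real r \<le> S / r"
  proof -
    have "real r ^ 2 \<le> real r ^ (k - 1)" using k_ge r_bounds by (intro power_increasing) auto
    also have "\<dots> \<le> S" unfolding S_def using m_ge mult_right_mono[of 1 "real m" "real r ^ (k - 1)"] by simp
    finally show ?thesis using r0 by (simp add: le_divide_eq power2_eq_square)
  qed
  have main: "real (k - 1) * c \<le> (real k - 1) / fact k * S"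
  proof -
    have "real c \<le> S / fact k" using cS by (simp add: le_divide_eq mult.commute)
    then have "(real k - 1) * real c \<le> (real k - 1) * (S / fact k)" using k_ge by (intro mult_left_mono) auto
    then show ?thesis using k_ge by (simp add: of_nat_diff)
  qed
  have goal: "real q powr (- ((real k - 1) / fact k + (2 * real k ^ 2 + 24) / r) * real m * real r ^ (k - 1)) \<le> real q powr (- y)"
    if "y \<le> real (k - 1) * c + (2 * real k ^ 2 + 24) * (S / r)" for y
  proof -
    have "- ((real k - 1) / fact k + (2 * real k ^ 2 + 24) / r) * real m * real r ^ (k - 1)
       = - ((real k - 1) / fact k * S + (2 * real k ^ 2 + 24) * (S / r))"
      unfolding S_def by (simp add: algebra_simps add_divide_distrib)
    then show ?thesis using that main q_pos by (intro powr_mono) auto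
  qed
  show ?thesis
  proof (cases "2 * k * c \<le> q ^ (r - 1)")
    case True
    have "2 * real k ^ 2 * c / r \<le> 2 * real k ^ 2 * (S / r)"
      using c1 r0 by (simp add: divide_right_mono mult_left_mono)
    moreover have "2 * real r + 7 \<le> 24 * (S / r)" using rS r_bounds by linarith
    ultimately have "real (k - 1) * c + 2 * real k ^ 2 * c / r + 2 * real r + 7
        \<le> real (k - 1) * c + (2 * real k ^ 2 + 24) * (S / r)" unfolding distrib_right by linarith
    from goal[OF this] show ?thesis using tv_small_c[OF D1 True] by linarith
  next
    case False
    \<comment> \<open>Both terms of the truncation condition divided by \<open>r\<close>; the last 1
      rounds \<open>k * c / r\<close> up.\<close>
    define a where "a = (r + 2)\<^sup>2 * r + k * c div r + 1"
    have "k * c = (k * c div r) * r + k * c mod r" by simp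
    moreover have "k * c mod r < r" using r_bounds by simp
    ultimately have "k * c \<le> (k * c div r + 1) * r" unfolding add_mult_distrib by linarith
    then have a: "(r + 2)\<^sup>2 * r\<^sup>2 + k * c \<le> a * r"
      unfolding a_def by (simp add: power2_eq_square algebra_simps)
    have r4: "real r ^ 3 \<le> S / r"
    proof -
      have "2 * k * r ^ 4 \<le> 2 ^ (r - 1)" by (rule r_ge)
      also have "\<dots> \<le> q ^ (r - 1)" using q_ge by (rule power_mono) simp
      also have "\<dots> \<le> 2 * k * c" using False by simp
      finally have "r ^ 4 \<le> c" using k_ge by simp
      then have "real (r ^ 4) \<le> real c" by (simp only: of_nat_le_iff)
      then have "real r ^ 3 * real r \<le> S" using c1 by (simp add: power_numeral_reduce mult_ac)
      then show ?thesis using r0 by (simp add: le_divide_eq)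
    qed
    \<comment> \<open>The two terms of \<open>a\<close> contribute
      \<open>(2 * k ^ 2 + 8) * (S / r)\<close>; the additive constants are absorbed by the rest of
      the 24.\<close>
    have aS: "2 * real a + 4 \<le> (2 * real k ^ 2 + 24) * (S / r)"
    proof -
      have "real (k * c div r) \<le> real k * real c / real r"
        using of_nat_div_le_of_nat[of "k * c" r, where 'a = real] by simp
      also have "\<dots> \<le> real k * (S / r)" using c1 r0 by (simp add: divide_right_mono mult_left_mono)
      also have "\<dots> \<le> real k ^ 2 * (S / r)"
        using k_ge S0 r0 by (intro mult_right_mono) (auto simp: power2_eq_square)
      finally have 1: "real (k * c div r) \<le> real k ^ 2 * (S / r)" .
      have "(r + 2)\<^sup>2 \<le> (2 * r)\<^sup>2" using r_bounds by (intro power_mono) auto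
      then have "(r + 2)\<^sup>2 * r \<le> (2 * r)\<^sup>2 * r" by (rule mult_le_mono1)
      also have "\<dots> = 4 * r ^ 3" by (simp add: power2_eq_square power3_eq_cube)
      finally have "real ((r + 2)\<^sup>2 * r) \<le> real (4 * r ^ 3)" by (simp only: of_nat_le_iff)
      then have 2: "real ((r + 2)\<^sup>2 * r) \<le> 4 * (S / r)" using r4 by simp
      have "real a = real ((r + 2)\<^sup>2 * r) + real (k * c div r) + 1" unfolding a_def by simp
      then show ?thesis using 1 2 rS r_bounds unfolding distrib_right by linarith
    qed
    have "1 / (16 * real q ^ ((k - 1) * c + 2 * a)) \<ge> real q powr (- (real (k - 1) * c + 2 * real a + 4))"
    proof -
      have "(2::real) ^ 4 \<le> real q ^ 4" using q_pos by (intro power_mono) auto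
      then have "16 * real q ^ ((k - 1) * c + 2 * a) \<le> real q ^ 4 * real q ^ ((k - 1) * c + 2 * a)"
        using q_pos by (intro mult_right_mono) auto
      also have "\<dots> = real q ^ ((k - 1) * c + 2 * a + 4)" by (simp add: power_add)
      also have "\<dots> = real q powr real ((k - 1) * c + 2 * a + 4)" using q_pos by (intro powr_realpow[symmetric])
      also have "\<dots> = real q powr (real (k - 1) * c + 2 * real a + 4)" by simp
      finally have le: "16 * real q ^ ((k - 1) * c + 2 * a) \<le> real q powr (real (k - 1) * c + 2 * real a + 4)" .
      have "1 / real q powr (real (k - 1) * c + 2 * real a + 4) \<le> 1 / (16 * real q ^ ((k - 1) * c + 2 * a))"
        using le q_pos by (intro divide_left_mono) auto
      then show ?thesis by (simp only: powr_minus_divide)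
    qed
    moreover have "real (k - 1) * c + 2 * real a + 4 \<le> real (k - 1) * c + (2 * real k ^ 2 + 24) * (S / r)"
      using aS by simp
    ultimately show ?thesis using goal[of "real (k - 1) * c + 2 * real a + 4"] tv_large_c[OF D2 a] by linarith
  qed
qed

end

section \<open>Uniform random forms\<close>

context finite_vectorspace
begin

lemma sdim_span_le:
  assumes "A \<subseteq> carrier V"
  shows "sdim (span A) \<le> card A"
proof -
  have s: "subspace K (span A) V" using assms by (rule span_is_subspace)
  interpret S: vectorspace K "vs (span A)" using s by (rule subspace_is_vs)
  have "A \<subseteq> span A" using assms by (simp add: in_own_span)
  moreover from this have "S.span A = span A" using span_li_not_depend(1)[OF _ is_module[OF s]] by simp
  moreover have "finite A" using assms finite_V finite_subset by blast
  ultimately show ?thesis by (intro S.gen_ge_dim) auto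
qed

lemma zero_subspace: "subspace K (span {}) V" "sdim (span {}) = 0" "subspace K H V \<Longrightarrow> span {} \<subseteq> H"
  using span_is_subspace[of "{}"] sdim_span[OF lin_indpt_empty] span_subset[of H "{}"] by auto

lemma grassmannian_between: "grassmannian K d V = between (span {}) (carrier V) d"
  unfolding grassmannian_def between_def using zero_subspace(3) subspace_subset by blast

lemma grassmannianD: "H \<in> grassmannian K d V \<Longrightarrow> subspace K H V \<and> sdim H = d"
  unfolding grassmannian_def by auto

lemma finite_grassmannian: "finite (grassmannian K d V)"
  unfolding grassmannian_between by (rule finite_between)

lemma card_grassmannian:
  assumes "d \<le> sdim (carrier V)"
  shows "real q ^ (d * (sdim (carrier V) - d)) \<le> real (card (grassmannian K d V))"
    "real (card (grassmannian K d V)) \<le> 4 * real q ^ (d * (sdim (carrier V) - d))"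
  using card_between_bounds[OF zero_subspace(1) subspace_carrier zero_subspace(3)[OF subspace_carrier], of d] assms
  unfolding grassmannian_between zero_subspace(2) by (simp_all add: mult.commute)

text \<open>The span of the union of bases. It serves as \<open>U\<close> in
  \<open>count_null_extend\<close>, where only its dimension matters for the counts.\<close>

lemma common_superspace:
  assumes "set Hs \<subseteq> grassmannian K d V"
  shows "\<exists>U. subspace K U V \<and> (\<forall>H\<in>set Hs. H \<subseteq> U) \<and> sdim U \<le> length Hs * d"
  using assms
proof (induction Hs)
  case Nil
  then show ?case using zero_subspace by (intro exI[of _ "span {}"]) auto
next
  case (Cons H Hs)
  then obtain U where U: "subspace K U V" "\<forall>H\<in>set Hs. H \<subseteq> U" "sdim U \<le> length Hs * d" by auto
  have H: "subspace K H V" "sdim H = d" using Cons.prems grassmannianD by auto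
  obtain A where A: "A \<subseteq> U" "span A = U" "card A = sdim U" using subspace_basis[OF U(1)] by metis
  obtain B where B: "B \<subseteq> H" "span B = H" "card B = sdim H" using subspace_basis[OF H(1)] by metis
  have AB: "A \<union> B \<subseteq> carrier V" using A B subspace_subset[OF U(1)] subspace_subset[OF H(1)] by auto
  have "sdim (span (A \<union> B)) \<le> card (A \<union> B)" using AB by (rule sdim_span_le)
  also have "\<dots> \<le> card A + card B" by (rule card_Un_le)
  finally have "sdim (span (A \<union> B)) \<le> length (H # Hs) * d" using A B U H by simp
  moreover have "U \<subseteq> span (A \<union> B)" "H \<subseteq> span (A \<union> B)"
    using span_is_monotone[of A "A \<union> B"] span_is_monotone[of B "A \<union> B"] A B by auto
  moreover have "subspace K (span (A \<union> B)) V" using AB by (rule span_is_subspace)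
  ultimately show ?case using U(2) by (intro exI[of _ "span (A \<union> B)"]) auto
qed

section \<open>Counting forms with values in a module of \<open>q ^ m\<close> elements\<close>

context
  fixes k m :: nat and W :: "('a, 'w, 'f) module_scheme"
  assumes k: "1 \<le> k" and W: "module K W" and cardW: "card (carrier W) = q ^ m"
begin

abbreviation forms where "forms \<equiv> lin_maps K (exterior_power K k V) W"

lemma finite_W: "finite (carrier W)"
  using cardW q_ge_2 by (intro card_ge_0_finite) simp

text \<open>The extension count with the zero space as \<open>U\<close> and no prior
  condition.\<close>

lemma card_null_on:
  assumes H: "subspace K H V"
  shows "card {\<theta>\<in>forms. null_on k W \<theta> H} * q ^ (m * (sdim H choose k)) = card forms"
proof -
  have HU: "H \<inter> span {} = span {}" using zero_subspace(3)[OF H] by auto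
  \<comment> \<open>The zero space is null because, \<open>k\<close> being positive, the empty basis
    has no \<open>k\<close>-subsets.\<close>
  have n0: "null_on k W \<theta> (span {})" if "\<theta> \<in> forms" for \<theta>
  proof -
    obtain B where "basis B" using subspace_basis[OF subspace_carrier] unfolding basis_def by metis
    then show ?thesis using null_on_span[of B W \<theta> k "{}"] W that k by (auto simp: ksub_def)
  qed
  have "card {\<theta>\<in>forms. (\<forall>S\<in>{}. null_on k W \<theta> S) \<and> null_on k W \<theta> H} * card (carrier W) ^ ((sdim H choose k) - (sdim (H \<inter> span {}) choose k))
     = card {\<theta>\<in>forms. \<forall>S\<in>{}. null_on k W \<theta> S}"
    by (rule count_null_extend(2)[OF W finite_W H zero_subspace(1)]) (use n0 HU in auto)
  then show ?thesis using k unfolding HU zero_subspace(2) cardW by (simp add: power_mult[symmetric] binomial_eq_0)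
qed

text \<open>Equality holds in the extension count, since \<open>H \<inter> U\<close> inherits
  nullity from \<open>U\<close>.\<close>

lemma card_null_on_pair:
  assumes H: "subspace K H V" and U: "subspace K U V"
  shows "card {\<theta>\<in>forms. null_on k W \<theta> U \<and> null_on k W \<theta> H} *
     q ^ (m * (sdim U choose k) + m * ((sdim H choose k) - (sdim (H \<inter> U) choose k))) = card forms"
proof -
  have "card {\<theta>\<in>forms. (\<forall>S\<in>{U}. null_on k W \<theta> S) \<and> null_on k W \<theta> H} * card (carrier W) ^ ((sdim H choose k) - (sdim (H \<inter> U) choose k))
     = card {\<theta>\<in>forms. \<forall>S\<in>{U}. null_on k W \<theta> S}"
    by (rule count_null_extend(2)[OF W finite_W H U])
       (use null_on_mono[OF _ W subspace_subset[OF U]] in auto)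
  then have "card {\<theta>\<in>forms. null_on k W \<theta> U \<and> null_on k W \<theta> H} * q ^ (m * ((sdim H choose k) - (sdim (H \<inter> U) choose k)))
     = card {\<theta>\<in>forms. null_on k W \<theta> U}"
    unfolding cardW by (simp add: power_mult[symmetric])
  then show ?thesis using card_null_on[OF U] by (simp add: power_add mult_ac)
qed

text \<open>Classify \<open>H\<close> by \<open>j = sdim (H \<inter> U)\<close>, with
  \<open>U\<close> a common superspace. The intersection is one of at most
  \<open>4 * q ^ ((sdim U - j) * j)\<close> subspaces of \<open>U\<close>, and \<open>H\<close> is
  one of at most \<open>4 * q ^ ((sdim (carrier V) - d) * (d - j))\<close> spaces above it; hence
  the 16.\<close>

lemma card_null_on_step:
  assumes d: "d \<le> sdim (carrier V)" and Hs: "set Hs \<subseteq> grassmannian K d V"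
  shows "(\<Sum>H\<in>grassmannian K d V. real (card {\<theta>\<in>forms. (\<forall>S\<in>set Hs. null_on k W \<theta> S) \<and> null_on k W \<theta> H}))
      \<le> real (card {\<theta>\<in>forms. \<forall>S\<in>set Hs. null_on k W \<theta> S}) *
        (\<Sum>j\<le>d. 16 * real q ^ (j * (length Hs * d - j) + (d - j) * (sdim (carrier V) - d)) / real q ^ (m * ((d choose k) - (j choose k))))"
proof -
  let ?G = "grassmannian K d V" and ?N = "sdim (carrier V)"
  let ?n = "real (card {\<theta>\<in>forms. \<forall>S\<in>set Hs. null_on k W \<theta> S})"
  have q0: "real q \<ge> 1" using q_ge_2 by simp
  obtain U where U: "subspace K U V" "\<forall>H\<in>set Hs. H \<subseteq> U" "sdim U \<le> length Hs * d"
    using common_superspace[OF Hs] by blast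
  let ?w = "\<lambda>j. real q ^ (m * ((d choose k) - (j choose k)))"
  have one: "real (card {\<theta>\<in>forms. (\<forall>S\<in>set Hs. null_on k W \<theta> S) \<and> null_on k W \<theta> H}) \<le> ?n / ?w (sdim (H \<inter> U))"
    if "H \<in> ?G" for H
  proof -
    have H: "subspace K H V" "sdim H = d" using grassmannianD[OF that] by auto
    have "card {\<theta>\<in>forms. (\<forall>S\<in>set Hs. null_on k W \<theta> S) \<and> null_on k W \<theta> H} * card (carrier W) ^ ((sdim H choose k) - (sdim (H \<inter> U) choose k))
       \<le> card {\<theta>\<in>forms. \<forall>S\<in>set Hs. null_on k W \<theta> S}"
      by (rule count_null_extend(1)[OF W finite_W H(1) U(1)]) (use U(2) in auto)
    then have "card {\<theta>\<in>forms. (\<forall>S\<in>set Hs. null_on k W \<theta> S) \<and> null_on k W \<theta> H} * q ^ (m * ((d choose k) - (sdim (H \<inter> U) choose k)))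
       \<le> card {\<theta>\<in>forms. \<forall>S\<in>set Hs. null_on k W \<theta> S}"
      unfolding cardW H(2) by (simp add: power_mult[symmetric])
    then have "real (card {\<theta>\<in>forms. (\<forall>S\<in>set Hs. null_on k W \<theta> S) \<and> null_on k W \<theta> H} * q ^ (m * ((d choose k) - (sdim (H \<inter> U) choose k)))) \<le> ?n"
      by (simp only: of_nat_le_iff)
    then show ?thesis using q0 by (simp add: pos_le_divide_eq)
  qed
  have jd: "sdim (H \<inter> U) \<le> d" if "H \<in> ?G" for H
    using grassmannianD[OF that] sdim_mono[OF subspace_Int[OF _ U(1)], of H H] by auto
  have cnt: "real (card {H\<in>?G. sdim (H \<inter> U) = j}) \<le> 16 * real q ^ (j * (length Hs * d - j) + (d - j) * (?N - d))"
    if j: "j \<le> d" for j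
  proof (cases "j \<le> sdim U")
    case True
    have UV: "sdim U \<le> ?N" using sdim_mono[OF U(1) subspace_carrier subspace_subset[OF U(1)]] .
    let ?B = "between (span {}) U j"
    have "{H\<in>?G. sdim (H \<inter> U) = j} \<subseteq> (\<Union>J\<in>?B. between J (carrier V) d)"
    proof
      fix H assume "H \<in> {H\<in>?G. sdim (H \<inter> U) = j}"
      then have H: "subspace K H V" "sdim H = d" "sdim (H \<inter> U) = j" using grassmannianD by auto
      have "H \<inter> U \<in> ?B" unfolding between_def using subspace_Int[OF H(1) U(1)] H zero_subspace(3) by auto
      moreover have "H \<in> between (H \<inter> U) (carrier V) d" unfolding between_def using H subspace_subset by auto
      ultimately show "H \<in> (\<Union>J\<in>?B. between J (carrier V) d)" by blast
    qed
    then have "card {H\<in>?G. sdim (H \<inter> U) = j} \<le> card (\<Union>J\<in>?B. between J (carrier V) d)"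
      by (intro card_mono) (auto simp: finite_between)
    also have "\<dots> \<le> (\<Sum>J\<in>?B. card (between J (carrier V) d))" by (rule card_UN_le[OF finite_between])
    finally have "real (card {H\<in>?G. sdim (H \<inter> U) = j}) \<le> real (\<Sum>J\<in>?B. card (between J (carrier V) d))"
      by (simp only: of_nat_le_iff)
    also have "\<dots> = (\<Sum>J\<in>?B. real (card (between J (carrier V) d)))" by simp
    also have "\<dots> \<le> (\<Sum>J\<in>?B. 4 * real q ^ ((?N - d) * (d - j)))"
    proof (rule sum_mono)
      fix J assume "J \<in> ?B"
      then have J: "subspace K J V" "sdim J = j" unfolding between_def by auto
      show "real (card (between J (carrier V) d)) \<le> 4 * real q ^ ((?N - d) * (d - j))"
        using card_between_bounds(2)[OF J(1) subspace_carrier subspace_subset[OF J(1)], of d] J(2) j d by simp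
    qed
    also have "\<dots> = real (card ?B) * (4 * real q ^ ((?N - d) * (d - j)))" by simp
    also have "\<dots> \<le> (4 * real q ^ ((sdim U - j) * j)) * (4 * real q ^ ((?N - d) * (d - j)))"
      using card_between_bounds(2)[OF zero_subspace(1) U(1) zero_subspace(3)[OF U(1)], of j] zero_subspace(2) True
      by (intro mult_right_mono) auto
    also have "\<dots> \<le> (4 * real q ^ (j * (length Hs * d - j))) * (4 * real q ^ ((?N - d) * (d - j)))"
    proof -
      have "(sdim U - j) * j \<le> j * (length Hs * d - j)"
        unfolding mult.commute[of _ j] using U(3) by (intro mult_le_mono2) simp
      then have "real q ^ ((sdim U - j) * j) \<le> real q ^ (j * (length Hs * d - j))"
        using q0 by (intro power_increasing) auto
      then show ?thesis using q0 by (intro mult_right_mono) auto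
    qed
    also have "\<dots> = 16 * real q ^ (j * (length Hs * d - j) + (d - j) * (?N - d))"
      by (simp add: power_add mult.commute)
    finally show ?thesis .
  next
    case False
    have e: "{H\<in>?G. sdim (H \<inter> U) = j} = {}"
      using False grassmannianD sdim_mono[OF subspace_Int[OF _ U(1)] U(1)] by fastforce
    show ?thesis unfolding e by simp
  qed
  have "(\<Sum>H\<in>?G. real (card {\<theta>\<in>forms. (\<forall>S\<in>set Hs. null_on k W \<theta> S) \<and> null_on k W \<theta> H}))
     \<le> (\<Sum>H\<in>?G. ?n / ?w (sdim (H \<inter> U)))" by (rule sum_mono) (rule one)
  also have "\<dots> = (\<Sum>j\<le>d. \<Sum>H\<in>{H\<in>?G. sdim (H \<inter> U) = j}. ?n / ?w (sdim (H \<inter> U)))"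
    by (rule sum.group[symmetric]) (use jd finite_grassmannian in auto)
  also have "\<dots> = (\<Sum>j\<le>d. real (card {H\<in>?G. sdim (H \<inter> U) = j}) * (?n / ?w j))"
    by (intro sum.cong refl) simp
  also have "\<dots> \<le> (\<Sum>j\<le>d. (16 * real q ^ (j * (length Hs * d - j) + (d - j) * (?N - d))) * (?n / ?w j))"
    by (intro sum_mono mult_right_mono cnt) auto
  also have "\<dots> = ?n * (\<Sum>j\<le>d. 16 * real q ^ (j * (length Hs * d - j) + (d - j) * (?N - d)) / ?w j)"
    unfolding sum_distrib_left by (intro sum.cong refl) simp
  finally show ?thesis .
qed

text \<open>A single hyperplane \<open>J\<close> of \<open>H\<close> suffices: at least
  \<open>q ^ c\<close> spaces of dimension \<open>r\<close> lie above \<open>J\<close>, and each of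
  them other than \<open>H\<close> meets \<open>H\<close> exactly in \<open>J\<close>.\<close>

lemma null_near_exists:
  assumes H: "H \<in> grassmannian K r V" and r: "1 \<le> r" and c: "sdim (carrier V) = r + c"
  shows "\<exists>S \<subseteq> grassmannian K r V - {H}. q ^ c \<le> card S + 1 \<and>
      (\<forall>H'\<in>S. card {\<theta>\<in>forms. null_on k W \<theta> H \<and> null_on k W \<theta> H'} * q ^ (m * (2 * (r choose k) - (r - 1 choose k))) = card forms)"
proof -
  have sH: "subspace K H V" "sdim H = r" using grassmannianD[OF H] by auto
  obtain A where A: "A \<subseteq> H" "lin_indpt A" "span A = H" "card A = r" using subspace_basis[OF sH(1)] sH(2) by metis
  have AV: "A \<subseteq> carrier V" using A subspace_subset[OF sH(1)] by auto
  obtain a where a: "a \<in> A" using A(4) r by (metis card.empty equals0I not_one_le_zero)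
  let ?J = "span (A - {a})"
  have fA: "finite A" using AV finite_V finite_subset by blast
  have J: "subspace K ?J V" using AV by (intro span_is_subspace) auto
  have dJ: "sdim ?J = r - 1"
    using sdim_span[of "A - {a}"] subset_li_is_li[OF A(2), of "A - {a}"] AV a A(4) fA by auto
  have JH: "?J \<subseteq> H" using span_is_monotone[of "A - {a}" A] A(3) by auto
  let ?B = "between ?J (carrier V) r"
  have BG: "?B \<subseteq> grassmannian K r V" unfolding between_def grassmannian_def by auto
  have "real q ^ ((r + c - r) * (r - (r - 1))) \<le> real (card ?B)"
    using card_between_bounds(1)[OF J subspace_carrier subspace_subset[OF J], of r] c dJ by simp
  moreover have "(r + c - r) * (r - (r - 1)) = c" using r by simp
  ultimately have "real (q ^ c) \<le> real (card ?B)" by (simp only: of_nat_power)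
  then have "q ^ c \<le> card ?B" by (simp only: of_nat_le_iff)
  also have "\<dots> \<le> card (?B - {H}) + 1"
    using finite_between by (metis Suc_eq_plus1 card_Diff1_le card_Suc_Diff1 diff_le_self le_refl le_SucI Diff_empty Diff_insert0)
  finally have 1: "q ^ c \<le> card (?B - {H}) + 1" .
  have 2: "card {\<theta>\<in>forms. null_on k W \<theta> H \<and> null_on k W \<theta> H'} * q ^ (m * (2 * (r choose k) - (r - 1 choose k))) = card forms"
    if "H' \<in> ?B - {H}" for H'
  proof -
    have H': "subspace K H' V" "sdim H' = r" "?J \<subseteq> H'" "H' \<noteq> H" using that unfolding between_def by auto
    have I: "subspace K (H' \<inter> H) V" using subspace_Int[OF H'(1) sH(1)] .
    have "r - 1 \<le> sdim (H' \<inter> H)" using sdim_mono[OF J I] H'(3) JH dJ by auto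
    moreover have "sdim (H' \<inter> H) \<le> r" using sdim_mono[OF I sH(1)] sH(2) by auto
    moreover have "sdim (H' \<inter> H) \<noteq> r"
    proof
      assume "sdim (H' \<inter> H) = r"
      then have "H' \<inter> H = H'" "H' \<inter> H = H"
        using sdim_eq_imp_eq[OF I H'(1)] sdim_eq_imp_eq[OF I sH(1)] H'(2) sH(2) by auto
      then show False using H'(4) by auto
    qed
    ultimately have e: "sdim (H' \<inter> H) = r - 1" by linarith
    have le: "(r - 1 choose k) \<le> (r choose k)" by (rule binomial_right_mono) simp
    have "2 * (r choose k) - (r - 1 choose k) = (r choose k) + ((r choose k) - (r - 1 choose k))" using le by simp
    then have "m * (2 * (r choose k) - (r - 1 choose k)) = m * (r choose k) + m * ((r choose k) - (r - 1 choose k))"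
      by (simp only: add_mult_distrib2)
    then show ?thesis using card_null_on_pair[OF H'(1) sH(1)] unfolding e H'(2) sH(2) by simp
  qed
  show ?thesis using BG 1 2 by (intro exI[of _ "?B - {H}"]) blast
qed

theorem exterior_null_model:
  assumes "3 \<le> k" "1 \<le> m" "sufficiently_large k r" "r * c = m * (r choose k)" "sdim (carrier V) = r + c"
  shows "null_model q k r m c forms (\<lambda>d. grassmannian K d V) (null_on k W)"
proof
  show "2 \<le> q" by (rule q_ge_2)
  show "finite forms" "forms \<noteq> {}" using finite_lin_maps[OF W finite_W] by auto
  show "finite (grassmannian K d V)" for d by (rule finite_grassmannian)
  show "real q ^ (d * (r + c - d)) \<le> real (card (grassmannian K d V))"
    "real (card (grassmannian K d V)) \<le> 4 * real q ^ (d * (r + c - d))" if "d \<le> r + c" for d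
    using card_grassmannian[of d] that assms(5) by auto
  show "card {\<theta>\<in>forms. null_on k W \<theta> H} * q ^ (m * (d choose k)) = card forms" if "H \<in> grassmannian K d V" for d H
    using card_null_on[of H] grassmannianD[OF that] by auto
  show "card forms \<le> card {\<theta>\<in>forms. null_on k W \<theta> H \<and> null_on k W \<theta> H'} * q ^ (2 * (m * (d choose k)))"
    if "H \<in> grassmannian K d V" "H' \<in> grassmannian K d V" for d H H'
  proof -
    \<comment> \<open>An intersection can only lower the exponent, so two null events are never
      negatively correlated.\<close>
    have "q ^ (m * (d choose k) + m * ((d choose k) - (sdim (H' \<inter> H) choose k))) \<le> q ^ (2 * (m * (d choose k)))"
      using q_ge_2 by (intro power_increasing) (auto simp: mult_2)
    then have "card {\<theta>\<in>forms. null_on k W \<theta> H \<and> null_on k W \<theta> H'} * q ^ (m * (d choose k) + m * ((d choose k) - (sdim (H' \<inter> H) choose k)))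
      \<le> card {\<theta>\<in>forms. null_on k W \<theta> H \<and> null_on k W \<theta> H'} * q ^ (2 * (m * (d choose k)))"
      by (rule mult_le_mono2)
    moreover have d: "subspace K H V" "sdim H = d" "subspace K H' V" "sdim H' = d"
      using grassmannianD[OF that(1)] grassmannianD[OF that(2)] by auto
    ultimately show ?thesis using card_null_on_pair[OF d(3,1)] unfolding d by simp
  qed
  show "\<exists>S \<subseteq> grassmannian K r V - {H}. q ^ c \<le> card S + 1 \<and>
      (\<forall>H'\<in>S. card {\<theta>\<in>forms. null_on k W \<theta> H \<and> null_on k W \<theta> H'} * q ^ (m * (2 * (r choose k) - (r - 1 choose k))) = card forms)"
    if "H \<in> grassmannian K r V" for H
  proof (rule null_near_exists[OF that _ assms(5)])
    have "1 \<le> k ^ 3" using assms(1) by simp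
    then show "1 \<le> r" using assms(3) unfolding sufficiently_large_def by linarith
  qed
  show "(\<Sum>H\<in>grassmannian K d V. real (card {\<theta>\<in>forms. (\<forall>S\<in>set Hs. null_on k W \<theta> S) \<and> null_on k W \<theta> H}))
      \<le> real (card {\<theta>\<in>forms. \<forall>S\<in>set Hs. null_on k W \<theta> S}) *
        (\<Sum>j\<le>d. 16 * real q ^ (j * (length Hs * d - j) + (d - j) * (r + c - d)) / real q ^ (m * ((d choose k) - (j choose k))))"
    if "d \<le> r + c" "set Hs \<subseteq> grassmannian K d V" for d Hs
    using card_null_on_step[of d Hs] that assms(5) by simp
  show "q ^ r \<le> card {H\<in>grassmannian K r V. null_on k W \<theta> H}"
    if "\<theta> \<in> forms" "T \<in> grassmannian K (Suc r) V" "null_on k W \<theta> T" for \<theta> T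
  proof -
    have T: "subspace K T V" "sdim T = Suc r" using grassmannianD[OF that(2)] by auto
    \<comment> \<open>A space of dimension \<open>r + 1\<close> has at least \<open>q ^ r\<close>
      hyperplanes; they inherit nullity.\<close>
    have "real q ^ ((Suc r - r) * (r - 0)) \<le> real (card (between (span {}) T r))"
      using card_between_bounds(1)[OF zero_subspace(1) T(1) zero_subspace(3)[OF T(1)], of r] T(2) zero_subspace(2) by simp
    then have "real (q ^ r) \<le> real (card (between (span {}) T r))" by simp
    then have "q ^ r \<le> card (between (span {}) T r)" by (simp only: of_nat_le_iff)
    also have "between (span {}) T r \<subseteq> {H\<in>grassmannian K r V. null_on k W \<theta> H}"
      unfolding between_def grassmannian_def
      using null_on_mono[OF that(1) W subspace_subset[OF T(1)] _ that(3)] by auto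
    then have "card (between (span {}) T r) \<le> card {H\<in>grassmannian K r V. null_on k W \<theta> H}"
      by (intro card_mono) (auto simp: finite_grassmannian)
    finally show ?thesis .
  qed
qed (use assms in auto)

end

end

section \<open>Poisson and binomial comparison\<close>

lemma exp_4_le: "exp (4::real) \<le> 128"
proof -
  have "exp (4::real) = exp 1 ^ 4" by (simp flip: exp_of_nat_mult)
  also have "\<dots> \<le> 3 ^ 4" using exp_le by (intro power_mono) auto
  finally show ?thesis by simp
qed

text \<open>Markov's inequality for \<open>2 ^ n\<close>. Bounded partial sums suffice, the tail
  being the limit of its finite pieces.\<close>

lemma prob_atLeast_le:
  fixes D :: "nat pmf"
  assumes "\<And>N. (\<Sum>n\<le>N. 2 ^ n * pmf D n) \<le> C"
  shows "measure_pmf.prob D {M..} \<le> C / 2 ^ M"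
proof -
  have "(\<lambda>N. measure_pmf.prob D {M..N}) \<longlonglongrightarrow> measure_pmf.prob D (\<Union>N. {M..N})"
    by (rule measure_pmf.finite_Lim_measure_incseq) (auto simp: incseq_def)
  moreover have "(\<Union>N. {M..N}) = {M..}" by auto
  moreover have "measure_pmf.prob D {M..N} \<le> C / 2 ^ M" for N
  proof -
    have "measure_pmf.prob D {M..N} = (\<Sum>n\<in>{M..N}. pmf D n)" by (simp add: measure_measure_pmf_finite)
    also have "\<dots> \<le> (\<Sum>n\<in>{M..N}. 2 ^ n * pmf D n / 2 ^ M)"
    proof (rule sum_mono)
      fix n assume "n \<in> {M..N}"
      then have "(2::real) ^ M \<le> 2 ^ n" by (intro power_increasing) auto
      then have "2 ^ M * pmf D n \<le> 2 ^ n * pmf D n" by (rule mult_right_mono) simp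
      then show "pmf D n \<le> 2 ^ n * pmf D n / 2 ^ M" by (simp add: le_divide_eq mult.commute)
    qed
    also have "\<dots> = (\<Sum>n\<in>{M..N}. 2 ^ n * pmf D n) / 2 ^ M" by (simp add: sum_divide_distrib)
    also have "\<dots> \<le> (\<Sum>n\<le>N. 2 ^ n * pmf D n) / 2 ^ M"
      by (intro divide_right_mono sum_mono2) auto
    also have "\<dots> \<le> C / 2 ^ M" using assms by (intro divide_right_mono) auto
    finally show ?thesis .
  qed
  ultimately show ?thesis by (intro LIMSEQ_le_const2) auto
qed

text \<open>The factor \<open>n * (n - 1)\<close> shifts the index by two and leaves at most
  \<open>A\<close> times the mass of another probability law \<open>D'\<close>.\<close>

lemma factorial_moment_le:
  fixes D D' :: "nat pmf"
  assumes "0 \<le> A" "\<And>n. real (n + 2) * real (n + 1) * pmf D (n + 2) \<le> A * pmf D' n"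
  shows "(\<Sum>n\<le>N. real n * (real n - 1) * pmf D n) \<le> A"
proof -
  let ?f = "\<lambda>n. real n * (real n - 1) * pmf D n"
  have f0: "0 \<le> ?f n" for n by (cases n) auto
  have "(\<Sum>n\<le>N. ?f n) \<le> (\<Sum>n\<le>Suc (Suc N). ?f n)" using f0 by (intro sum_mono2) auto
  also have "\<dots> = (\<Sum>n\<le>N. ?f (Suc (Suc n)))" by (simp only: sum.atMost_Suc_shift) simp
  also have "\<dots> \<le> (\<Sum>n\<le>N. A * pmf D' n)"
  proof (rule sum_mono)
    fix n show "?f (Suc (Suc n)) \<le> A * pmf D' n" using assms(2)[of n] by (simp add: algebra_simps)
  qed
  also have "\<dots> = A * measure_pmf.prob D' {..N}"
    by (simp add: measure_measure_pmf_finite sum_distrib_left)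
  also have "\<dots> \<le> A * 1" using assms(1) measure_pmf.prob_le_1 by (rule mult_left_mono[rotated])
  finally show ?thesis by simp
qed

text \<open>The mean of \<open>2 ^ n\<close> is \<open>exp \<mu>\<close>, so that 128 serves every
  mean up to 4; for the second moment the shifted law is the Poisson law itself.\<close>

lemma poisson_moments:
  assumes "0 < \<mu>" "\<mu> \<le> 4"
  shows "measure_pmf.prob (poisson_pmf \<mu>) {M..} \<le> 128 / 2 ^ M"
    "(\<Sum>n\<le>N. real n * (real n - 1) * pmf (poisson_pmf \<mu>) n) \<le> \<mu>\<^sup>2"
proof -
  show "measure_pmf.prob (poisson_pmf \<mu>) {M..} \<le> 128 / 2 ^ M"
  proof (rule prob_atLeast_le)
    fix N
    have "(\<Sum>n\<le>N. 2 ^ n * pmf (poisson_pmf \<mu>) n) = (\<Sum>n\<le>N. (2 * \<mu>) ^ n /\<^sub>R fact n) * exp (- \<mu>)"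
      unfolding sum_distrib_right
      by (intro sum.cong refl) (use assms in \<open>simp add: power_mult_distrib field_simps\<close>)
    also have "(\<Sum>n\<le>N. (2 * \<mu>) ^ n /\<^sub>R fact n) \<le> exp (2 * \<mu>)"
      unfolding exp_def using assms by (intro sum_le_suminf summable_exp_generic) auto
    also have "exp (2 * \<mu>) * exp (- \<mu>) = exp \<mu>" by (simp flip: exp_add)
    also have "\<dots> \<le> exp 4" using assms by simp
    also have "\<dots> \<le> 128" by (rule exp_4_le)
    finally show "(\<Sum>n\<le>N. 2 ^ n * pmf (poisson_pmf \<mu>) n) \<le> 128" by simp
  qed
  show "(\<Sum>n\<le>N. real n * (real n - 1) * pmf (poisson_pmf \<mu>) n) \<le> \<mu>\<^sup>2"
  proof (rule factorial_moment_le[where D' = "poisson_pmf \<mu>"])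
    fix n
    have "fact (n + 2) = real (n + 2) * real (n + 1) * fact n" by (simp add: fact_reduce algebra_simps)
    then show "real (n + 2) * real (n + 1) * pmf (poisson_pmf \<mu>) (n + 2) \<le> \<mu>\<^sup>2 * pmf (poisson_pmf \<mu>) n"
      using assms by (simp add: power2_eq_square divide_simps)
  qed simp
qed

text \<open>The mean of \<open>2 ^ n\<close> is \<open>(1 + p) ^ n0 \<le> exp \<mu>\<close>, and the
  second factorial moment is \<open>n0 * (n0 - 1) * p ^ 2\<close>. The bounds coincide with the
  Poisson ones, so that one lower bound serves both comparison laws.\<close>

lemma binomial_moments:
  assumes p: "0 \<le> p" "p \<le> 1" and mu: "real n0 * p = \<mu>" "\<mu> \<le> 4"
  shows "measure_pmf.prob (binomial_pmf n0 p) {M..} \<le> 128 / 2 ^ M"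
    "(\<Sum>n\<le>N. real n * (real n - 1) * pmf (binomial_pmf n0 p) n) \<le> \<mu>\<^sup>2"
proof -
  show "measure_pmf.prob (binomial_pmf n0 p) {M..} \<le> 128 / 2 ^ M"
  proof (rule prob_atLeast_le)
    fix N
    have "(\<Sum>n\<le>N. 2 ^ n * pmf (binomial_pmf n0 p) n) \<le> (\<Sum>n\<le>N + n0. 2 ^ n * pmf (binomial_pmf n0 p) n)"
      by (intro sum_mono2) auto
    also have "\<dots> = (\<Sum>n\<le>n0. 2 ^ n * pmf (binomial_pmf n0 p) n)"
      using p by (intro sum.mono_neutral_right) (auto simp: binomial_eq_0)
    also have "\<dots> = (\<Sum>n\<le>n0. real (n0 choose n) * (2 * p) ^ n * (1 - p) ^ (n0 - n))"
      using p by (simp add: power_mult_distrib mult_ac)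
    also have "\<dots> = (2 * p + (1 - p)) ^ n0" by (simp only: binomial_ring)
    also have "\<dots> \<le> exp p ^ n0"
    proof (rule power_mono)
      show "2 * p + (1 - p) \<le> exp p" using exp_ge_add_one_self[of p] by linarith
    qed (use p in simp)
    also have "\<dots> = exp \<mu>" using mu(1) by (simp flip: exp_of_nat_mult)
    also have "\<dots> \<le> exp 4" using mu by simp
    also have "\<dots> \<le> 128" by (rule exp_4_le)
    finally show "(\<Sum>n\<le>N. 2 ^ n * pmf (binomial_pmf n0 p) n) \<le> 128" .
  qed
  show "(\<Sum>n\<le>N. real n * (real n - 1) * pmf (binomial_pmf n0 p) n) \<le> \<mu>\<^sup>2"
  proof (rule factorial_moment_le[where D' = "binomial_pmf (n0 - 2) p"])
    fix n
    show "real (n + 2) * real (n + 1) * pmf (binomial_pmf n0 p) (n + 2) \<le> \<mu>\<^sup>2 * pmf (binomial_pmf (n0 - 2) p) n"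
    proof (cases "n0 \<ge> 2")
      case True
      then obtain n1 where n1: "n0 = Suc (Suc n1)" by (metis add_2_eq_Suc le_Suc_ex)
      \<comment> \<open>Absorption, applied twice, removes \<open>n + 2\<close> and
        \<open>n + 1\<close>; \<open>Suc n0 - 1\<close> is just \<open>n0\<close>.\<close>
      have "Suc (Suc n) * (Suc n0 - 1 choose Suc (Suc n)) = n0 * (Suc n1 choose Suc n)"
        unfolding n1 using Suc_times_binomial_eq[of "Suc n1" "Suc n"] by (simp add: mult.commute)
      moreover have "Suc n * (Suc n1 choose Suc n) = Suc n1 * (n1 choose n)"
        using Suc_times_binomial_eq[of n1 n] by (simp add: mult.commute)
      ultimately have "Suc (Suc n) * Suc n * (n0 choose Suc (Suc n)) = n0 * Suc n1 * (n1 choose n)"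
        by (metis diff_Suc_1 mult.assoc mult.left_commute)
      then have "real (Suc (Suc n) * Suc n * (n0 choose Suc (Suc n))) = real (n0 * Suc n1 * (n1 choose n))" by simp
      then have e: "real (n + 2) * real (n + 1) * real (n0 choose (n + 2)) = real n0 * real (Suc n1) * real (n1 choose n)"
        by (simp only: of_nat_mult add_2_eq_Suc' Suc_eq_plus1[symmetric])
      have "real (n + 2) * real (n + 1) * pmf (binomial_pmf n0 p) (n + 2)
         = (real (n + 2) * real (n + 1) * real (n0 choose (n + 2))) * p ^ (n + 2) * (1 - p) ^ (n0 - (n + 2))"
        using p by simp
      also have "\<dots> = (real n0 * p) * (real (Suc n1) * p) * pmf (binomial_pmf (n0 - 2) p) n"
        unfolding e using p by (simp add: n1)
      also have "\<dots> \<le> (real n0 * p) * (real n0 * p) * pmf (binomial_pmf (n0 - 2) p) n"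
        using p n1 by (intro mult_right_mono mult_left_mono) auto
      finally show ?thesis by (simp add: mu(1) power2_eq_square)
    qed (use p in \<open>simp add: binomial_eq_0\<close>)
  qed simp
qed

context null_model
begin

lemma expectation_X: "measure_pmf.expectation (map_pmf X (pmf_of_set L)) real = mu"
proof -
  have "measure_pmf.expectation (map_pmf X (pmf_of_set L)) real = (\<Sum>\<theta>\<in>L. real (X \<theta>)) / card L"
    using finL neL by (simp add: integral_pmf_of_set)
  also have "(\<Sum>\<theta>\<in>L. real (X \<theta>)) = (\<Sum>H\<in>G r. card L / real q ^ (m * (r choose k)))"
    unfolding X_def sum_count[OF finG] using card_null by (intro sum.cong) auto
  also have "\<dots> / card L = mu" unfolding mu_def rc using nL by simp
  finally show ?thesis .
qed

end

section \<open>From coordinate spaces to the three distances\<close>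

lemma coord_space_simps:
  assumes "field F" "finite (carrier F)"
  shows "finite_vectorspace F (coord_space F n)" "module F (coord_space F n)"
    "card (carrier (coord_space F n)) = card (carrier F) ^ n"
proof -
  interpret F: field F by fact
  show mod: "module F (coord_space F n)" unfolding coord_space_def by (rule F.func_space_is_module)
  have car: "carrier (coord_space F n) = {..<n} \<rightarrow>\<^sub>E carrier F" by (simp add: coord_space_def F.func_space_def)
  show "card (carrier (coord_space F n)) = card (carrier F) ^ n" unfolding car by (simp add: card_PiE)
  have "finite (carrier (coord_space F n))" unfolding car using assms(2) by (intro finite_PiE) auto
  then show "finite_vectorspace F (coord_space F n)"
    using mod assms by (simp add: finite_vectorspace_def finite_vectorspace_axioms_def vectorspace_def)
qed

text \<open>The total mass, read off as a natural number, is a statistic of the process and is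
  compared with the number of null spaces.\<close>

lemma count_poisson_process:
  assumes "finite S" "S \<noteq> {}" "p > 0"
  shows "map_pmf (\<lambda>\<xi>. nat \<lfloor>enn2real (emeasure \<xi> S)\<rfloor>) (poisson_process S (\<lambda>_. p)) = poisson_pmf (real (card S) * p)"
proof -
  have "map_pmf (\<lambda>\<xi>. nat \<lfloor>enn2real (emeasure \<xi> S)\<rfloor>) (poisson_process S (\<lambda>_. p))
      = map_pmf (\<lambda>x. nat \<lfloor>enn2real x\<rfloor>) (map_pmf (\<lambda>\<xi>. emeasure \<xi> S) (poisson_process S (\<lambda>_. p)))"
    by (simp add: map_pmf_comp)
  also have "map_pmf (\<lambda>\<xi>. emeasure \<xi> S) (poisson_process S (\<lambda>_. p)) = map_pmf of_nat (poisson_pmf (\<Sum>x\<in>S. p))"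
    by (rule poisson_process_count) (use assms in auto)
  also have "map_pmf (\<lambda>x. nat \<lfloor>enn2real x\<rfloor>) \<dots> = poisson_pmf (\<Sum>x\<in>S. p)"
    by (simp add: map_pmf_comp ennreal_of_nat_eq_real_of_nat)
  finally show ?thesis by simp
qed

text \<open>The error \<open>(2 * k ^ 2 + 24) / r\<close> depends on \<open>k\<close> and
  \<open>r\<close> alone; this is the uniformity in \<open>q\<close> and \<open>m\<close>.\<close>

definition rate_bound :: "nat \<Rightarrow> nat \<Rightarrow> real \<Rightarrow> nat \<Rightarrow> real" where
  "rate_bound k m q r = q powr (- ((real k - 1) / fact k + (2 * real k ^ 2 + 24) / real r) * real m * real r ^ (k - 1))"

text \<open>Statistics reduce the random objects to laws on the natural numbers: the cardinality for
  random sets, the total mass for point processes.\<close>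

lemma tv_dist_bounds:
  fixes F :: "'a ring"
  assumes F: "field F" "finite (carrier F)" and k: "3 \<le> k" and m: "1 \<le> m" and sufficiently_large: "sufficiently_large k r"
    and c: "real c = real m / real r * real (r choose k)" and N: "N = r + c"
  defines "b \<equiv> rate_bound k m (real (card (carrier F))) r"
    and "G \<equiv> grassmannian F r (coord_space F N)" and "p \<equiv> null_prob F k m r"
  shows "b \<le> tv_dist (null_count_law F k m N r) (poisson_pmf (null_mean F k m N r))"
    and "b \<le> tv_dist (null_set_law F k m N r) (bernoulli_set_law G p)"
    and "b \<le> tv_dist (null_process_law F k m N r) (poisson_process G (\<lambda>_. p))"
proof -
  let ?V = "coord_space F N" and ?W = "coord_space F m"
  interpret V: finite_vectorspace F ?V by (rule coord_space_simps(1)[OF F])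
  have "0 < k ^ 3" using k by simp
  then have r0: "0 < r" using sufficiently_large unfolding sufficiently_large_def by linarith
  have "real (r * c) = real (m * (r choose k))" using c r0 by simp
  then have rc: "r * c = m * (r choose k)" by (simp only: of_nat_eq_iff)
  have dimV: "V.sdim (carrier ?V) = r + c"
    using V.sdim_unique[OF V.subspace_carrier] coord_space_simps(3)[OF F] N by blast
  let ?L = "lin_maps F (exterior_power F k ?V) ?W"
  interpret M: null_model "card (carrier F)" k r m c ?L "\<lambda>d. grassmannian F d ?V" "V.null_on k ?W"
    by (rule V.exterior_null_model[OF _ coord_space_simps(2)[OF F] coord_space_simps(3)[OF F] k m sufficiently_large rc dimV])
      (use k in simp)
  have ns: "null_spaces F k m N r \<theta> = {H\<in>G. V.null_on k ?W \<theta> H}" for \<theta>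
    unfolding null_spaces_def V.null_on_def G_def by simp
  have count: "null_count_law F k m N r = map_pmf M.X (pmf_of_set ?L)"
    unfolding null_count_law_def null_set_law_def random_form_def map_pmf_comp ns M.X_def G_def ..
  have mean: "null_mean F k m N r = M.mu" unfolding null_mean_def count by (rule M.expectation_X)
  have finG: "finite G" unfolding G_def by (rule M.finG)
  have p: "p = 1 / real (card (carrier F)) ^ (r * c)" unfolding p_def null_prob_def rc ..
  have p01: "0 < p" "p \<le> 1" unfolding p using M.q_pos by simp_all
  have Gp: "real (card G) * p = M.mu" unfolding M.mu_def p G_def by simp
  have Gne: "G \<noteq> {}" using Gp M.mu_bounds by auto
  note lower = M.tv_lower_bound[folded rate_bound_def b_def, folded count]
  note pois = poisson_moments[of M.mu]
  show "b \<le> tv_dist (null_count_law F k m N r) (poisson_pmf (null_mean F k m N r))"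
    unfolding mean using M.mu_bounds by (intro lower pois) auto
  show "b \<le> tv_dist (null_set_law F k m N r) (bernoulli_set_law G p)"
  proof -
    \<comment> \<open>The number of retained spaces is binomial with mean \<open>M.mu\<close>, and
      \<open>tv_lower_bound\<close> accepts this law as it does the Poisson law.\<close>
    have "map_pmf card (bernoulli_set_law G p) = binomial_pmf (card G) p"
      unfolding bernoulli_set_law_def map_pmf_comp
      using binomial_pmf_altdef'[OF finG refl, of p False] p01 by simp
    moreover have "b \<le> tv_dist (null_count_law F k m N r) (binomial_pmf (card G) p)"
      using p01 M.mu_bounds Gp by (intro lower binomial_moments) auto
    ultimately have "b \<le> tv_dist (map_pmf card (null_set_law F k m N r)) (map_pmf card (bernoulli_set_law G p))"
      unfolding null_count_law_def by simp
    also have "\<dots> \<le> tv_dist (null_set_law F k m N r) (bernoulli_set_law G p)" by (rule tv_dist_map_le)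
    finally show ?thesis .
  qed
  show "b \<le> tv_dist (null_process_law F k m N r) (poisson_process G (\<lambda>_. p))"
  proof -
    let ?h = "\<lambda>\<xi>. nat \<lfloor>enn2real (emeasure \<xi> G)\<rfloor>"
    have "?h (atomic_measure G (indicator (null_spaces F k m N r \<theta>))) = card (null_spaces F k m N r \<theta>)" for \<theta>
    proof -
      have "null_spaces F k m N r \<theta> \<subseteq> G" unfolding ns by auto
      then have "(\<Sum>x\<in>G. indicator (null_spaces F k m N r \<theta>) x) = card (null_spaces F k m N r \<theta>)"
        using finG by (simp add: indicator_def sum.If_cases Int_absorb1)
      then show ?thesis by (simp add: emeasure_atomic_measure[OF finG] ennreal_of_nat_eq_real_of_nat)
    qed
    then have 1: "map_pmf ?h (null_process_law F k m N r) = null_count_law F k m N r"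
      unfolding null_process_law_def null_count_law_def null_set_law_def G_def[symmetric] map_pmf_comp by simp
    have "b \<le> tv_dist (null_count_law F k m N r) (poisson_pmf M.mu)"
      using M.mu_bounds by (intro lower pois) auto
    also have "\<dots> = tv_dist (map_pmf ?h (null_process_law F k m N r)) (map_pmf ?h (poisson_process G (\<lambda>_. p)))"
      unfolding 1 count_poisson_process[OF finG Gne p01(1)] Gp ..
    also have "\<dots> \<le> tv_dist (null_process_law F k m N r) (poisson_process G (\<lambda>_. p))" by (rule tv_dist_map_le)
    finally show ?thesis .
  qed
qed

text \<open>Taking logarithms bounds the rate by \<open>(k - 1) / fact k\<close> plus a multiple of
  \<open>1 / r i\<close>. As \<open>rate_bound\<close> is positive, so is \<open>d i\<close>
  eventually, and the value \<open>\<infinity>\<close> of \<open>neg_log\<close> is avoided.\<close>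

lemma limsup_rate_le:
  fixes q d :: "nat \<Rightarrow> real" and r m :: "nat \<Rightarrow> nat"
  assumes r: "filterlim r at_top sequentially" and q: "\<And>i. 1 < q i" and m: "\<And>i. 1 \<le> m i"
    and ev: "eventually (\<lambda>i. rate_bound k (m i) (q i) (r i) \<le> d i) sequentially"
  shows "limsup (\<lambda>i. neg_log (q i) (d i) / ereal (real (m i) * real (r i) ^ (k - 1))) \<le> ereal ((real k - 1) / fact k)"
proof -
  let ?C = "(2 * real k ^ 2 + 24)" and ?chi = "(real k - 1) / fact k"
  have "eventually (\<lambda>i. 1 \<le> r i) sequentially" using r by (auto simp: filterlim_at_top)
  then have "eventually (\<lambda>i. neg_log (q i) (d i) / ereal (real (m i) * real (r i) ^ (k - 1)) \<le> ereal (?chi + ?C / real (r i))) sequentially"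
    using ev
  proof eventually_elim
    case (elim i)
    define S where "S = real (m i) * real (r i) ^ (k - 1)"
    have S: "S > 0" unfolding S_def using m[of i] elim by simp
    have e: "- (?chi + ?C / real (r i)) * real (m i) * real (r i) ^ (k - 1) = - ((?chi + ?C / real (r i)) * S)"
      unfolding S_def by (simp only: mult_minus_left mult.assoc)
    have b: "q i powr (- ((?chi + ?C / real (r i)) * S)) \<le> d i"
      using elim(2) unfolding rate_bound_def e .
    have q1: "1 < q i" by (rule q)
    then have d: "0 < d i" using b powr_gt_zero[of "q i"] by (smt (verit))
    have "- ((?chi + ?C / real (r i)) * S) \<le> log (q i) (d i)"
      using log_le_cancel_iff[OF q1 _ d, of "q i powr (- ((?chi + ?C / real (r i)) * S))"] b q1 by simp
    then have "- log (q i) (d i) \<le> (?chi + ?C / real (r i)) * S" by linarith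
    then have "- log (q i) (d i) / S \<le> ?chi + ?C / real (r i)" using S by (simp only: pos_divide_le_eq)
    then show ?case using d S unfolding neg_log_def S_def[symmetric] by simp
  qed
  then have "limsup (\<lambda>i. neg_log (q i) (d i) / ereal (real (m i) * real (r i) ^ (k - 1))) \<le> limsup (\<lambda>i. ereal (?chi + ?C / real (r i)))"
    by (rule Limsup_mono)
  also have "(\<lambda>i. ?chi + ?C / real (r i)) \<longlonglongrightarrow> ?chi + 0"
    using r by (intro tendsto_intros tendsto_divide_0[OF tendsto_const] filterlim_at_top_imp_at_infinity filterlim_compose[OF filterlim_real_sequentially])
  then have "(\<lambda>i. ereal (?chi + ?C / real (r i))) \<longlonglongrightarrow> ereal ?chi" by simp
  then have "limsup (\<lambda>i. ereal (?chi + ?C / real (r i))) = ereal ?chi"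
    by (intro lim_imp_Limsup) auto
  finally show ?thesis .
qed

theorem proposition6p13:
  fixes k :: nat
  assumes "k \<ge> 3"
  shows
    "(\<exists>\<epsilon> :: nat \<Rightarrow> real. \<epsilon> \<longlonglongrightarrow> 0 \<and>
       (\<forall>\<^sub>F r in sequentially. \<forall>(F :: 'a ring) m c N.
          field F \<and> finite (carrier F) \<and> m \<ge> 1 \<and>
          real c = real m / real r * real (r choose k) \<and> N = r + c \<longrightarrow>
          (let bound = real (card (carrier F)) powr
                 (- ((real k - 1) / fact k + \<epsilon> r) * real m * real r ^ (k - 1));
               G = grassmannian F r (coord_space F N);
               p = null_prob F k m r
           in tv_dist (null_count_law F k m N r) (poisson_pmf (null_mean F k m N r)) \<ge> bound \<and>
              tv_dist (null_set_law F k m N r) (bernoulli_set_law G p) \<ge> bound \<and>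
              tv_dist (null_process_law F k m N r) (poisson_process G (\<lambda>_. p)) \<ge> bound))) \<and>
     (\<forall>(r :: nat \<Rightarrow> nat) (F :: nat \<Rightarrow> 'a ring) m c N.
        filterlim r at_top sequentially \<and>
        (\<forall>i. field (F i) \<and> finite (carrier (F i)) \<and> m i \<ge> 1 \<and>
             real (c i) = real (m i) / real (r i) * real (r i choose k) \<and> N i = r i + c i) \<longrightarrow>
        (let q = (\<lambda>i. real (card (carrier (F i))));
             G = (\<lambda>i. grassmannian (F i) (r i) (coord_space (F i) (N i)));
             p = (\<lambda>i. null_prob (F i) k (m i) (r i));
             rate = (\<lambda>i d. neg_log (q i) d / ereal (real (m i) * real (r i) ^ (k - 1)))
         in limsup (\<lambda>i. rate i (tv_dist (null_count_law (F i) k (m i) (N i) (r i))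
                                   (poisson_pmf (null_mean (F i) k (m i) (N i) (r i)))))
              \<le> ereal ((real k - 1) / fact k) \<and>
            limsup (\<lambda>i. rate i (tv_dist (null_set_law (F i) k (m i) (N i) (r i))
                                   (bernoulli_set_law (G i) (p i))))
              \<le> ereal ((real k - 1) / fact k) \<and>
            limsup (\<lambda>i. rate i (tv_dist (null_process_law (F i) k (m i) (N i) (r i))
                                   (poisson_process (G i) (\<lambda>_. p i))))
              \<le> ereal ((real k - 1) / fact k)))"
proof -
  define \<epsilon> where "\<epsilon> r = (2 * real k ^ 2 + 24) / real r" for r
  have eps: "\<epsilon> \<longlonglongrightarrow> 0" unfolding \<epsilon>_def by real_asymp
  show ?thesis
  proof (intro conjI exI[of _ \<epsilon>] allI impI eps, goal_cases)
    case 1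
    show ?case using eventually_sufficiently_large[of k]
    proof eventually_elim
      case (elim r)
      show ?case
      proof (intro allI impI, elim conjE, goal_cases)
        case (1 F m c N)
        then show ?case
          using tv_dist_bounds[OF _ _ assms _ elim, of F m c N] unfolding Let_def rate_bound_def \<epsilon>_def by blast
      qed
    qed
  next
    case (2 r F m c N)
    then have r: "filterlim r at_top sequentially"
      and *: "\<And>i. field (F i)" "\<And>i. finite (carrier (F i))" "\<And>i. 1 \<le> m i"
        "\<And>i. real (c i) = real (m i) / real (r i) * real (r i choose k)" "\<And>i. N i = r i + c i" by auto
    have "eventually (\<lambda>i. sufficiently_large k (r i)) sequentially"
      using eventually_sufficiently_large r by (rule eventually_compose_filterlim)
    then have ev: "eventually (\<lambda>i. rate_bound k (m i) (real (card (carrier (F i)))) (r i) \<le> d i) sequentially"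
      if "\<And>i. sufficiently_large k (r i) \<Longrightarrow> rate_bound k (m i) (real (card (carrier (F i)))) (r i) \<le> d i" for d
      using that by (auto elim: eventually_mono)
    \<comment> \<open>The coordinate space of dimension 0 only serves to make \<open>q_ge_2\<close>
      available for the field.\<close>
    have q: "1 < real (card (carrier (F i)))" for i
      using finite_vectorspace.q_ge_2[OF coord_space_simps(1)[OF *(1)[of i] *(2)[of i], of 0]] by simp
    note bounds = tv_dist_bounds[OF *(1,2) assms *(3) _ *(4,5)]
    show ?case unfolding Let_def
      by (intro conjI limsup_rate_le[OF r q *(3)] ev bounds)
  qed
qed

end
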